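(* Let $\lambda\in(0,1)$ and let $K(\lambda)\subset S^1$ be the set of all $\theta\in S^1$ for which there exists a sequence $(w_j)$ of vectors $w_j=(\lambda+m_j,n_j)\in\mathbb R^2$ with $m_j,n_j\in2\mathbb Z$ and $n_j\neq0$, whose Euclidean lengths $|w_j|$ are increasing, such that $$\sum_j |w_j\times w_{j+1}|<\infty$$ and $w_j/|w_j|\to\theta$ as $j\to\infty$. If $\lambda$ is Diophantine, then the Hausdorff dimension of $K(\lambda)$ is $1/2$.
   Context: For $w=(x,y)$, $w'=(x',y')$ in $\mathbb R^2$, $w\times w'=xy'-x'y$. The number $\lambda$ is Diophantine if there is an exponent $e>0$ such that the inequality $\left|\lambda-\frac pq\right|\le \frac1{|q|^e}$ has at most finitely many integer solutions $(p,q)$, $q\neq0$. *)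

theory Defs
  imports "HOL-Analysis.Analysis"
begin

definition cross2 :: "real \<times> real \<Rightarrow> real \<times> real \<Rightarrow> real" where
  "cross2 w w' = fst w * snd w' - fst w' * snd w"

definition diophantine :: "real \<Rightarrow> bool" where
  "diophantine l \<longleftrightarrow>
     (\<exists>e::real. e > 0 \<and>
       finite {(p::int, q::int). q \<noteq> 0 \<and>
         \<bar>l - real_of_int p / real_of_int q\<bar> \<le> 1 / \<bar>real_of_int q\<bar> powr e})"

(* The s-th power of the diameter of a bounded set. Since 0 powr 0 = 0 in the library,
   s = 0 is treated separately, so that the 0-dimensional measure is counting measure. *)
definition diam_pow :: "real \<Rightarrow> 'a::metric_space set \<Rightarrow> ennreal" where
  "diam_pow s U =
     (if U = {} then 0 else if s = 0 then 1 else ennreal (diameter U powr s))"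

(* Covers are indexed by nat; finite covers are included because empty sets contribute 0.
   Boundedness is required because diameter has no meaningful value on unbounded sets. *)
definition hausdorff_premeasure :: "real \<Rightarrow> real \<Rightarrow> 'a::metric_space set \<Rightarrow> ennreal" where
  "hausdorff_premeasure s \<delta> A =
     Inf {(\<Sum>i. diam_pow s (U i)) | U :: nat \<Rightarrow> 'a set.
            A \<subseteq> (\<Union>i. U i) \<and> (\<forall>i. bounded (U i) \<and> diameter (U i) \<le> \<delta>)}"

definition hausdorff_measure :: "real \<Rightarrow> 'a::metric_space set \<Rightarrow> ennreal" where
  "hausdorff_measure s A = (SUP \<delta>\<in>{0<..}. hausdorff_premeasure s \<delta> A)"

definition hausdorff_dim :: "'a::metric_space set \<Rightarrow> ereal" where
  "hausdorff_dim A = Inf {ereal s | s. 0 \<le> s \<and> hausdorff_measure s A = 0}"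

(* The norm on pairs of reals is the Euclidean norm of the plane, so sphere 0 1 is the
   unit circle. *)
definition K :: "real \<Rightarrow> (real \<times> real) set" where
  "K l = {\<theta> \<in> sphere 0 1.
     \<exists>w :: nat \<Rightarrow> real \<times> real.
       (\<forall>j. \<exists>m n :: int. even m \<and> even n \<and> n \<noteq> 0 \<and>
              w j = (l + real_of_int m, real_of_int n)) \<and>
       strict_mono (\<lambda>j. norm (w j)) \<and>
       summable (\<lambda>j. \<bar>cross2 (w j) (w (Suc j))\<bar>) \<and>
       (\<lambda>j. w j /\<^sub>R norm (w j)) \<longlonglongrightarrow> \<theta>}"

end

theory Submission
  imports Defs "HOL-Computational_Algebra.Primes"
begin

text \<open>
  \<^bold>\<open>Setting.\<close> Halving the vectors of a sequence and writing \<open>\<mu> = l / 2\<close> turns them into vectors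
  \<open>w = (\<mu> + a, b)\<close> with integers \<open>a\<close> and \<open>b\<close>, called slits here. Two consecutive slits differ by \<open>d * u\<close> with
  an integer \<open>d\<close> and a primitive integer vector \<open>u\<close>, and their cross product is \<open>d\<close> times that of \<open>w\<close> and
  \<open>u\<close>. So both slits are nearly parallel to \<open>u\<close>. Slits are never parallel to integer vectors because \<open>\<mu>\<close>
  is irrational.

  \<^bold>\<open>Upper bound.\<close> The limit direction of a sequence that starts along \<open>u\<close> is within a constant times
  \<open>1 / norm u ^ 2\<close> of the direction of \<open>u\<close>. The sequence cannot go on along \<open>u\<close> forever. At the slit \<open>w\<close> where it
  turns to another direction \<open>u'\<close>, both \<open>u\<close> and \<open>u'\<close> are nearly parallel to \<open>w\<close>; since nonparallel integer
  vectors have cross product at least one, \<open>u'\<close> is longer than \<open>w\<close> by a large factor of order \<open>1 / \<epsilon>\<close>. About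
  \<open>X / norm w\<close> primitive vectors of length about \<open>X\<close> qualify as \<open>u'\<close>, because primitive vectors of that length are
  \<open>1 / X ^ 2\<close> apart in direction, and the possible \<open>w\<close> lie on a line with spacing \<open>norm u\<close>. Hence for \<open>s > 1/2\<close> the sum of
  \<open>norm u' powr (- 2 * s)\<close> over all \<open>w\<close> and \<open>u'\<close> is at most half of \<open>norm u powr (- 2 * s)\<close> when \<open>\<epsilon>\<close> is
  small (\<open>path_limits_content_step\<close>), and iterating this shows that the \<open>s\<close>-dimensional content is zero.

  \<^bold>\<open>Lower bound.\<close> Take \<open>\<tau>\<close> slightly above one and heights \<open>H k\<close> with \<open>H (Suc k) = H k powr \<tau>\<close>. The children of a
  slit \<open>w\<close> of height about \<open>H = H k\<close> are the slits \<open>w + u\<close> where \<open>u\<close> is primitive, of height about \<open>H powr \<tau>\<close>, and has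
  cross product at most \<open>H powr (- \<eta>)\<close> with \<open>w\<close>. If the integer vectors are evenly distributed in the strip
  along \<open>w\<close>, then there are about \<open>H powr (\<tau> - 1 - \<eta>)\<close> children. Their directions are about \<open>H powr (- 2 * \<tau>)\<close>
  apart, and the resulting Cantor set has dimension about \<open>1 / (1 + \<tau>)\<close> (\<open>hausdorff_content_neq_0\<close>),
  which tends to \<open>1/2\<close> as \<open>\<tau>\<close> tends to one.

  Even distribution fails only if some integer vector \<open>v\<close> not much longer than \<open>w\<close> is too nearly parallel to
  \<open>w\<close>. A slit without such a \<open>v\<close> is good, and the point is that most children of a good slit are good. If
  \<open>v\<close> spoils the child \<open>w + u\<close>, then the cross product of \<open>w\<close> and \<open>v\<close> is extremely close to an integer \<open>k\<close>, and
  the vectors with the same \<open>k\<close> differ by vectors that are extremely parallel to \<open>w\<close>; goodness of \<open>w\<close>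
  makes these long, so the vectors \<open>v\<close> are few (\<open>few_bad_children\<close>). This controls the children with slightly worse
  exponents than those assumed for \<open>w\<close>. The closeness exponent, however, gains a factor \<open>\<tau>\<close> in each step, so goodness is
  required for a finite ladder of exponents, whose top holds for every slit because \<open>\<mu>\<close> is
  Diophantine (\<open>good_children\<close>). A first good slit is found by counting modulo a large
  prime (\<open>good_root\<close>).
\<close>

section \<open>Hausdorff content\<close>

text \<open>Whether a Hausdorff measure of positive dimension vanishes does not depend on the bound imposed on the diameters of
  the covering sets. Dropping that bound gives an outer measure with the same null sets that is
  easier to estimate.\<close>

definition hausdorff_content :: "real \<Rightarrow> 'a::metric_space set \<Rightarrow> ennreal" where
  "hausdorff_content s A =
     Inf {(\<Sum>i. diam_pow s (U i)) | U :: nat \<Rightarrow> 'a set. A \<subseteq> (\<Union>i. U i) \<and> (\<forall>i. bounded (U i))}"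

lemma hausdorff_content_le:
  fixes U :: "nat \<Rightarrow> 'a::metric_space set"
  assumes "A \<subseteq> (\<Union>i. U i)" "\<And>i. bounded (U i)"
  shows "hausdorff_content s A \<le> (\<Sum>i. diam_pow s (U i))"
  unfolding hausdorff_content_def by (rule Inf_lower) (use assms in auto)

lemma hausdorff_content_less_cover:
  fixes A :: "'a::metric_space set"
  assumes "hausdorff_content s A < c"
  obtains U :: "nat \<Rightarrow> 'a set"
  where "A \<subseteq> (\<Union>i. U i)" "\<And>i. bounded (U i)" "(\<Sum>i. diam_pow s (U i)) < c"
  using assms unfolding hausdorff_content_def Inf_less_iff by blast

lemma hausdorff_content_mono:
  assumes "A \<subseteq> B"
  shows "hausdorff_content s A \<le> hausdorff_content s B"
  unfolding hausdorff_content_def by (rule Inf_superset_mono) (use assms in blast)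

lemma hausdorff_content_UN_le:
  fixes A :: "nat \<Rightarrow> 'a::metric_space set"
  shows "hausdorff_content s (\<Union>i. A i) \<le> (\<Sum>i. hausdorff_content s (A i))"
proof (rule ennreal_le_epsilon)
  fix e :: real assume fin: "(\<Sum>i. hausdorff_content s (A i)) < top" and e: "0 < e"
  have "\<exists>U :: nat \<Rightarrow> 'a set. A i \<subseteq> (\<Union>j. U j) \<and> (\<forall>j. bounded (U j)) \<and>
      (\<Sum>j. diam_pow s (U j)) \<le> hausdorff_content s (A i) + ennreal (e * (1/2) ^ Suc i)" for i
  proof -
    have "hausdorff_content s (A i) \<le> (\<Sum>i. hausdorff_content s (A i))"
      using sum_le_suminf[of "\<lambda>i. hausdorff_content s (A i)" "{i}"] by simp
    with fin have "hausdorff_content s (A i) \<noteq> top" by (auto simp: top_unique)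
    moreover have "0 < ennreal (e * (1/2) ^ Suc i)" using e by simp
    ultimately have "hausdorff_content s (A i) < hausdorff_content s (A i) + ennreal (e * (1/2) ^ Suc i)"
      using ennreal_add_left_cancel_less[of "hausdorff_content s (A i)" 0] by simp
    then show ?thesis by (metis hausdorff_content_less_cover less_imp_le)
  qed
  then obtain U :: "nat \<Rightarrow> nat \<Rightarrow> 'a set" where U: "\<And>i. A i \<subseteq> (\<Union>j. U i j)" "\<And>i j. bounded (U i j)"
    "\<And>i. (\<Sum>j. diam_pow s (U i j)) \<le> hausdorff_content s (A i) + ennreal (e * (1/2) ^ Suc i)"
    by metis
  define V where "V n = (case prod_decode n of (i, j) \<Rightarrow> U i j)" for n
  have "(\<Union>i. A i) \<subseteq> (\<Union>n. V n)"
  proof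
    fix x assume "x \<in> (\<Union>i. A i)"
    then obtain i j where "x \<in> U i j" using U(1) by blast
    then have "x \<in> V (prod_encode (i, j))" by (simp add: V_def)
    then show "x \<in> (\<Union>n. V n)" by blast
  qed
  moreover have "bounded (V n)" for n by (simp add: V_def U(2) split: prod.split)
  ultimately have "hausdorff_content s (\<Union>i. A i) \<le> (\<Sum>n. diam_pow s (V n))"
    by (rule hausdorff_content_le)
  also have "\<dots> = (\<Sum>n. (case prod_decode n of (i, j) \<Rightarrow> diam_pow s (U i j)))"
    by (simp add: V_def case_prod_beta)
  also have "\<dots> = (\<Sum>i. \<Sum>j. diam_pow s (U i j))"
    by (rule suminf_ennreal_2dimen) auto
  also have "\<dots> \<le> (\<Sum>i. hausdorff_content s (A i) + ennreal (e * (1/2) ^ Suc i))"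
    by (intro suminf_le U summableI)
  also have "\<dots> = (\<Sum>i. hausdorff_content s (A i)) + (\<Sum>i. ennreal (e * (1/2) ^ Suc i))"
    by (rule suminf_add[symmetric]) (auto intro: summableI)
  also have "(\<Sum>i. ennreal (e * (1/2) ^ Suc i)) = ennreal (e * 1)"
    using e by (intro suminf_ennreal_eq sums_mult power_half_series) auto
  finally show "hausdorff_content s (\<Union>i. A i) \<le> (\<Sum>i. hausdorff_content s (A i)) + ennreal e" by simp
qed

lemma diam_pow_empty [simp]: "diam_pow s {} = 0"
  by (simp add: diam_pow_def)

lemma hausdorff_content_bounded_le:
  assumes "bounded A"
  shows "hausdorff_content s A \<le> diam_pow s A"
proof -
  have "hausdorff_content s A \<le> (\<Sum>i. diam_pow s (if i = (0::nat) then A else {}))"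
    by (rule hausdorff_content_le) (use assms in auto)
  also have "\<dots> = (\<Sum>i\<in>{0::nat}. diam_pow s (if i = (0::nat) then A else {}))"
    by (rule suminf_finite) auto
  finally show ?thesis by simp
qed

lemma diameter_le_dist:
  fixes A :: "'a::metric_space set"
  assumes "0 \<le> d" "\<And>x y. x \<in> A \<Longrightarrow> y \<in> A \<Longrightarrow> dist x y \<le> d"
  shows "diameter A \<le> d"
  using assms by (auto simp: diameter_def intro!: cSUP_least)

lemma diam_pow_le:
  fixes A :: "'a::metric_space set"
  assumes "0 < s" "bounded A" "0 \<le> d" "\<And>x y. x \<in> A \<Longrightarrow> y \<in> A \<Longrightarrow> dist x y \<le> d"
  shows "diam_pow s A \<le> ennreal (d powr s)"
  using assms diameter_le_dist[of d A] diameter_ge_0[of A]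
  by (auto simp: diam_pow_def intro!: ennreal_leI powr_mono2)

lemma hausdorff_content_empty [simp]: "hausdorff_content s {} = 0"
  using hausdorff_content_bounded_le[of "{}" s] by simp

lemma hausdorff_content_Un_le:
  "hausdorff_content s (A \<union> B) \<le> hausdorff_content s A + hausdorff_content s B"
proof -
  define C where "C i = (if i = (0::nat) then A else if i = 1 then B else {})" for i
  have "hausdorff_content s (A \<union> B) \<le> hausdorff_content s (\<Union>i. C i)"
    by (rule hausdorff_content_mono) (auto simp: C_def split: if_splits)
  also have "\<dots> \<le> (\<Sum>i. hausdorff_content s (C i))" by (rule hausdorff_content_UN_le)
  also have "\<dots> = (\<Sum>i\<in>{0,1}. hausdorff_content s (C i))"
    by (rule suminf_finite) (auto simp: C_def)
  finally show ?thesis by (simp add: C_def)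
qed

lemma hausdorff_content_finite_UN_le:
  assumes "finite I" "\<And>i. i \<in> I \<Longrightarrow> hausdorff_content s (A i) \<le> c"
  shows "hausdorff_content s (\<Union>i\<in>I. A i) \<le> of_nat (card I) * c"
  using assms
proof (induction I rule: finite_induct)
  case (insert x I)
  have "hausdorff_content s (\<Union>i\<in>insert x I. A i) \<le> hausdorff_content s (A x) + hausdorff_content s (\<Union>i\<in>I. A i)"
    using hausdorff_content_Un_le by simp
  also have "\<dots> \<le> c + of_nat (card I) * c" using insert by (intro add_mono) auto
  finally show ?case using insert by (simp add: algebra_simps)
qed simp

lemma hausdorff_content_countable_UN_zero:
  assumes "countable I" "\<And>i. i \<in> I \<Longrightarrow> hausdorff_content s (A i) = 0"
  shows "hausdorff_content s (\<Union>i\<in>I. A i) = 0"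
proof (cases "I = {}")
  case False
  have "(\<Union>i\<in>I. A i) = (\<Union>n. A (from_nat_into I n))"
    using range_from_nat_into[OF False assms(1)] by (metis image_image)
  then have "hausdorff_content s (\<Union>i\<in>I. A i) \<le> (\<Sum>n. hausdorff_content s (A (from_nat_into I n)))"
    by (simp add: hausdorff_content_UN_le)
  then show ?thesis using assms(2) from_nat_into[OF False] by simp
qed simp

text \<open>A cover of small total cost consists of sets of small diameter, so the diameter bound in the
  definition of the measure comes for free.\<close>

lemma hausdorff_measure_eq_0:
  assumes "0 < s" "hausdorff_content s A = 0"
  shows "hausdorff_measure s A = 0"
proof -
  have "hausdorff_premeasure s \<delta> A \<le> 0" if "0 < \<delta>" for \<delta>
  proof (rule ennreal_le_epsilon)
    fix e :: real assume e: "0 < e"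
    define c where "c = min e (\<delta> powr s)"
    have "0 < c" using e that by (simp add: c_def)
    then have "hausdorff_content s A < ennreal c" using assms by simp
    then obtain U where U: "A \<subseteq> (\<Union>i. U i)" "\<And>i. bounded (U i)" "(\<Sum>i. diam_pow s (U i)) < ennreal c"
      by (rule hausdorff_content_less_cover) blast
    have "diameter (U i) \<le> \<delta>" for i
    proof (cases "U i = {}")
      case True then show ?thesis using that by simp
    next
      case False
      have "diam_pow s (U i) \<le> (\<Sum>i. diam_pow s (U i))"
        using sum_le_suminf[of "\<lambda>i. diam_pow s (U i)" "{i}"] by simp
      also have "\<dots> < ennreal c" by (rule U)
      finally have "ennreal (diameter (U i) powr s) < ennreal c"
        using False assms(1) by (simp add: diam_pow_def)
      then have "diameter (U i) powr s < \<delta> powr s"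
        by (auto simp: c_def ennreal_less_iff)
      then show ?thesis using that assms(1) diameter_ge_0[OF U(2)]
        by (meson less_imp_le not_le powr_mono2)
    qed
    then have "hausdorff_premeasure s \<delta> A \<le> (\<Sum>i. diam_pow s (U i))"
      unfolding hausdorff_premeasure_def by (intro Inf_lower) (use U in auto)
    also have "\<dots> \<le> ennreal e" by (rule order_trans[OF less_imp_le[OF U(3)] ennreal_leI]) (simp add: c_def)
    finally show "hausdorff_premeasure s \<delta> A \<le> 0 + ennreal e" by simp
  qed
  then show ?thesis unfolding hausdorff_measure_def
    by (metis SUP_least bot.extremum_uniqueI bot_ennreal greaterThan_iff)
qed

text \<open>Covers by sets of diameter at most one only get more expensive when the exponent drops.\<close>

lemma hausdorff_measure_neq_0:
  assumes "0 \<le> r" "r \<le> s" "0 < s" "hausdorff_content s A \<noteq> 0"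
  shows "hausdorff_measure r A \<noteq> 0"
proof -
  have "hausdorff_content s A \<le> hausdorff_premeasure r 1 A"
    unfolding hausdorff_premeasure_def
  proof (rule Inf_greatest)
    fix z assume "z \<in> {(\<Sum>i. diam_pow r (U i)) | U :: nat \<Rightarrow> _ set.
            A \<subseteq> (\<Union>i. U i) \<and> (\<forall>i. bounded (U i) \<and> diameter (U i) \<le> 1)}"
    then obtain U where U: "z = (\<Sum>i. diam_pow r (U i))" "A \<subseteq> (\<Union>i. U i)"
      "\<And>i. bounded (U i)" "\<And>i. diameter (U i) \<le> 1" by auto
    have "diam_pow s (U i) \<le> diam_pow r (U i)" for i
    proof -
      have "diameter (U i) powr s \<le> diameter (U i) powr r"
        using assms U diameter_ge_0[OF U(3)] by (intro powr_mono') auto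
      moreover have "diameter (U i) powr s \<le> 1"
        using assms U diameter_ge_0[OF U(3)] by (intro powr_le1) auto
      ultimately show ?thesis using assms by (auto simp: diam_pow_def intro!: ennreal_leI)
    qed
    then have "(\<Sum>i. diam_pow s (U i)) \<le> z" unfolding U by (intro suminf_le summableI)
    then show "hausdorff_content s A \<le> z" using hausdorff_content_le[of A U s] U order_trans by blast
  qed
  also have "\<dots> \<le> hausdorff_measure r A"
    unfolding hausdorff_measure_def by (rule SUP_upper) simp
  finally show ?thesis using assms(4) by auto
qed

lemma hausdorff_dim_eqI:
  assumes d: "0 < d"
    and upper: "\<And>s. d < s \<Longrightarrow> hausdorff_content s A = 0"
    and lower: "\<And>s. 0 < s \<Longrightarrow> s < d \<Longrightarrow> hausdorff_content s A \<noteq> 0"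
  shows "hausdorff_dim A = ereal d"
  unfolding hausdorff_dim_def
proof (rule antisym)
  show "Inf {ereal s |s. 0 \<le> s \<and> hausdorff_measure s A = 0} \<le> ereal d"
  proof (rule ereal_le_epsilon2)
    fix e :: real assume "0 < e"
    then have "hausdorff_measure (d + e) A = 0"
      using d upper[of "d + e"] by (intro hausdorff_measure_eq_0) auto
    then show "Inf {ereal s |s. 0 \<le> s \<and> hausdorff_measure s A = 0} \<le> ereal d + ereal e"
      using d \<open>0 < e\<close> by (intro Inf_lower) auto
  qed
  show "ereal d \<le> Inf {ereal s |s. 0 \<le> s \<and> hausdorff_measure s A = 0}"
  proof (rule Inf_greatest, clarify)
    fix s assume s: "0 \<le> s" "hausdorff_measure s A = 0"
    show "ereal d \<le> ereal s"
    proof (rule ccontr)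
      assume "\<not> ereal d \<le> ereal s"
      then have "s < (s + d) / 2" "(s + d) / 2 < d" by auto
      then show False using hausdorff_measure_neq_0[of s "(s + d) / 2" A] lower[of "(s + d) / 2"] s d
        by auto
    qed
  qed
qed

text \<open>A cover of the image pulls back to a cover of \<open>E\<close> whose diameters are larger by at most the factor \<open>C\<close>.\<close>

lemma hausdorff_content_expanding_le:
  fixes g :: "'a::metric_space \<Rightarrow> 'b::metric_space"
  assumes s: "0 < s" and C: "0 < C"
    and g: "\<And>x y. x \<in> E \<Longrightarrow> y \<in> E \<Longrightarrow> dist x y \<le> C * dist (g x) (g y)"
  shows "hausdorff_content s E \<le> ennreal (C powr s) * hausdorff_content s (g ` E)"
proof -
  define k k' where "k = ennreal (C powr s)" and "k' = ennreal (C powr (- s))"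
  have kk: "k * k' = 1" using C by (simp add: k_def k'_def ennreal_mult'[symmetric] powr_add[symmetric])
  have "k' * hausdorff_content s E \<le> hausdorff_content s (g ` E)"
    unfolding hausdorff_content_def[of s "g ` E"]
  proof (rule Inf_greatest, clarify)
    fix U :: "nat \<Rightarrow> 'b set" assume U: "g ` E \<subseteq> (\<Union>i. U i)" "\<forall>i. bounded (U i)"
    define V where "V i = {x\<in>E. g x \<in> U i}" for i
    have d: "dist x y \<le> C * diameter (U i)" if "x \<in> V i" "y \<in> V i" for x y i
    proof -
      have "dist (g x) (g y) \<le> diameter (U i)"
        using that U(2) by (intro diameter_bounded_bound) (auto simp: V_def)
      then have "C * dist (g x) (g y) \<le> C * diameter (U i)" using C by simp
      then show ?thesis using g[of x y] that by (auto simp: V_def)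
    qed
    have bV: "bounded (V i)" for i unfolding bounded_two_points using d by blast
    have "diam_pow s (V i) \<le> k * diam_pow s (U i)" for i
    proof (cases "V i = {}")
      case False
      then have "U i \<noteq> {}" by (auto simp: V_def)
      have D: "0 \<le> diameter (U i)" using U(2) diameter_ge_0 by blast
      have "diam_pow s (V i) \<le> ennreal ((C * diameter (U i)) powr s)"
        using s C d bV D by (intro diam_pow_le) auto
      also have "\<dots> = k * diam_pow s (U i)"
        using s C \<open>U i \<noteq> {}\<close> D by (auto simp: diam_pow_def powr_mult ennreal_mult k_def)
      finally show ?thesis .
    qed simp
    then have "(\<Sum>i. diam_pow s (V i)) \<le> (\<Sum>i. k * diam_pow s (U i))"
      by (intro suminf_le summableI)
    moreover have "hausdorff_content s E \<le> (\<Sum>i. diam_pow s (V i))"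
      using U(1) bV by (intro hausdorff_content_le) (auto simp: V_def)
    ultimately have "hausdorff_content s E \<le> k * (\<Sum>i. diam_pow s (U i))" by simp
    then have "k' * hausdorff_content s E \<le> k' * (k * (\<Sum>i. diam_pow s (U i)))"
      by (rule mult_left_mono) simp
    also have "\<dots> = (k * k') * (\<Sum>i. diam_pow s (U i))" by (simp only: mult_ac)
    finally show "k' * hausdorff_content s E \<le> (\<Sum>i. diam_pow s (U i))" by (simp add: kk)
  qed
  then have "k * (k' * hausdorff_content s E) \<le> k * hausdorff_content s (g ` E)"
    by (rule mult_left_mono) simp
  then show ?thesis by (simp add: mult.assoc[symmetric] kk flip: k_def)
qed

section \<open>Lower bounds from Cantor schemes\<close>

text \<open>Rounding down to multiples of \<open>\<delta>\<close> is injective on a set of numbers that are \<open>\<delta>\<close> apart.\<close>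

lemma separated_card_le:
  fixes f :: "'a \<Rightarrow> real"
  assumes \<delta>: "0 < \<delta>" and xy: "x \<le> y"
    and sep: "\<And>a b. a \<in> A \<Longrightarrow> b \<in> A \<Longrightarrow> a \<noteq> b \<Longrightarrow> \<delta> \<le> \<bar>f a - f b\<bar>"
    and range: "\<And>a. a \<in> A \<Longrightarrow> x \<le> f a \<and> f a \<le> y"
  shows "finite A" "real (card A) \<le> 1 + (y - x) / \<delta>"
proof -
  define g where "g a = nat \<lfloor>(f a - x) / \<delta>\<rfloor>" for a
  have inj: "inj_on g A"
  proof (rule inj_onI, rule ccontr)
    fix a b assume *: "a \<in> A" "b \<in> A" "g a = g b" "a \<noteq> b"
    have nn: "0 \<le> (f a - x) / \<delta>" "0 \<le> (f b - x) / \<delta>" using range * \<delta> by auto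
    have "\<lfloor>(f a - x) / \<delta>\<rfloor> = \<lfloor>(f b - x) / \<delta>\<rfloor>"
      using *(3) nn unfolding g_def by (metis eq_nat_nat_iff zero_le_floor)
    then have "\<bar>(f a - x) / \<delta> - (f b - x) / \<delta>\<bar> < 1" by linarith
    also have "(f a - x) / \<delta> - (f b - x) / \<delta> = (f a - f b) / \<delta>" by (simp add: diff_divide_distrib)
    finally have "\<bar>f a - f b\<bar> < \<delta>" using \<delta> by (simp add: abs_divide)
    with sep[OF *(1,2,4)] show False by simp
  qed
  have sub: "g ` A \<subseteq> {..nat \<lfloor>(y - x) / \<delta>\<rfloor>}"
    using range \<delta> by (auto simp: g_def intro!: nat_mono floor_mono divide_right_mono)
  show "finite A" using inj sub finite_imageD finite_subset by blast
  have "card A \<le> Suc (nat \<lfloor>(y - x) / \<delta>\<rfloor>)"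
    using card_mono[OF _ sub] card_image[OF inj] by simp
  moreover have "0 \<le> (y - x) / \<delta>" using xy \<delta> by simp
  then have "real (nat \<lfloor>(y - x) / \<delta>\<rfloor>) \<le> (y - x) / \<delta>" by linarith
  ultimately show "real (card A) \<le> 1 + (y - x) / \<delta>" by linarith
qed

text \<open>If every node passes its mass on to its children in equal parts, then this is the share of the mass
  of \<open>x\<close> that sits, \<open>r\<close> generations later, on nodes whose cells meet \<open>U\<close>. It replaces the measure of \<open>U\<close> in
  the mass distribution principle, so that no limit measure has to be constructed.\<close>

primrec hit_fraction ::
  "(nat \<Rightarrow> 'n \<Rightarrow> 'n set) \<Rightarrow> (nat \<Rightarrow> 'n \<Rightarrow> 'b set) \<Rightarrow> 'b set \<Rightarrow> nat \<Rightarrow> nat \<Rightarrow> 'n \<Rightarrow> real" where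
  "hit_fraction ch cell U 0 k x = (if cell k x \<inter> U = {} then 0 else 1)"
| "hit_fraction ch cell U (Suc r) k x =
     (\<Sum>y\<in>ch k x. hit_fraction ch cell U r (Suc k) y) / card (ch k x)"

text \<open>A tree of nested real sets. It suffices to separate siblings, since nesting passes the distance on
  to their descendants. The predicate \<open>G k\<close> singles out the nodes of level \<open>k\<close>.\<close>

locale cantor_scheme =
  fixes G :: "nat \<Rightarrow> 'n \<Rightarrow> bool" and ch :: "nat \<Rightarrow> 'n \<Rightarrow> 'n set"
    and cell :: "nat \<Rightarrow> 'n \<Rightarrow> real set" and N \<delta> :: "nat \<Rightarrow> real"
  assumes finite_ch: "G k x \<Longrightarrow> finite (ch k x)"
    and card_ch: "G k x \<Longrightarrow> N k \<le> card (ch k x)"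
    and N_pos: "0 < N k"
    and G_ch: "G k x \<Longrightarrow> y \<in> ch k x \<Longrightarrow> G (Suc k) y"
    and nested: "G k x \<Longrightarrow> y \<in> ch k x \<Longrightarrow> cell (Suc k) y \<subseteq> cell k x"
    and separated: "G k x \<Longrightarrow> y \<in> ch k x \<Longrightarrow> y' \<in> ch k x \<Longrightarrow> y \<noteq> y' \<Longrightarrow>
      p \<in> cell (Suc k) y \<Longrightarrow> p' \<in> cell (Suc k) y' \<Longrightarrow> \<delta> k \<le> \<bar>p - p'\<bar>"
    and \<delta>_pos: "0 < \<delta> k"
    and \<delta>_lim: "\<delta> \<longlonglongrightarrow> 0"
begin

abbreviation "hit \<equiv> hit_fraction ch cell"

lemma card_ch_pos: "G k x \<Longrightarrow> 0 < real (card (ch k x))"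
  using card_ch N_pos by (meson less_le_trans)

lemma hit_nonneg: "0 \<le> hit U r k x"
  by (induction r arbitrary: k x) (auto intro!: divide_nonneg_nonneg sum_nonneg)

lemma hit_eq_0: "G k x \<Longrightarrow> cell k x \<inter> U = {} \<Longrightarrow> hit U r k x = 0"
proof (induction r arbitrary: k x)
  case (Suc r)
  have "hit U r (Suc k) y = 0" if "y \<in> ch k x" for y
    using nested[OF Suc.prems(1) that] Suc.prems(2) by (intro Suc.IH G_ch[OF Suc.prems(1) that]) auto
  then show ?case by simp
qed simp

text \<open>As long as \<open>U\<close> is smaller than the sibling distance it meets the cell of at most one child, so each
  level divides the hit fraction by the number of children.\<close>

lemma hit_small_le:
  assumes B: "0 \<le> B" "\<And>x. G (k + r) x \<Longrightarrow> hit U m (k + r) x \<le> B"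
    and U: "\<And>j p p'. k \<le> j \<Longrightarrow> j < k + r \<Longrightarrow> p \<in> U \<Longrightarrow> p' \<in> U \<Longrightarrow> \<bar>p - p'\<bar> < \<delta> j"
    and x: "G k x"
  shows "hit U (r + m) k x \<le> B / (\<Prod>j=k..<k + r. N j)"
  using assms
proof (induction r arbitrary: k x)
  case (Suc r)
  define b where "b = B / (\<Prod>j=Suc k..<Suc k + r. N j)"
  have "0 < (\<Prod>j=Suc k..<Suc k + r. N j)" by (intro prod_pos) (simp add: N_pos)
  then have b0: "0 \<le> b" unfolding b_def using Suc.prems(1) by (intro divide_nonneg_pos)
  have IH: "hit U (r + m) (Suc k) y \<le> b" if "y \<in> ch k x" for y
    unfolding b_def
  proof (rule Suc.IH)
    show "G (Suc k) y" using Suc.prems(4) that by (rule G_ch)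
  qed (use Suc.prems in auto)
  have "(\<Sum>y\<in>ch k x. hit U (r + m) (Suc k) y) \<le> b"
  proof (cases "\<exists>y\<in>ch k x. cell (Suc k) y \<inter> U \<noteq> {}")
    case True
    then obtain y p where y: "y \<in> ch k x" "p \<in> cell (Suc k) y" "p \<in> U" by blast
    have "hit U (r + m) (Suc k) y' = 0" if y': "y' \<in> ch k x" "y' \<noteq> y" for y'
    proof (rule hit_eq_0)
      show "G (Suc k) y'" using Suc.prems(4) y'(1) by (rule G_ch)
      show "cell (Suc k) y' \<inter> U = {}"
      proof (rule ccontr)
        assume "cell (Suc k) y' \<inter> U \<noteq> {}"
        then obtain p' where "p' \<in> cell (Suc k) y'" "p' \<in> U" by blast
        then show False
          using separated[OF Suc.prems(4) y(1) y'(1)] y'(2) y(2,3) Suc.prems(3)[of k p p'] by force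
      qed
    qed
    then have "(\<Sum>y\<in>ch k x. hit U (r + m) (Suc k) y) = hit U (r + m) (Suc k) y"
      using sum.remove[OF finite_ch[OF Suc.prems(4)] y(1), of "\<lambda>y. hit U (r + m) (Suc k) y"] by simp
    then show ?thesis using IH[OF y(1)] by simp
  next
    case False
    then have "hit U (r + m) (Suc k) y = 0" if "y \<in> ch k x" for y
      using that G_ch[OF Suc.prems(4)] by (intro hit_eq_0) auto
    then show ?thesis using b0 by simp
  qed
  then have "hit U (Suc r + m) k x \<le> b / card (ch k x)"
    by (simp add: divide_right_mono)
  also have "\<dots> \<le> b / N k"
    using b0 card_ch[OF Suc.prems(4)] N_pos[of k] by (intro divide_left_mono mult_pos_pos) auto
  also have "\<dots> = B / (\<Prod>j=k..<k + Suc r. N j)"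
    by (simp add: b_def prod.atLeast_Suc_lessThan mult.commute)
  finally show ?case .
qed simp

text \<open>Points of \<open>U\<close> in the cells of different children are \<open>\<delta> k\<close> apart, so at most \<open>1 + d / \<delta> k\<close> children are
  hit.\<close>

lemma hit_children_le:
  assumes x: "G k x" and d: "\<delta> k \<le> d" and U: "\<And>p p'. p \<in> U \<Longrightarrow> p' \<in> U \<Longrightarrow> \<bar>p - p'\<bar> \<le> d"
  shows "hit U 1 k x \<le> min 1 (2 * d / (\<delta> k * N k))"
proof -
  define S where "S = {y\<in>ch k x. cell (Suc k) y \<inter> U \<noteq> {}}"
  have fin: "finite (ch k x)" by (rule finite_ch[OF x])
  have "hit U 1 k x = real (card S) / card (ch k x)"
    using fin by (simp add: S_def sum.If_cases Int_def)
  moreover have "real (card S) \<le> card (ch k x)"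
    using fin by (auto simp: S_def intro!: card_mono)
  moreover have "real (card S) \<le> 2 * d / \<delta> k"
  proof (cases "S = {}")
    case False
    define p where "p y = (SOME p. p \<in> cell (Suc k) y \<inter> U)" for y
    have p: "p y \<in> cell (Suc k) y \<inter> U" if "y \<in> S" for y
      unfolding p_def by (rule someI_ex) (use that in \<open>auto simp: S_def\<close>)
    obtain y1 where y1: "y1 \<in> S" "\<And>y. y \<in> S \<Longrightarrow> p y1 \<le> p y"
      using ex_min_if_finite[of "p ` S"] False fin
      by (metis (no_types, lifting) S_def arg_min_if_finite(1) arg_min_least finite_subset mem_Collect_eq subsetI)
    have "real (card S) \<le> 1 + (p y1 + d - p y1) / \<delta> k"
    proof (rule separated_card_le(2)[OF \<delta>_pos])
      show "p y1 \<le> p y1 + d" using d \<delta>_pos[of k] by simp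
      show "\<delta> k \<le> \<bar>p a - p b\<bar>" if "a \<in> S" "b \<in> S" "a \<noteq> b" for a b
        using p[of a] p[of b] that by (intro separated[OF x, of a b]) (auto simp: S_def)
      show "p y1 \<le> p a \<and> p a \<le> p y1 + d" if "a \<in> S" for a
        using y1 that U[of "p a" "p y1"] p[of a] p[of y1] by auto
    qed
    also have "\<dots> \<le> 2 * d / \<delta> k" using d \<delta>_pos[of k] by (simp add: field_simps)
    finally show ?thesis .
  qed (use d \<delta>_pos[of k] in auto)
  then have "real (card S) / card (ch k x) \<le> 2 * d / \<delta> k / N k"
    using card_ch[OF x] N_pos[of k] by (intro frac_le) auto
  ultimately show ?thesis using card_ch_pos[OF x] by simp
qed

text \<open>The total hit fraction of a node is at least the average over its children, so a branch can be
  chosen along which it does not increase.\<close>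

lemma avoiding_branch:
  assumes x0: "G 0 x0" and lt: "(\<Sum>i. ennreal (hit (U i) (lev i) 0 x0)) < 1"
  obtains X where "X 0 = x0" "\<And>k. X (Suc k) \<in> ch k (X k)" "\<And>k. G k (X k)"
    "\<And>k. (\<Sum>i. ennreal (hit (U i) (lev i - k) k (X k))) < 1"
proof -
  define \<Phi> where "\<Phi> k x = (\<Sum>i. ennreal (hit (U i) (lev i - k) k x))" for k x
  have step: "\<exists>y. (G (Suc k) y \<and> \<Phi> (Suc k) y < 1) \<and> y \<in> ch k x" if x: "G k x \<and> \<Phi> k x < 1" for k x
  proof (rule ccontr)
    assume "\<not> ?thesis"
    then have ge: "1 \<le> \<Phi> (Suc k) y" if "y \<in> ch k x" for y
      using that x G_ch by (meson not_le)
    let ?n = "of_nat (card (ch k x)) :: ennreal"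
    have n: "?n = ennreal (real (card (ch k x)))" by (simp add: ennreal_of_nat_eq_real_of_nat)
    have "?n \<le> (\<Sum>y\<in>ch k x. \<Phi> (Suc k) y)"
      using sum_mono[of "ch k x" "\<lambda>_. 1" "\<Phi> (Suc k)"] ge by simp
    also have "\<dots> = (\<Sum>i. \<Sum>y\<in>ch k x. ennreal (hit (U i) (lev i - Suc k) (Suc k) y))"
      unfolding \<Phi>_def by (rule suminf_sum[symmetric]) auto
    also have "\<dots> \<le> (\<Sum>i. ?n * ennreal (hit (U i) (lev i - k) k x))"
    proof (intro suminf_le summableI)
      fix i
      have "(\<Sum>y\<in>ch k x. hit (U i) (lev i - Suc k) (Suc k) y) \<le> card (ch k x) * hit (U i) (lev i - k) k x"
      proof (cases "k < lev i")
        case True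
        then have "lev i - k = Suc (lev i - Suc k)" by simp
        then show ?thesis using card_ch_pos[of k x] x by simp
      next
        case False
        then have "hit (U i) (lev i - Suc k) (Suc k) y \<le> hit (U i) (lev i - k) k x" if "y \<in> ch k x" for y
          using nested[OF conjunct1[OF x] that] by auto
        then show ?thesis by (rule sum_bounded_above)
      qed
      then have "ennreal (\<Sum>y\<in>ch k x. hit (U i) (lev i - Suc k) (Suc k) y)
          \<le> ennreal (card (ch k x) * hit (U i) (lev i - k) k x)" by (rule ennreal_leI)
      then show "(\<Sum>y\<in>ch k x. ennreal (hit (U i) (lev i - Suc k) (Suc k) y))
          \<le> ?n * ennreal (hit (U i) (lev i - k) k x)"
        unfolding n by (simp add: hit_nonneg sum_ennreal ennreal_mult)
    qed
    also have "\<dots> = ?n * \<Phi> k x" by (simp add: \<Phi>_def)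
    finally have "?n \<le> ?n * \<Phi> k x" .
    moreover have "?n * \<Phi> k x < ?n * 1"
      using x card_ch_pos[of k x] unfolding n by (intro ennreal_mult_strict_left_mono) auto
    ultimately show False by simp
  qed
  have "\<exists>X. \<forall>k. (G k (X k) \<and> \<Phi> k (X k) < 1 \<and> (k = 0 \<longrightarrow> X k = x0)) \<and> X (Suc k) \<in> ch k (X k)"
    by (rule dependent_nat_choice) (use x0 lt step in \<open>auto simp: \<Phi>_def\<close>)
  then show thesis using that unfolding \<Phi>_def by metis
qed

text \<open>A set of diameter \<open>d\<close> is caught at the first level at which the sibling distance has dropped
  below \<open>d\<close>: up to there it follows a single node, and among the children of that node it meets at
  most \<open>2 * d / \<delta> k\<close>. If a cover were too cheap, some branch would avoid all of it.\<close>

theorem hausdorff_content_neq_0: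
  assumes s: "0 < s" "s \<le> 1" and x0: "G 0 x0"
    and lim: "\<And>X. X 0 = x0 \<Longrightarrow> (\<And>k. X (Suc k) \<in> ch k (X k)) \<Longrightarrow> \<exists>\<theta>\<in>E. \<forall>k. \<theta> \<in> cell k (X k)"
    and c: "0 < c" and mass: "\<And>k. c \<le> (\<Prod>j<k. N j) * (N k * \<delta> k) powr s"
  shows "hausdorff_content s E \<noteq> 0"
proof
  assume "hausdorff_content s E = 0"
  define c' where "c' = c / (4 * 2 powr s)"
  have c': "0 < c'" using c by (simp add: c'_def)
  then have "hausdorff_content s E < ennreal c'" using \<open>hausdorff_content s E = 0\<close> by simp
  then obtain U where U: "E \<subseteq> (\<Union>i. U i)" "\<And>i. bounded (U i)" "(\<Sum>i. diam_pow s (U i)) < ennreal c'"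
    by (rule hausdorff_content_less_cover) blast
  have D: "0 \<le> diameter (U i)" for i using U(2) diameter_ge_0 by blast
  (* Sets of diameter zero get a positive size, so that each of them is caught at some level. *)
  define d where "d i = (diameter (U i) powr s + c' * (1/2) ^ Suc i) powr (1/s)" for i
  have base: "diameter (U i) powr s + c' * (1/2) ^ Suc i > 0" for i
    using c' by (intro add_nonneg_pos) auto
  have d_pos: "0 < d i" for i using base[of i] by (simp add: d_def)
  have d_powr: "d i powr s = diameter (U i) powr s + c' * (1/2) ^ Suc i" for i
    using base[of i] s by (simp add: d_def powr_powr)
  have diam_less: "diameter (U i) < d i" for i
  proof -
    have "diameter (U i) powr s < d i powr s" unfolding d_powr using c' by simp
    then show ?thesis using D[of i] d_pos[of i] s by (meson less_imp_le not_le powr_mono2)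
  qed
  have dist_U: "\<bar>p - p'\<bar> < d i" if "p \<in> U i" "p' \<in> U i" for p p' i
    using diameter_bounded_bound[OF U(2) that] diam_less[of i] by (simp add: dist_real_def)
  have ex_level: "\<exists>k. \<delta> k \<le> d i" for i
    using order_tendstoD(2)[OF \<delta>_lim d_pos[of i]] by (metis eventually_sequentially less_imp_le order_refl)
  define L where "L i = (LEAST k. \<delta> k \<le> d i)" for i
  have L: "\<delta> (L i) \<le> d i" for i unfolding L_def by (rule LeastI_ex[OF ex_level])
  have L_less: "d i < \<delta> j" if "j < L i" for i j
    using not_less_Least[OF that[unfolded L_def]] by simp
  have hit_le: "hit (U i) (Suc (L i)) 0 x0 \<le> 2 powr s / c * d i powr s" for i
  proof -
    let ?k = "L i"
    define q where "q = 2 * d i / (\<delta> ?k * N ?k)"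
    have q: "0 < q" using d_pos \<delta>_pos N_pos by (simp add: q_def)
    have "hit (U i) (?k + 1) 0 x0 \<le> min 1 q / (\<Prod>j=0..<0 + ?k. N j)"
    proof (rule hit_small_le[OF _ _ _ x0])
      show "hit (U i) 1 (0 + ?k) x \<le> min 1 q" if "G (0 + ?k) x" for x
      proof -
        have "hit (U i) 1 ?k x \<le> min 1 (2 * d i / (\<delta> ?k * N ?k))"
          by (rule hit_children_le) (use that L dist_U in \<open>auto intro: less_imp_le\<close>)
        then show ?thesis by (simp add: q_def)
      qed
      show "\<bar>p - p'\<bar> < \<delta> j" if "j < 0 + ?k" "p \<in> U i" "p' \<in> U i" for j p p'
        using dist_U[OF that(2,3)] L_less[of j i] that(1) by simp
    qed (use q in auto)
    also have "min 1 q \<le> q powr s"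
    proof (cases "q \<le> 1")
      case True
      then have "q powr 1 \<le> q powr s" using q s by (intro powr_mono') auto
      then show ?thesis using q by simp
    next
      case False
      then show ?thesis using s by (simp add: ge_one_powr_ge_zero min_def)
    qed
    then have "min 1 q / (\<Prod>j=0..<0 + ?k. N j) \<le> q powr s / (\<Prod>j<?k. N j)"
      using N_pos by (simp add: atLeast0LessThan divide_right_mono prod_nonneg less_imp_le)
    also have "q powr s = 2 powr s * d i powr s / (N ?k * \<delta> ?k) powr s"
      using d_pos[of i] \<delta>_pos[of ?k] N_pos[of ?k]
      by (simp add: q_def powr_divide powr_mult mult.commute)
    also have "\<dots> / (\<Prod>j<?k. N j) = 2 powr s * d i powr s / ((\<Prod>j<?k. N j) * (N ?k * \<delta> ?k) powr s)"
      by (simp add: mult.commute)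
    also have "\<dots> \<le> 2 powr s * d i powr s / c"
      using less_le_trans[OF c mass[of ?k]] mass[of ?k] c by (intro divide_left_mono) auto
    finally show ?thesis by (simp add: mult.commute)
  qed
  have "(\<Sum>i. ennreal (hit (U i) (Suc (L i)) 0 x0)) \<le> (\<Sum>i. ennreal (2 powr s / c) * (diam_pow s (U i) + ennreal (c' * (1/2) ^ Suc i)))"
  proof (intro suminf_le summableI)
    fix i
    have "diam_pow s (U i) = ennreal (diameter (U i) powr s)"
      using s by (auto simp: diam_pow_def)
    then have "ennreal (2 powr s / c) * (diam_pow s (U i) + ennreal (c' * (1/2) ^ Suc i)) = ennreal (2 powr s / c * d i powr s)"
      using c c' unfolding d_powr by (subst ennreal_mult) (auto simp: ennreal_plus)
    then show "ennreal (hit (U i) (Suc (L i)) 0 x0) \<le> ennreal (2 powr s / c) * (diam_pow s (U i) + ennreal (c' * (1/2) ^ Suc i))"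
      using hit_le[of i] by (simp add: ennreal_leI)
  qed
  also have "\<dots> = ennreal (2 powr s / c) * ((\<Sum>i. diam_pow s (U i)) + (\<Sum>i. ennreal (c' * (1/2) ^ Suc i)))"
    by (simp add: suminf_add)
  also have "(\<Sum>i. ennreal (c' * (1/2) ^ Suc i)) = ennreal (c' * 1)"
    using c' by (intro suminf_ennreal_eq sums_mult power_half_series) auto
  also have "ennreal (2 powr s / c) * ((\<Sum>i. diam_pow s (U i)) + ennreal (c' * 1)) \<le> ennreal (2 powr s / c) * (ennreal c' + ennreal c')"
    using U(3) by (intro mult_left_mono add_mono) auto
  also have "\<dots> = ennreal (2 powr s / c * (c' + c'))"
    using c c' ennreal_plus[of c' c'] by (subst ennreal_mult) (auto simp del: ennreal_plus)
  also have "2 powr s / c * (c' + c') = 1/2" using c by (simp add: c'_def field_simps)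
  also have "ennreal (1/2) < ennreal 1" by (subst ennreal_less_iff) auto
  finally have "(\<Sum>i. ennreal (hit (U i) (Suc (L i)) 0 x0)) < 1" by simp
  then obtain X where X: "X 0 = x0" "\<And>k. X (Suc k) \<in> ch k (X k)"
    "\<And>k. (\<Sum>i. ennreal (hit (U i) (Suc (L i) - k) k (X k))) < 1"
    by (rule avoiding_branch[OF x0]) blast
  obtain \<theta> where \<theta>: "\<theta> \<in> E" "\<And>k. \<theta> \<in> cell k (X k)" using lim[of X, OF X(1,2)] by blast
  then obtain i where i: "\<theta> \<in> U i" using U(1) by blast
  let ?k = "Suc (L i)"
  have "1 = ennreal (hit (U i) (Suc (L i) - ?k) ?k (X ?k))" using i \<theta>(2)[of ?k] by auto
  also have "\<dots> \<le> (\<Sum>i. ennreal (hit (U i) (Suc (L i) - ?k) ?k (X ?k)))"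
    using sum_le_suminf[of "\<lambda>i. ennreal (hit (U i) (Suc (L i) - ?k) ?k (X ?k))" "{i}"] by simp
  finally show False using X(3)[of ?k] by simp
qed

end

section \<open>Plane geometry of slits and lattice vectors\<close>

lemma norm_pair_sq: "(norm (x :: real \<times> real))\<^sup>2 = (fst x)\<^sup>2 + (snd x)\<^sup>2"
  by (cases x) (simp add: norm_Pair)

lemma cross2_sq_add_inner_sq: "(cross2 x y)\<^sup>2 + (x \<bullet> y)\<^sup>2 = (norm x)\<^sup>2 * (norm y)\<^sup>2"
  unfolding norm_pair_sq by (cases x; cases y) (simp add: cross2_def algebra_simps power2_eq_square)

lemma abs_cross2_le: "\<bar>cross2 x y\<bar> \<le> norm x * norm y"
proof -
  have "(cross2 x y)\<^sup>2 \<le> (norm x * norm y)\<^sup>2"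
    using cross2_sq_add_inner_sq[of x y] zero_le_power2[of "x \<bullet> y"]
    unfolding power_mult_distrib by linarith
  then show ?thesis by (simp add: abs_le_square_iff[symmetric] abs_mult)
qed

lemma cross2_simps [simp]:
  "cross2 x x = 0" "cross2 x 0 = 0" "cross2 0 x = 0"
  "cross2 (c *\<^sub>R x) y = c * cross2 x y" "cross2 x (c *\<^sub>R y) = c * cross2 x y"
  "cross2 (- x) y = - cross2 x y" "cross2 x (- y) = - cross2 x y"
  by (simp_all add: cross2_def algebra_simps)

lemma cross2_add:
  "cross2 (x + y) z = cross2 x z + cross2 y z" "cross2 z (x + y) = cross2 z x + cross2 z y"
  "cross2 (x - y) z = cross2 x z - cross2 y z" "cross2 z (x - y) = cross2 z x - cross2 z y"
  by (simp_all add: cross2_def algebra_simps)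

lemma cross2_swap: "cross2 x y = - cross2 y x"
  by (simp add: cross2_def algebra_simps)

lemma cross2_jacobi: "cross2 x y *\<^sub>R z + cross2 y z *\<^sub>R x + cross2 z x *\<^sub>R y = 0"
  by (auto simp: cross2_def prod_eq_iff algebra_simps)

text \<open>The quotients are sines of angles between lines. Unlike the angle between vectors they do not depend on
  the orientation, which is not controlled for slits and lattice vectors.\<close>

lemma sine_triangle:
  assumes "x \<noteq> 0" "y \<noteq> 0" "z \<noteq> 0"
  shows "\<bar>cross2 x z\<bar> / (norm x * norm z) \<le>
    \<bar>cross2 x y\<bar> / (norm x * norm y) + \<bar>cross2 y z\<bar> / (norm y * norm z)"
proof -
  have eq: "(norm y)\<^sup>2 * cross2 x z = (y \<bullet> z) * cross2 x y + (x \<bullet> y) * cross2 y z"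
    unfolding norm_pair_sq
    by (cases x; cases y; cases z) (simp add: cross2_def algebra_simps power2_eq_square)
  have "(norm y)\<^sup>2 * \<bar>cross2 x z\<bar> = \<bar>(norm y)\<^sup>2 * cross2 x z\<bar>" by (simp add: abs_mult)
  also have "\<dots> \<le> \<bar>y \<bullet> z\<bar> * \<bar>cross2 x y\<bar> + \<bar>x \<bullet> y\<bar> * \<bar>cross2 y z\<bar>"
    unfolding eq using abs_triangle_ineq by (simp flip: abs_mult)
  also have "\<dots> \<le> (norm y * norm z) * \<bar>cross2 x y\<bar> + (norm x * norm y) * \<bar>cross2 y z\<bar>"
    by (intro add_mono mult_right_mono Cauchy_Schwarz_ineq2) auto
  finally have "norm y * (norm y * \<bar>cross2 x z\<bar>) \<le> norm y * (norm z * \<bar>cross2 x y\<bar> + norm x * \<bar>cross2 y z\<bar>)"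
    by (simp add: power2_eq_square algebra_simps)
  then have "norm y * \<bar>cross2 x z\<bar> \<le> norm z * \<bar>cross2 x y\<bar> + norm x * \<bar>cross2 y z\<bar>"
    using assms(2) by simp
  then show ?thesis using assms by (simp add: field_simps)
qed

definition ivec :: "int \<times> int \<Rightarrow> real \<times> real" where
  "ivec u = (real_of_int (fst u), real_of_int (snd u))"

definition primitive :: "int \<times> int \<Rightarrow> bool" where
  "primitive u \<longleftrightarrow> coprime (fst u) (snd u)"

text \<open>The halves of the vectors that are allowed in \<open>K (2 * \<mu>)\<close>.\<close>

definition slits :: "real \<Rightarrow> (real \<times> real) set" where
  "slits \<mu> = {(\<mu> + real_of_int a, real_of_int b) | a b. b \<noteq> 0}"

lemma cross2_ivec: "cross2 (ivec u) (ivec v) = real_of_int (fst u * snd v - fst v * snd u)"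
  by (simp add: cross2_def ivec_def)

lemma primitive_norm_ge_1:
  assumes "primitive u"
  shows "1 \<le> norm (ivec u)"
proof -
  have "u \<noteq> (0, 0)" using assms by (auto simp: primitive_def)
  then have "1 \<le> (fst u)\<^sup>2 + (snd u)\<^sup>2"
    by (smt (verit) prod.exhaust_sel sum_power2_gt_zero_iff)
  then have "1 \<le> real_of_int ((fst u)\<^sup>2 + (snd u)\<^sup>2)" by linarith
  then have "1 \<le> (norm (ivec u))\<^sup>2" by (simp add: norm_pair_sq ivec_def)
  then show ?thesis using power2_le_imp_le[of 1 "norm (ivec u)"] by simp
qed

text \<open>Since \<open>fst u\<close> is coprime to \<open>snd u\<close> and divides \<open>fst v * snd u\<close>, it divides \<open>fst v\<close>.\<close>

lemma parallel_primitive_multiple: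
  assumes "primitive u" "cross2 (ivec u) (ivec v) = 0"
  obtains c where "v = (c * fst u, c * snd u)"
proof -
  have "fst u * snd v - fst v * snd u = 0"
    using assms(2) unfolding cross2_ivec by (simp only: of_int_eq_0_iff)
  then have eq: "fst u * snd v = fst v * snd u" by simp
  have cop: "coprime (fst u) (snd u)" using assms(1) by (simp add: primitive_def)
  have "fst u dvd fst v * snd u" using eq by (metis dvd_triv_left)
  then have d1: "fst u dvd fst v" using cop by (simp add: coprime_dvd_mult_left_iff)
  show thesis
  proof (cases "fst u = 0")
    case True
    then have "\<bar>snd u\<bar> = 1" using cop by simp
    moreover have "fst v = 0" using d1 True by simp
    ultimately have "v = (snd v * snd u * fst u, snd v * snd u * snd u)"
      using True by (cases v) (auto simp: abs_if split: if_splits)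
    then show thesis by (rule that)
  next
    case False
    from d1 obtain c where c: "fst v = fst u * c" by (rule dvdE)
    with eq have "fst u * snd v = fst u * (c * snd u)" by (simp add: mult_ac)
    with False have "snd v = c * snd u" by simp
    then show thesis using that[of c] c by (cases v) (simp add: mult.commute)
  qed
qed

lemma parallel_primitives:
  assumes "primitive u" "primitive v" "cross2 (ivec u) (ivec v) = 0"
  shows "v = u \<or> v = - u"
proof -
  obtain c where c: "v = (c * fst u, c * snd u)"
    using parallel_primitive_multiple assms(1,3) by blast
  then have "is_unit c" using assms(2) by (simp add: primitive_def)
  then have "\<bar>c\<bar> = 1" by simp
  then have "c = 1 \<or> c = -1" by arith
  then show ?thesis using c by (auto simp: prod_eq_iff)
qed

lemma abs_cross2_ivec_ge_1:
  assumes "cross2 (ivec u) (ivec v) \<noteq> 0"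
  shows "1 \<le> \<bar>cross2 (ivec u) (ivec v)\<bar>"
proof -
  have "1 \<le> \<bar>real_of_int n\<bar>" if "real_of_int n \<noteq> 0" for n
  proof -
    have "1 \<le> \<bar>n\<bar>" using that by (simp add: int_one_le_iff_zero_less)
    then show ?thesis by (metis of_int_abs of_int_1_le_iff)
  qed
  then show ?thesis using assms unfolding cross2_ivec by blast
qed

lemma eq_multiple_primitive:
  assumes "z \<noteq> (0, 0)"
  obtains d u where "primitive u" "0 < d" "z = (d * fst u, d * snd u)"
proof -
  let ?g = "gcd (fst z) (snd z)"
  have g: "0 < ?g" using assms by (cases z) auto
  define u where "u = (fst z div ?g, snd z div ?g)"
  have "primitive u" using assms by (cases z) (simp add: primitive_def u_def div_gcd_coprime)
  moreover have "z = (?g * fst u, ?g * snd u)" by (simp add: u_def)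
  ultimately show thesis using that g by blast
qed

lemma slits_diff:
  assumes "w \<in> slits \<mu>" "w' \<in> slits \<mu>"
  obtains z where "w' - w = ivec z"
proof -
  obtain a b a' b' where "w = (\<mu> + real_of_int a, real_of_int b)" "w' = (\<mu> + real_of_int a', real_of_int b')"
    using assms by (auto simp: slits_def)
  then have "w' - w = ivec (a' - a, b' - b)" by (simp add: ivec_def)
  then show thesis by (rule that)
qed

text \<open>A slit parallel to an integer vector would make \<open>\<mu>\<close> a quotient of integers.\<close>

lemma slit_cross_primitive_neq_0:
  assumes \<mu>: "\<mu> \<notin> \<rat>" and w: "w \<in> slits \<mu>" and u: "primitive u"
  shows "cross2 w (ivec u) \<noteq> 0"
proof
  assume 0: "cross2 w (ivec u) = 0"
  obtain a b where ab: "w = (\<mu> + real_of_int a, real_of_int b)" "b \<noteq> 0" using w by (auto simp: slits_def)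
  have eq: "(\<mu> + a) * snd u = fst u * b" using 0 by (simp add: ab cross2_def ivec_def)
  show False
  proof (cases "snd u = 0")
    case True
    then have "fst u \<noteq> 0" using u by (auto simp: primitive_def)
    then show False using eq True ab(2) by simp
  next
    case False
    then have "\<mu> = real_of_int (fst u) * b / snd u - a" using eq by (simp add: field_simps)
    moreover have "real_of_int (fst u) * b / snd u - a \<in> \<rat>" by simp
    ultimately show False using \<mu> by simp
  qed
qed

section \<open>The upper bound\<close>

text \<open>A tail of a sequence in the definition of \<open>K\<close>, halved and late enough for the sum to be at most \<open>\<epsilon>\<close>.\<close>

definition slit_path :: "real \<Rightarrow> real \<Rightarrow> real \<times> real \<Rightarrow> (nat \<Rightarrow> real \<times> real) \<Rightarrow> bool" where
  "slit_path \<epsilon> \<mu> \<theta> W \<longleftrightarrow> (\<forall>j. W j \<in> slits \<mu>) \<and> strict_mono (\<lambda>j. norm (W j)) \<and>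
     summable (\<lambda>j. \<bar>cross2 (W j) (W (Suc j))\<bar>) \<and> (\<Sum>j. \<bar>cross2 (W j) (W (Suc j))\<bar>) \<le> \<epsilon> \<and>
     (\<lambda>j. W j /\<^sub>R norm (W j)) \<longlonglongrightarrow> \<theta> \<and> norm \<theta> = 1"

text \<open>Limits are sorted by the primitive direction of the first step.\<close>

definition path_limits :: "real \<Rightarrow> real \<Rightarrow> int \<times> int \<Rightarrow> (real \<times> real) set" where
  "path_limits \<epsilon> \<mu> u = {\<theta>. \<exists>W d. slit_path \<epsilon> \<mu> \<theta> W \<and> d \<noteq> 0 \<and> W 1 - W 0 = real_of_int d *\<^sub>R ivec u}"

lemma slit_neq_0: "w \<in> slits \<mu> \<Longrightarrow> w \<noteq> 0"
  by (auto simp: slits_def prod_eq_iff)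

lemma slit_path_slit: "slit_path \<epsilon> \<mu> \<theta> W \<Longrightarrow> W j \<in> slits \<mu>"
  by (simp add: slit_path_def)

lemma slit_path_norm_mono: "slit_path \<epsilon> \<mu> \<theta> W \<Longrightarrow> i \<le> j \<Longrightarrow> norm (W i) \<le> norm (W j)"
  unfolding slit_path_def using strict_mono_less_eq[of "\<lambda>j. norm (W j)" i j] by blast

lemma slit_path_shift:
  assumes "slit_path \<epsilon> \<mu> \<theta> W"
  shows "slit_path \<epsilon> \<mu> \<theta> (\<lambda>j. W (j + k))"
proof -
  let ?c = "\<lambda>j. \<bar>cross2 (W j) (W (Suc j))\<bar>"
  have S: "summable ?c" using assms by (simp add: slit_path_def)
  have "(\<Sum>j. ?c (j + k)) \<le> (\<Sum>j. ?c j)"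
    using suminf_split_initial_segment[OF S, of k] by (simp add: sum_nonneg)
  then show ?thesis
    using assms summable_ignore_initial_segment[OF S, of k]
    by (auto simp: slit_path_def strict_mono_def intro: LIMSEQ_ignore_initial_segment)
qed

lemma slit_path_cross_le:
  assumes "slit_path \<epsilon> \<mu> \<theta> W"
  shows "\<bar>cross2 (W j) (W (Suc j))\<bar> \<le> \<epsilon>"
proof -
  let ?c = "\<lambda>j. \<bar>cross2 (W j) (W (Suc j))\<bar>"
  have "?c j \<le> (\<Sum>j. ?c j)"
    using sum_le_suminf[of ?c "{j}"] assms by (simp add: slit_path_def)
  then show ?thesis using assms by (simp add: slit_path_def)
qed

lemma slit_path_difference:
  assumes "slit_path \<epsilon> \<mu> \<theta> W"
  obtains d u where "primitive u" "d \<noteq> 0" "W (Suc j) - W j = real_of_int d *\<^sub>R ivec u"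
proof -
  have W: "W j \<in> slits \<mu>" "W (Suc j) \<in> slits \<mu>" "norm (W j) < norm (W (Suc j))"
    using assms by (auto simp: slit_path_def strict_mono_def)
  obtain z where z: "W (Suc j) - W j = ivec z" using slits_diff[OF W(1,2)] .
  moreover have "z \<noteq> (0, 0)"
  proof
    assume "z = (0, 0)"
    then have "W (Suc j) = W j" using z by (simp add: ivec_def zero_prod_def[symmetric])
    then show False using W(3) by simp
  qed
  ultimately obtain d u where "primitive u" "0 < d" "z = (d * fst u, d * snd u)"
    using eq_multiple_primitive by blast
  then show thesis using that[of u d] z by (simp add: ivec_def)
qed

lemma tendsto_cross2:
  assumes "(f \<longlongrightarrow> x) F"
  shows "((\<lambda>n. cross2 (f n) y) \<longlongrightarrow> cross2 x y) F"
  unfolding cross2_def by (intro tendsto_intros assms)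

text \<open>The angle between consecutive slits is the cross product divided by both lengths, and the
  lengths increase.\<close>

lemma slit_path_limit_cross_le:
  assumes path: "slit_path \<epsilon> \<mu> \<theta> W"
  shows "\<bar>cross2 \<theta> (W 0)\<bar> \<le> \<epsilon> / norm (W 0)"
proof -
  let ?c = "\<lambda>j. \<bar>cross2 (W j) (W (Suc j))\<bar>"
  have nz: "W j \<noteq> 0" for j using slit_neq_0[OF slit_path_slit[OF path]] .
  have mono: "norm (W 0) \<le> norm (W j)" for j
    using slit_path_norm_mono[OF path] by simp
  have n0: "0 < norm (W 0)" using nz by simp
  have S: "summable ?c" "(\<Sum>j. ?c j) \<le> \<epsilon>" using path by (auto simp: slit_path_def)
  have *: "\<bar>cross2 (W k) (W 0)\<bar> / (norm (W k) * norm (W 0)) \<le> (\<Sum>j<k. ?c j) / (norm (W 0))\<^sup>2" for k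
  proof (induction k)
    case (Suc k)
    have "\<bar>cross2 (W (Suc k)) (W 0)\<bar> / (norm (W (Suc k)) * norm (W 0)) \<le>
        \<bar>cross2 (W (Suc k)) (W k)\<bar> / (norm (W (Suc k)) * norm (W k)) + \<bar>cross2 (W k) (W 0)\<bar> / (norm (W k) * norm (W 0))"
      by (rule sine_triangle) (rule nz)+
    also have "\<bar>cross2 (W (Suc k)) (W k)\<bar> = ?c k" by (subst cross2_swap) simp
    also have "?c k / (norm (W (Suc k)) * norm (W k)) \<le> ?c k / (norm (W 0))\<^sup>2"
      unfolding power2_eq_square using n0 nz
      by (intro divide_left_mono mult_mono mono mult_pos_pos) auto
    finally show ?case using Suc.IH by (simp add: add_divide_distrib)
  qed simp
  have le: "\<bar>cross2 (W k /\<^sub>R norm (W k)) (W 0)\<bar> \<le> \<epsilon> / norm (W 0)" for k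
  proof -
    have "(\<Sum>j<k. ?c j) \<le> \<epsilon>" using sum_le_suminf[OF S(1), of "{..<k}"] S(2) by simp
    then have "(\<Sum>j<k. ?c j) / (norm (W 0))\<^sup>2 \<le> \<epsilon> / (norm (W 0))\<^sup>2" by (simp add: divide_right_mono)
    with *[of k] have "\<bar>cross2 (W k) (W 0)\<bar> / (norm (W k) * norm (W 0)) \<le> \<epsilon> / (norm (W 0))\<^sup>2" by simp
    then have "\<bar>cross2 (W k) (W 0)\<bar> / (norm (W k) * norm (W 0)) * norm (W 0) \<le> \<epsilon> / (norm (W 0))\<^sup>2 * norm (W 0)"
      using n0 by (intro mult_right_mono) auto
    then show ?thesis using n0 by (simp add: power2_eq_square abs_mult divide_inverse mult_ac)
  qed
  have "(\<lambda>k. \<bar>cross2 (W k /\<^sub>R norm (W k)) (W 0)\<bar>) \<longlonglongrightarrow> \<bar>cross2 \<theta> (W 0)\<bar>"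
    using path by (intro tendsto_rabs tendsto_cross2) (simp add: slit_path_def)
  then show ?thesis using le by (intro LIMSEQ_le_const2) auto
qed

text \<open>The step is a nonzero integer multiple of \<open>u\<close>, so the cross product of \<open>W j\<close> with \<open>u\<close> is at most that with
  \<open>W (Suc j)\<close>; and it joins two slits of which the second is the longer one.\<close>

lemma slit_path_step:
  assumes path: "slit_path \<epsilon> \<mu> \<theta> W" and d: "d \<noteq> 0" "W (Suc j) - W j = real_of_int d *\<^sub>R ivec u"
  shows "\<bar>cross2 (W (Suc j)) (ivec u)\<bar> \<le> \<epsilon>" "norm (ivec u) \<le> 2 * norm (W (Suc j))"
    "\<bar>cross2 (W j) (ivec u)\<bar> \<le> \<epsilon>"
proof -
  have W: "W (Suc j) = W j + real_of_int d *\<^sub>R ivec u" using d(2) by (simp add: algebra_simps)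
  have d1: "1 \<le> \<bar>real_of_int d\<bar>" using d(1) by linarith
  have "\<bar>cross2 (W j) (ivec u)\<bar> \<le> \<bar>real_of_int d\<bar> * \<bar>cross2 (W j) (ivec u)\<bar>"
    using d1 by (simp add: mult_le_cancel_right1)
  also have "\<dots> = \<bar>cross2 (W j) (W (Suc j))\<bar>" unfolding W by (simp add: cross2_add abs_mult)
  finally show "\<bar>cross2 (W j) (ivec u)\<bar> \<le> \<epsilon>" using slit_path_cross_le[OF path, of j] by simp
  then show "\<bar>cross2 (W (Suc j)) (ivec u)\<bar> \<le> \<epsilon>" unfolding W by (simp add: cross2_add)
  have "norm (W j) \<le> norm (W (Suc j))" using slit_path_norm_mono[OF path] by simp
  moreover have "norm (ivec u) \<le> \<bar>real_of_int d\<bar> * norm (ivec u)"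
    using d1 by (simp add: mult_le_cancel_right1)
  moreover have "\<bar>real_of_int d\<bar> * norm (ivec u) = norm (W (Suc j) - W j)" unfolding d(2) by simp
  ultimately show "norm (ivec u) \<le> 2 * norm (W (Suc j))"
    using norm_triangle_ineq4[of "W (Suc j)" "W j"] by linarith
qed

text \<open>The second slit of the path is nearly parallel to \<open>u\<close> and to the limit, and at least half as long as
  \<open>u\<close>.\<close>

lemma path_limits_cross_le:
  assumes u: "primitive u" and \<theta>: "\<theta> \<in> path_limits \<epsilon> \<mu> u"
  shows "\<bar>cross2 \<theta> (ivec u)\<bar> \<le> 6 * \<epsilon> / norm (ivec u)"
proof -
  obtain W d where W: "slit_path \<epsilon> \<mu> \<theta> W" "d \<noteq> 0" "W (Suc 0) - W 0 = real_of_int d *\<^sub>R ivec u"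
    using \<theta> by (auto simp: path_limits_def)
  let ?v = "W (Suc 0)" and ?n = "norm (ivec u)"
  note step = slit_path_step[OF W]
  have n: "0 < ?n" using primitive_norm_ge_1[OF u] by linarith
  then have v: "0 < norm ?v" using step(2) by linarith
  have \<theta>1: "norm \<theta> = 1" using W(1) by (simp add: slit_path_def)
  have \<epsilon>: "0 \<le> \<epsilon>" using step(1) by linarith
  have "\<bar>cross2 \<theta> ?v\<bar> \<le> \<epsilon> / norm ?v"
    using slit_path_limit_cross_le[OF slit_path_shift[OF W(1), of 1]] by simp
  then have 1: "\<bar>cross2 \<theta> ?v\<bar> / norm ?v \<le> \<epsilon> / norm ?v / norm ?v" using v by (intro divide_right_mono) auto
  have inv: "1 / norm ?v \<le> 2 / ?n" using step(2) n v by (simp add: field_simps)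
  have "\<epsilon> / norm ?v / norm ?v = \<epsilon> * ((1 / norm ?v) * (1 / norm ?v))" by simp
  also have "\<dots> \<le> \<epsilon> * ((2 / ?n) * (2 / ?n))"
    using inv \<epsilon> v n by (intro mult_left_mono mult_mono) auto
  finally have 2: "\<epsilon> / norm ?v / norm ?v \<le> 4 * \<epsilon> / ?n\<^sup>2" by (simp add: power2_eq_square mult.commute)
  have "\<bar>cross2 ?v (ivec u)\<bar> / (norm ?v * ?n) = \<bar>cross2 ?v (ivec u)\<bar> * ((1 / norm ?v) * (1 / ?n))" by simp
  also have "\<dots> \<le> \<epsilon> * ((2 / ?n) * (1 / ?n))"
    using inv step(1) v n \<epsilon> by (intro mult_mono) auto
  finally have 3: "\<bar>cross2 ?v (ivec u)\<bar> / (norm ?v * ?n) \<le> 2 * \<epsilon> / ?n\<^sup>2" by (simp add: power2_eq_square mult.commute)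
  have "\<bar>cross2 \<theta> (ivec u)\<bar> / (norm \<theta> * ?n) \<le> \<bar>cross2 \<theta> ?v\<bar> / (norm \<theta> * norm ?v) + \<bar>cross2 ?v (ivec u)\<bar> / (norm ?v * ?n)"
    using \<theta>1 v n by (intro sine_triangle) auto
  then have "\<bar>cross2 \<theta> (ivec u)\<bar> / ?n \<le> 6 * \<epsilon> / ?n\<^sup>2" using 1 2 3 \<theta>1 by simp
  then have "\<bar>cross2 \<theta> (ivec u)\<bar> / ?n * ?n \<le> 6 * \<epsilon> / ?n\<^sup>2 * ?n" using n by (intro mult_right_mono) auto
  then show ?thesis using n by (simp add: power2_eq_square)
qed

lemma path_limits_uminus: "path_limits \<epsilon> \<mu> (- u) = path_limits \<epsilon> \<mu> u"
proof -
  have "path_limits \<epsilon> \<mu> u \<subseteq> path_limits \<epsilon> \<mu> (- u)" for u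
  proof
    fix \<theta> assume "\<theta> \<in> path_limits \<epsilon> \<mu> u"
    then obtain W d where "slit_path \<epsilon> \<mu> \<theta> W" "d \<noteq> 0" "W 1 - W 0 = real_of_int d *\<^sub>R ivec u"
      by (auto simp: path_limits_def)
    then have "slit_path \<epsilon> \<mu> \<theta> W \<and> - d \<noteq> 0 \<and> W 1 - W 0 = real_of_int (- d) *\<^sub>R ivec (- u)"
      by (simp add: ivec_def)
    then show "\<theta> \<in> path_limits \<epsilon> \<mu> (- u)" unfolding path_limits_def by blast
  qed
  from this[of u] this[of "- u"] show ?thesis by auto
qed

text \<open>A path cannot keep moving in the direction of a single lattice vector \<open>u\<close>: the cross products
  would all be nonzero multiples of one number, which is nonzero because \<open>\<mu>\<close> is irrational. The slit at
  which it first turns to another direction \<open>u'\<close> has small cross products with both.\<close>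

lemma path_limits_child:
  assumes \<mu>: "\<mu> \<notin> \<rat>" and \<epsilon>: "\<epsilon> < 1/2" and u: "primitive u" and \<theta>: "\<theta> \<in> path_limits \<epsilon> \<mu> u"
  obtains w u' where "w \<in> slits \<mu>" "primitive u'" "norm (ivec u) \<le> 2 * norm w"
    "\<bar>cross2 w (ivec u)\<bar> \<le> \<epsilon>" "\<bar>cross2 w (ivec u')\<bar> \<le> \<epsilon>" "0 < w \<bullet> ivec u'"
    "cross2 (ivec u) (ivec u') \<noteq> 0" "\<theta> \<in> path_limits \<epsilon> \<mu> u'"
proof -
  obtain W d0 where W: "slit_path \<epsilon> \<mu> \<theta> W" and d0: "d0 \<noteq> 0" "W 1 - W 0 = real_of_int d0 *\<^sub>R ivec u"
    using \<theta> by (auto simp: path_limits_def)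
  have slit: "W j \<in> slits \<mu>" for j using W by (simp add: slit_path_def)
  define along where "along j \<longleftrightarrow> (\<exists>d. d \<noteq> 0 \<and> W (Suc j) - W j = real_of_int d *\<^sub>R ivec u)" for j
  have along0: "along 0" using d0 by (auto simp: along_def)
  have "\<exists>j. \<not> along j"
  proof (rule ccontr)
    assume "\<not> ?thesis"
    then have all: "along j" for j by blast
    have const: "cross2 (W j) (ivec u) = cross2 (W 0) (ivec u)" for j
    proof (induction j)
      case (Suc j)
      obtain d where "W (Suc j) - W j = real_of_int d *\<^sub>R ivec u" using all[of j] by (auto simp: along_def)
      then have "W (Suc j) = W j + real_of_int d *\<^sub>R ivec u" by (simp add: algebra_simps)
      then show ?case using Suc by (simp add: cross2_add)
    qed simp
    have ge: "\<bar>cross2 (W 0) (ivec u)\<bar> \<le> \<bar>cross2 (W j) (W (Suc j))\<bar>" for j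
    proof -
      obtain d where d: "d \<noteq> 0" "W (Suc j) - W j = real_of_int d *\<^sub>R ivec u"
        using all[of j] by (auto simp: along_def)
      then have "W (Suc j) = W j + real_of_int d *\<^sub>R ivec u" by (simp add: algebra_simps)
      then have "cross2 (W j) (W (Suc j)) = real_of_int d * cross2 (W 0) (ivec u)"
        by (simp add: cross2_add const[of j])
      moreover have "1 \<le> \<bar>real_of_int d\<bar>" using d(1) by linarith
      ultimately show ?thesis by (simp add: abs_mult mult_le_cancel_right1)
    qed
    have "(\<lambda>j. \<bar>cross2 (W j) (W (Suc j))\<bar>) \<longlonglongrightarrow> 0"
      using W by (intro summable_LIMSEQ_zero) (simp add: slit_path_def)
    then have "\<bar>cross2 (W 0) (ivec u)\<bar> \<le> 0" using ge by (intro LIMSEQ_le_const) auto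
    then show False using slit_cross_primitive_neq_0[OF \<mu> slit u] by simp
  qed
  then have "\<not> along (LEAST j. \<not> along j)" by (rule LeastI_ex)
  moreover have "along i" if "i < (LEAST j. \<not> along j)" for i using not_less_Least[OF that] by simp
  ultimately obtain j where j: "\<not> along j" "\<And>i. i < j \<Longrightarrow> along i" by blast
  have "j \<noteq> 0" using j(1) along0 by metis
  then obtain i where i: "j = Suc i" using not0_implies_Suc by blast
  let ?w = "W j"
  have "along i" using j(2) i by simp
  then obtain d where d: "d \<noteq> 0" "W (Suc i) - W i = real_of_int d *\<^sub>R ivec u" by (auto simp: along_def)
  note w = slit_path_step(1,2)[OF W d, folded i]
  obtain d' v where v: "primitive v" "d' \<noteq> 0" "W (Suc j) - W j = real_of_int d' *\<^sub>R ivec v"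
    using slit_path_difference[OF W] .
  have cv: "\<bar>cross2 ?w (ivec v)\<bar> \<le> \<epsilon>" by (rule slit_path_step(3)[OF W v(2,3)])
  have \<theta>v: "\<theta> \<in> path_limits \<epsilon> \<mu> v"
    using slit_path_shift[OF W, of j] v(2,3) by (auto simp: path_limits_def intro!: exI[of _ "\<lambda>k. W (k + j)"])
  have nv: "cross2 (ivec u) (ivec v) \<noteq> 0"
  proof
    assume "cross2 (ivec u) (ivec v) = 0"
    then have "v = u \<or> v = - u" using parallel_primitives u v(1) by blast
    then have "along j"
    proof
      assume "v = u" then show ?thesis using v by (auto simp: along_def)
    next
      assume "v = - u"
      then have "ivec v = - ivec u" by (simp add: ivec_def)
      then have "W (Suc j) - W j = real_of_int (- d') *\<^sub>R ivec u" using v by simp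
      then show ?thesis unfolding along_def using v(2) by (metis neg_equal_0_iff_equal)
    qed
    then show False using j by simp
  qed
  have "1/2 \<le> norm ?w" using w(2) primitive_norm_ge_1[OF u] by linarith
  then have "1/2 * 1 \<le> norm ?w * norm (ivec v)"
    using primitive_norm_ge_1[OF v(1)] by (intro mult_mono) auto
  then have "\<bar>cross2 ?w (ivec v)\<bar> < norm ?w * norm (ivec v)" using cv \<epsilon> by linarith
  then have "(cross2 ?w (ivec v))\<^sup>2 < (norm ?w)\<^sup>2 * (norm (ivec v))\<^sup>2"
    unfolding power_mult_distrib[symmetric] by (metis abs_ge_zero power2_abs power_strict_mono zero_less_numeral)
  then have "?w \<bullet> ivec v \<noteq> 0" using cross2_sq_add_inner_sq[of ?w "ivec v"] by auto
  then consider "0 < ?w \<bullet> ivec v" | "0 < ?w \<bullet> ivec (- v)"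
    by (fastforce simp: ivec_def inner_prod_def)
  then show thesis
  proof cases
    case 1 then show ?thesis using that[OF slit v(1) w(2) w(1) cv _ nv \<theta>v] by simp
  next
    case 2
    have m: "ivec (- v) = - ivec v" by (simp add: ivec_def)
    show ?thesis
      using that[OF slit _ w(2) w(1) _ 2] v(1) cv nv \<theta>v
      by (simp add: m path_limits_uminus primitive_def)
  qed
qed

text \<open>By the Jacobi identity \<open>w\<close> is a combination of \<open>u\<close> and \<open>u'\<close> whose coefficients are the cross products with \<open>w\<close>,
  divided by the cross product of \<open>u\<close> and \<open>u'\<close>, a nonzero integer.\<close>

lemma child_norm_ge:
  assumes \<epsilon>: "0 < \<epsilon>" "\<epsilon> \<le> 1/4" and "norm (ivec u) \<le> 2 * norm w"
    "\<bar>cross2 w (ivec u)\<bar> \<le> \<epsilon>" "\<bar>cross2 w (ivec u')\<bar> \<le> \<epsilon>" "cross2 (ivec u) (ivec u') \<noteq> 0"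
  shows "norm w \<le> 2 * \<epsilon> * norm (ivec u')"
proof -
  have "cross2 (ivec u) (ivec u') *\<^sub>R w = - (cross2 (ivec u') w *\<^sub>R ivec u + cross2 w (ivec u) *\<^sub>R ivec u')"
    using cross2_jacobi[of "ivec u" "ivec u'" w] by (simp only: eq_neg_iff_add_eq_0 add.assoc)
  then have "norm (cross2 (ivec u) (ivec u') *\<^sub>R w) \<le> norm (cross2 (ivec u') w *\<^sub>R ivec u) + norm (cross2 w (ivec u) *\<^sub>R ivec u')"
    by (simp only: norm_minus_cancel norm_triangle_ineq)
  then have "\<bar>cross2 (ivec u) (ivec u')\<bar> * norm w \<le> \<bar>cross2 w (ivec u')\<bar> * norm (ivec u) + \<bar>cross2 w (ivec u)\<bar> * norm (ivec u')"
    using cross2_swap[of "ivec u'" w] by simp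
  also have "\<dots> \<le> \<epsilon> * (2 * norm w) + \<epsilon> * norm (ivec u')"
    using assms by (intro add_mono mult_mono) auto
  finally have "\<bar>cross2 (ivec u) (ivec u')\<bar> * norm w \<le> \<epsilon> * (2 * norm w) + \<epsilon> * norm (ivec u')" .
  moreover have "1 * norm w \<le> \<bar>cross2 (ivec u) (ivec u')\<bar> * norm w"
    by (intro mult_right_mono abs_cross2_ivec_ge_1 assms) auto
  moreover have "\<epsilon> * (2 * norm w) \<le> 1/4 * (2 * norm w)" using \<epsilon> by (intro mult_right_mono) auto
  ultimately show ?thesis by simp
qed

text \<open>Two of these slits differ by an integer vector whose cross product with \<open>u\<close> is an integer below one, hence
  zero. So they lie on one line, with spacing at least the length of \<open>u\<close>.\<close>

lemma slits_near_direction_card: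
  fixes \<mu> :: real
  assumes \<epsilon>: "0 \<le> \<epsilon>" "\<epsilon> \<le> 1/4" and u: "primitive u" and Y: "0 \<le> Y"
  defines "A \<equiv> {w \<in> slits \<mu>. \<bar>cross2 w (ivec u)\<bar> \<le> \<epsilon> \<and> norm w \<le> Y}"
  shows "finite A" "real (card A) \<le> 1 + 2 * Y / norm (ivec u)"
proof -
  let ?n = "norm (ivec u)"
  have n: "0 < ?n" using primitive_norm_ge_1[OF u] by linarith
  let ?f = "\<lambda>w. (w \<bullet> ivec u) / ?n"
  have sep: "?n \<le> \<bar>?f a - ?f b\<bar>" if ab: "a \<in> A" "b \<in> A" "a \<noteq> b" for a b
  proof -
    obtain z where z: "a - b = ivec z" using ab slits_diff[of b \<mu> a] by (auto simp: A_def)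
    have "\<bar>cross2 (ivec z) (ivec u)\<bar> \<le> \<bar>cross2 a (ivec u)\<bar> + \<bar>cross2 b (ivec u)\<bar>"
      unfolding z[symmetric] cross2_add by linarith
    also have "\<dots> \<le> 1/4 + 1/4" using ab \<epsilon> by (intro add_mono) (auto simp: A_def)
    finally have "\<not> 1 \<le> \<bar>cross2 (ivec z) (ivec u)\<bar>" by simp
    then have "cross2 (ivec z) (ivec u) = 0" using abs_cross2_ivec_ge_1 by blast
    then have "cross2 (ivec u) (ivec z) = 0" using cross2_swap[of "ivec u" "ivec z"] by simp
    then obtain c where c: "z = (c * fst u, c * snd u)" using parallel_primitive_multiple[OF u] by blast
    then have zc: "ivec z = real_of_int c *\<^sub>R ivec u" by (simp add: ivec_def)
    have "c \<noteq> 0" using ab(3) z zc by auto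
    then have c1: "1 \<le> \<bar>real_of_int c\<bar>" by linarith
    have "?f a - ?f b = (ivec z \<bullet> ivec u) / ?n"
      by (simp add: z[symmetric] inner_diff_left diff_divide_distrib)
    also have "\<dots> = real_of_int c * ?n" using n
      by (simp add: zc power2_norm_eq_inner[symmetric] power2_eq_square)
    finally show ?thesis using c1 n by (simp add: abs_mult mult_le_cancel_right1)
  qed
  have range: "- Y \<le> ?f a \<and> ?f a \<le> Y" if "a \<in> A" for a
  proof -
    have "\<bar>a \<bullet> ivec u\<bar> \<le> norm a * ?n" by (rule Cauchy_Schwarz_ineq2)
    also have "\<dots> \<le> Y * ?n" using that by (intro mult_right_mono) (auto simp: A_def)
    finally have "\<bar>?f a\<bar> \<le> Y" using n by (simp add: field_simps abs_divide)
    then show ?thesis by linarith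
  qed
  show "finite A" using separated_card_le(1)[OF n _ sep range] Y by auto
  show "real (card A) \<le> 1 + 2 * Y / ?n" using separated_card_le(2)[OF n _ sep range] Y by auto
qed

text \<open>Two primitive vectors of length at most \<open>2 * X\<close> differ in direction by at least \<open>1 / (4 * X\<^sup>2)\<close>,
  and the directions considered lie in an interval of length about \<open>\<epsilon> / (X * norm w)\<close> around that of \<open>w\<close>.\<close>

lemma primitives_near_slit_card:
  assumes \<epsilon>: "0 < \<epsilon>" "\<epsilon> \<le> 1/4" and w: "1/2 \<le> norm w" and X: "1/2 \<le> X"
  defines "A \<equiv> {u. primitive u \<and> \<bar>cross2 w (ivec u)\<bar> \<le> \<epsilon> \<and> 0 < w \<bullet> ivec u \<and>
    X \<le> norm (ivec u) \<and> norm (ivec u) \<le> 2 * X}"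
  shows "finite A" "real (card A) \<le> 1 + 16 * \<epsilon> * X / norm w"
proof -
  let ?f = "\<lambda>u. cross2 w (ivec u) / (w \<bullet> ivec u)"
  have n: "0 < norm w" using w by linarith
  have sep: "1 / (4 * X\<^sup>2) \<le> \<bar>?f a - ?f b\<bar>" if ab: "a \<in> A" "b \<in> A" "a \<noteq> b" for a b
  proof -
    have pos: "0 < w \<bullet> ivec a" "0 < w \<bullet> ivec b" using ab by (auto simp: A_def)
    have "b \<noteq> - a" using pos by (auto simp: ivec_def inner_prod_def)
    then have "cross2 (ivec a) (ivec b) \<noteq> 0"
      using parallel_primitives[of a b] ab by (auto simp: A_def)
    then have c: "1 \<le> \<bar>cross2 (ivec a) (ivec b)\<bar>" by (rule abs_cross2_ivec_ge_1)
    have "cross2 w (ivec a) * (w \<bullet> ivec b) - cross2 w (ivec b) * (w \<bullet> ivec a)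
        = - ((norm w)\<^sup>2 * cross2 (ivec a) (ivec b))"
      unfolding norm_pair_sq by (cases w) (simp add: cross2_def inner_prod_def algebra_simps power2_eq_square)
    moreover have "?f a - ?f b = (cross2 w (ivec a) * (w \<bullet> ivec b) - cross2 w (ivec b) * (w \<bullet> ivec a)) / ((w \<bullet> ivec a) * (w \<bullet> ivec b))"
      by (rule diff_frac_eq) (use pos in auto)
    ultimately have "?f a - ?f b = - ((norm w)\<^sup>2 * cross2 (ivec a) (ivec b)) / ((w \<bullet> ivec a) * (w \<bullet> ivec b))"
      by simp
    then have eq: "\<bar>?f a - ?f b\<bar> = (norm w)\<^sup>2 * \<bar>cross2 (ivec a) (ivec b)\<bar> / ((w \<bullet> ivec a) * (w \<bullet> ivec b))"
      using pos by (simp add: abs_mult abs_divide)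
    have le: "w \<bullet> ivec u \<le> norm w * (2 * X)" if "u \<in> A" for u
    proof -
      have "w \<bullet> ivec u \<le> norm w * norm (ivec u)" by (rule norm_cauchy_schwarz)
      also have "\<dots> \<le> norm w * (2 * X)" using that by (intro mult_left_mono) (auto simp: A_def)
      finally show ?thesis .
    qed
    have "1 / (4 * X\<^sup>2) = (norm w)\<^sup>2 * 1 / ((norm w * (2 * X)) * (norm w * (2 * X)))"
      using n X by (simp add: power2_eq_square field_simps)
    also have "\<dots> \<le> (norm w)\<^sup>2 * \<bar>cross2 (ivec a) (ivec b)\<bar> / ((w \<bullet> ivec a) * (w \<bullet> ivec b))"
      using c le[OF ab(1)] le[OF ab(2)] pos X n by (intro frac_le mult_mono mult_left_mono) auto
    finally show ?thesis unfolding eq .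
  qed
  have range: "- (2 * \<epsilon> / (norm w * X)) \<le> ?f a \<and> ?f a \<le> 2 * \<epsilon> / (norm w * X)" if a: "a \<in> A" for a
  proof -
    have pos: "0 < w \<bullet> ivec a" using a by (auto simp: A_def)
    have "1/2 * 1 \<le> norm w * norm (ivec a)"
      using w a primitive_norm_ge_1[of a] by (intro mult_mono) (auto simp: A_def)
    then have "(1/2)\<^sup>2 \<le> (norm w * norm (ivec a))\<^sup>2" by (intro power_mono) auto
    moreover have "(cross2 w (ivec a))\<^sup>2 \<le> (1/4)\<^sup>2"
      using a \<epsilon> by (subst abs_le_square_iff[symmetric]) (auto simp: A_def)
    ultimately have "(norm w * norm (ivec a) / 2)\<^sup>2 \<le> (w \<bullet> ivec a)\<^sup>2"
      using cross2_sq_add_inner_sq[of w "ivec a"] unfolding power_mult_distrib[symmetric] power_divide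
      by (simp add: power2_eq_square)
    then have "norm w * norm (ivec a) / 2 \<le> w \<bullet> ivec a" using pos by (rule power2_le_imp_le[OF _ less_imp_le])
    moreover have "norm w * X \<le> norm w * norm (ivec a)" using a by (intro mult_left_mono) (auto simp: A_def)
    ultimately have ge: "norm w * X / 2 \<le> w \<bullet> ivec a" by linarith
    have "\<bar>?f a\<bar> = \<bar>cross2 w (ivec a)\<bar> / (w \<bullet> ivec a)" using pos by (simp add: abs_divide)
    also have "\<dots> \<le> \<epsilon> / (norm w * X / 2)"
      using a ge n X by (intro frac_le) (auto simp: A_def)
    also have "\<epsilon> / (norm w * X / 2) = 2 * \<epsilon> / (norm w * X)" by simp
    finally show ?thesis by linarith
  qed
  have nn: "- (2 * \<epsilon> / (norm w * X)) \<le> 2 * \<epsilon> / (norm w * X)"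
    using \<epsilon> n X by (simp add: minus_le_iff)
  have pos: "0 < 1 / (4 * X\<^sup>2)" using X by simp
  show "finite A" by (rule separated_card_le(1)[OF pos nn sep range])
  have "real (card A) \<le> 1 + (2 * \<epsilon> / (norm w * X) - - (2 * \<epsilon> / (norm w * X))) / (1 / (4 * X\<^sup>2))"
    by (rule separated_card_le(2)[OF pos nn sep range])
  also have "(2 * \<epsilon> / (norm w * X) - - (2 * \<epsilon> / (norm w * X))) / (1 / (4 * X\<^sup>2)) = 16 * \<epsilon> * X / norm w"
    using n X by (simp add: field_simps power2_eq_square)
  finally show "real (card A) \<le> 1 + 16 * \<epsilon> * X / norm w" .
qed

lemma dyadic_shell:
  assumes "(x::real) \<le> y" "0 < x"
  obtains k :: nat where "2 ^ k * x \<le> y" "y \<le> 2 ^ Suc k * x"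
proof -
  obtain n where "y / x < 2 ^ n" using real_arch_pow[of 2 "y / x"] by auto
  then have ex: "\<exists>n. y \<le> 2 ^ Suc n * x" using assms by (intro exI[of _ n]) (simp add: field_simps)
  define k where "k = (LEAST n. y \<le> 2 ^ Suc n * x)"
  have "y \<le> 2 ^ Suc k * x" unfolding k_def by (rule LeastI_ex[OF ex])
  moreover have "2 ^ k * x \<le> y"
  proof (cases k)
    case (Suc m)
    then show ?thesis using not_less_Least[of m "\<lambda>n. y \<le> 2 ^ Suc n * x"] by (simp add: k_def)
  qed (use assms in simp)
  ultimately show thesis using that by blast
qed

text \<open>The limits of paths along \<open>u\<close> are limits of paths along the children of \<open>u\<close>. In the shell
  \<open>2^k * norm u \<le> 2 * norm w\<close> there are about \<open>2^k\<close> slits, and in the shell \<open>2^l * norm w \<le> 2 * \<epsilon> * norm u'\<close>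
  about \<open>2^l\<close> vectors, so that the exponents \<open>- 2 * s\<close> of the lengths win for \<open>s > 1/2\<close>.\<close>

lemma path_limits_content_step:
  assumes \<mu>: "\<mu> \<notin> \<rat>" and s: "1/2 < s" and \<epsilon>: "0 < \<epsilon>" "\<epsilon> \<le> 1/4" and c: "0 \<le> c"
    and le: "\<And>u'. primitive u' \<Longrightarrow> hausdorff_content s (path_limits \<epsilon> \<mu> u') \<le> ennreal (c * norm (ivec u') powr (- 2 * s))"
    and u: "primitive u"
  shows "hausdorff_content s (path_limits \<epsilon> \<mu> u) \<le>
    ennreal (27 * (4 * \<epsilon>) powr (2 * s) / (1 - 2 powr (1 - 2 * s))\<^sup>2 * c * norm (ivec u) powr (- 2 * s))"
proof -
  let ?D = "path_limits \<epsilon> \<mu>" and ?n = "norm (ivec u)"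
  have n1: "1 \<le> ?n" using primitive_norm_ge_1[OF u] .
  then have n0: "ivec u \<noteq> 0" by auto
  define A where "A k = {w \<in> slits \<mu>. \<bar>cross2 w (ivec u)\<bar> \<le> \<epsilon> \<and> norm w \<le> 2 ^ k * ?n} \<inter> {w. 2 ^ k * ?n / 2 \<le> norm w}" for k :: nat
  define B where "B l w = {u'. primitive u' \<and> \<bar>cross2 w (ivec u')\<bar> \<le> \<epsilon> \<and> 0 < w \<bullet> ivec u' \<and>
    2 ^ l * norm w / (2 * \<epsilon>) \<le> norm (ivec u') \<and> norm (ivec u') \<le> 2 * (2 ^ l * norm w / (2 * \<epsilon>))}" for l :: nat and w
  define x where "x = 2 powr (1 - 2 * s)"
  have x: "0 < x" "x < 1" using s by (auto simp: x_def powr_less_one)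
  have finA: "finite (A k)" and cardA: "real (card (A k)) \<le> 3 * 2 ^ k" for k
  proof -
    let ?A = "{w \<in> slits \<mu>. \<bar>cross2 w (ivec u)\<bar> \<le> \<epsilon> \<and> norm w \<le> 2 ^ k * ?n}"
    note S = slits_near_direction_card[OF less_imp_le[OF \<epsilon>(1)] \<epsilon>(2) u, of "2 ^ k * ?n" \<mu>]
    have fin: "finite ?A" using S(1) n1 by simp
    then show "finite (A k)" by (simp add: A_def)
    have "real (card (A k)) \<le> real (card ?A)" unfolding A_def using fin by (intro of_nat_mono card_mono) auto
    also have "\<dots> \<le> 1 + 2 * (2 ^ k * ?n) / ?n" using S(2) n1 by simp
    also have "\<dots> \<le> 3 * 2 ^ k" using n0 one_le_power[of "2::real" k] by simp
    finally show "real (card (A k)) \<le> 3 * 2 ^ k" .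
  qed
  have finB: "finite (B l w)" and cardB: "real (card (B l w)) \<le> 9 * 2 ^ l" if "w \<in> A k" for k l w
  proof -
    have w: "1/2 \<le> norm w"
    proof -
      have "1 * 1 \<le> 2 ^ k * ?n" using n1 by (intro mult_mono) auto
      then show ?thesis using that by (auto simp: A_def)
    qed
    let ?X = "2 ^ l * norm w / (2 * \<epsilon>)"
    have "norm w * (2 * \<epsilon>) \<le> norm w * 1" using \<epsilon> by (intro mult_left_mono) auto
    then have "norm w \<le> norm w / (2 * \<epsilon>)" using \<epsilon> by (simp add: pos_le_divide_eq)
    also have "\<dots> \<le> ?X" using \<epsilon> w one_le_power[of "2::real" l] by (intro divide_right_mono) (auto simp: mult_le_cancel_right1)
    finally have X: "1/2 \<le> ?X" using w by linarith
    note P = primitives_near_slit_card[OF \<epsilon> w X, folded B_def]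
    show "finite (B l w)" by (rule P(1))
    have "real (card (B l w)) \<le> 1 + 16 * \<epsilon> * ?X / norm w" by (rule P(2))
    also have "16 * \<epsilon> * ?X / norm w = 8 * 2 ^ l" using w \<epsilon> by auto
    also have "1 + 8 * (2::real) ^ l \<le> 9 * 2 ^ l" using one_le_power[of "2::real" l] by simp
    finally show "real (card (B l w)) \<le> 9 * 2 ^ l" .
  qed
  have cover: "?D u \<subseteq> (\<Union>k. \<Union>l. \<Union>w\<in>A k. \<Union>u'\<in>B l w. ?D u')"
  proof
    fix \<theta> assume \<theta>: "\<theta> \<in> ?D u"
    have "\<epsilon> < 1/2" using \<epsilon> by simp
    from path_limits_child[OF \<mu> this u \<theta>] obtain w u' where w: "w \<in> slits \<mu>" "primitive u'" "?n \<le> 2 * norm w"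
      "\<bar>cross2 w (ivec u)\<bar> \<le> \<epsilon>" "\<bar>cross2 w (ivec u')\<bar> \<le> \<epsilon>" "0 < w \<bullet> ivec u'"
      "cross2 (ivec u) (ivec u') \<noteq> 0" "\<theta> \<in> ?D u'" .
    have "norm w \<le> 2 * \<epsilon> * norm (ivec u')" using child_norm_ge[OF \<epsilon> w(3,4,5,7)] .
    then have "norm w / (2 * \<epsilon>) \<le> norm (ivec u')" using \<epsilon> by (simp add: pos_divide_le_eq mult.commute)
    moreover have "0 < norm w" using w(3) n1 by linarith
    ultimately obtain l where l: "2 ^ l * (norm w / (2 * \<epsilon>)) \<le> norm (ivec u')" "norm (ivec u') \<le> 2 ^ Suc l * (norm w / (2 * \<epsilon>))"
      using dyadic_shell[of "norm w / (2 * \<epsilon>)" "norm (ivec u')"] \<epsilon> by auto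
    obtain k where k: "2 ^ k * (?n / 2) \<le> norm w" "norm w \<le> 2 ^ Suc k * (?n / 2)"
      using dyadic_shell[of "?n / 2" "norm w"] w(3) n1 n0 by auto
    have "w \<in> A k" using w k by (simp add: A_def)
    moreover have "u' \<in> B l w" using w l by (simp add: B_def)
    ultimately show "\<theta> \<in> (\<Union>k. \<Union>l. \<Union>w\<in>A k. \<Union>u'\<in>B l w. ?D u')" using w(8) by blast
  qed
  define a where "a = 27 * c * (4 * \<epsilon>) powr (2 * s) * ?n powr (- 2 * s)"
  have a: "0 \<le> a" using c by (simp add: a_def)
  have cell: "hausdorff_content s (\<Union>w\<in>A k. \<Union>u'\<in>B l w. ?D u') \<le> ennreal (a * x ^ k * x ^ l)" for k l
  proof -
    define y where "y = c * (2 ^ (k + l) * ?n / (4 * \<epsilon>)) powr (- 2 * s)"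
    have y: "0 \<le> y" using c by (simp add: y_def)
    have base: "0 < 2 ^ (k + l) * ?n / (4 * \<epsilon>)"
      using n0 \<epsilon> by (intro divide_pos_pos mult_pos_pos) auto
    have "hausdorff_content s (\<Union>u'\<in>B l w. ?D u') \<le> ennreal (9 * 2 ^ l * y)" if w: "w \<in> A k" for w
    proof -
      have "hausdorff_content s (\<Union>u'\<in>B l w. ?D u') \<le> of_nat (card (B l w)) * ennreal y"
      proof (rule hausdorff_content_finite_UN_le[OF finB[OF w]])
        fix u' assume u': "u' \<in> B l w"
        have "2 ^ (k + l) * ?n / (4 * \<epsilon>) = 2 ^ l * (2 ^ k * ?n / 2) / (2 * \<epsilon>)" by (simp add: power_add)
        also have "\<dots> \<le> 2 ^ l * norm w / (2 * \<epsilon>)"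
          using w \<epsilon> by (intro divide_right_mono mult_left_mono) (auto simp: A_def)
        also have "\<dots> \<le> norm (ivec u')" using u' by (simp add: B_def)
        finally have "norm (ivec u') powr (- 2 * s) \<le> (2 ^ (k + l) * ?n / (4 * \<epsilon>)) powr (- 2 * s)"
          using base s by (intro powr_mono2') auto
        then have "c * norm (ivec u') powr (- 2 * s) \<le> y" unfolding y_def using c by (rule mult_left_mono)
        moreover have "primitive u'" using u' by (simp add: B_def)
        ultimately show "hausdorff_content s (?D u') \<le> ennreal y"
          using le by (meson ennreal_leI order_trans)
      qed
      also have "\<dots> = ennreal (real (card (B l w)) * y)"
        using y by (simp add: ennreal_mult ennreal_of_nat_eq_real_of_nat)
      also have "\<dots> \<le> ennreal (9 * 2 ^ l * y)"
        using cardB[OF w] y by (intro ennreal_leI mult_right_mono) auto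
      finally show ?thesis .
    qed
    then have "hausdorff_content s (\<Union>w\<in>A k. \<Union>u'\<in>B l w. ?D u') \<le> of_nat (card (A k)) * ennreal (9 * 2 ^ l * y)"
      by (rule hausdorff_content_finite_UN_le[OF finA])
    also have "\<dots> = ennreal (real (card (A k)) * (9 * 2 ^ l * y))"
      using y by (simp add: ennreal_mult ennreal_of_nat_eq_real_of_nat)
    also have "\<dots> \<le> ennreal (3 * 2 ^ k * (9 * 2 ^ l * y))"
      using cardA y by (intro ennreal_leI mult_right_mono) auto
    also have "3 * 2 ^ k * (9 * 2 ^ l * y) = a * x ^ k * x ^ l"
    proof -
      have x_pow: "x ^ m = 2 ^ m * (2 ^ m) powr (- 2 * s)" for m
        unfolding x_def using powr_realpow[of 2 m]
        by (simp add: powr_powr powr_add[symmetric] algebra_simps flip: powr_realpow)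
      have "(2 ^ (k + l) * ?n / (4 * \<epsilon>)) powr (- 2 * s)
          = (2 ^ k) powr (- 2 * s) * (2 ^ l) powr (- 2 * s) * ?n powr (- 2 * s) * (4 * \<epsilon>) powr (2 * s)"
        using \<epsilon> n1 by (simp add: powr_mult powr_divide power_add powr_minus field_simps)
      then show ?thesis by (simp add: a_def y_def x_pow mult_ac)
    qed
    finally show ?thesis .
  qed
  have "hausdorff_content s (?D u) \<le> hausdorff_content s (\<Union>k. \<Union>l. \<Union>w\<in>A k. \<Union>u'\<in>B l w. ?D u')"
    by (rule hausdorff_content_mono[OF cover])
  also have "\<dots> \<le> (\<Sum>k. hausdorff_content s (\<Union>l. \<Union>w\<in>A k. \<Union>u'\<in>B l w. ?D u'))"
    by (rule hausdorff_content_UN_le)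
  also have "\<dots> \<le> (\<Sum>k. \<Sum>l. ennreal (a * x ^ k * x ^ l))"
  proof (intro suminf_le summableI)
    fix k
    have "hausdorff_content s (\<Union>l. \<Union>w\<in>A k. \<Union>u'\<in>B l w. ?D u') \<le> (\<Sum>l. hausdorff_content s (\<Union>w\<in>A k. \<Union>u'\<in>B l w. ?D u'))"
      by (rule hausdorff_content_UN_le)
    also have "\<dots> \<le> (\<Sum>l. ennreal (a * x ^ k * x ^ l))" by (intro suminf_le summableI cell)
    finally show "hausdorff_content s (\<Union>l. \<Union>w\<in>A k. \<Union>u'\<in>B l w. ?D u') \<le> (\<Sum>l. ennreal (a * x ^ k * x ^ l))" .
  qed
  also have "\<dots> = (\<Sum>k. ennreal (a / (1 - x) * x ^ k))"
  proof -
    have "(\<Sum>l. ennreal (a * x ^ k * x ^ l)) = ennreal (a / (1 - x) * x ^ k)" for k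
    proof (rule suminf_ennreal_eq)
      show "(\<lambda>l. a * x ^ k * x ^ l) sums (a / (1 - x) * x ^ k)"
        using sums_mult[OF geometric_sums[of x], of "a * x ^ k"] x by (simp add: mult_ac)
    qed (use a x in auto)
    then show ?thesis by simp
  qed
  also have "\<dots> = ennreal (a / (1 - x)\<^sup>2)"
  proof (rule suminf_ennreal_eq)
    show "(\<lambda>k. a / (1 - x) * x ^ k) sums (a / (1 - x)\<^sup>2)"
      using sums_mult[OF geometric_sums[of x], of "a / (1 - x)"] x by (simp add: power2_eq_square)
  qed (use a x in auto)
  also have "a / (1 - x)\<^sup>2 = 27 * (4 * \<epsilon>) powr (2 * s) / (1 - 2 powr (1 - 2 * s))\<^sup>2 * c * ?n powr (- 2 * s)"
    by (simp add: a_def x_def)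
  finally show ?thesis .
qed

lemma hausdorff_content_cball_le:
  fixes x :: "'a::metric_space"
  assumes "0 < s" "0 \<le> r"
  shows "hausdorff_content s (cball x r) \<le> ennreal ((2 * r) powr s)"
proof -
  have "dist y z \<le> 2 * r" if "y \<in> cball x r" "z \<in> cball x r" for y z
    using that dist_triangle2[of y z x] by (auto simp: dist_commute)
  then show ?thesis
    using hausdorff_content_bounded_le[of "cball x r" s] diam_pow_le[of s "cball x r" "2 * r"] assms
    by (meson bounded_cball mult_nonneg_nonneg order_trans zero_le_numeral)
qed

text \<open>All these limits are close to the direction of \<open>u\<close> or to the opposite one.\<close>

lemma path_limits_content_base:
  assumes s: "0 < s" and \<epsilon>: "0 \<le> \<epsilon>" "\<epsilon> \<le> 1/4" and u: "primitive u"
  shows "hausdorff_content s (path_limits \<epsilon> \<mu> u) \<le> ennreal (2 * 6 powr s * norm (ivec u) powr (- 2 * s))"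
proof -
  let ?n = "norm (ivec u)"
  have n: "0 < ?n" using primitive_norm_ge_1[OF u] by linarith
  define e where "e = ivec u /\<^sub>R ?n"
  have e: "norm e = 1" using n by (simp add: e_def)
  define r where "r = 3 / ?n\<^sup>2"
  have r: "0 \<le> r" by (simp add: r_def)
  have "path_limits \<epsilon> \<mu> u \<subseteq> cball e r \<union> cball (- e) r"
  proof
    fix \<theta> assume \<theta>: "\<theta> \<in> path_limits \<epsilon> \<mu> u"
    then have \<theta>1: "norm \<theta> = 1" by (auto simp: path_limits_def slit_path_def)
    have "\<bar>cross2 \<theta> e\<bar> = \<bar>cross2 \<theta> (ivec u)\<bar> / ?n" using n by (simp add: e_def abs_mult divide_inverse mult.commute)
    also have "\<dots> \<le> (6 * \<epsilon> / ?n) / ?n" using path_limits_cross_le[OF u \<theta>] by (intro divide_right_mono) auto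
    also have "\<dots> \<le> (6 * (1/4) / ?n) / ?n" using \<epsilon> by (intro divide_right_mono mult_left_mono) auto
    finally have cr: "2 * \<bar>cross2 \<theta> e\<bar> \<le> r" by (simp add: r_def power2_eq_square)
    have near: "dist \<theta> f \<le> r" if f: "norm f = 1" "\<bar>cross2 \<theta> f\<bar> = \<bar>cross2 \<theta> e\<bar>" "0 \<le> \<theta> \<bullet> f" for f
    proof -
      have le1: "\<theta> \<bullet> f \<le> 1" using norm_cauchy_schwarz[of \<theta> f] \<theta>1 f by simp
      have sq: "(cross2 \<theta> f)\<^sup>2 + (\<theta> \<bullet> f)\<^sup>2 = 1" using cross2_sq_add_inner_sq[of \<theta> f] \<theta>1 f by simp
      have "(dist \<theta> f)\<^sup>2 = 2 - 2 * (\<theta> \<bullet> f)"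
        unfolding dist_norm power2_norm_eq_inner
        using \<theta>1 f(1) by (simp add: inner_diff inner_commute norm_eq_1)
      also have "\<dots> \<le> (2 * \<bar>cross2 \<theta> f\<bar>)\<^sup>2"
      proof -
        have "0 \<le> (1 - \<theta> \<bullet> f) * (2 + 4 * (\<theta> \<bullet> f))" using le1 f(3) by (intro mult_nonneg_nonneg) auto
        then show ?thesis using sq by (simp add: power_mult_distrib algebra_simps power2_eq_square)
      qed
      also have "\<dots> \<le> r\<^sup>2" using cr f(2) by (intro power_mono) auto
      finally show ?thesis using r by (rule power2_le_imp_le)
    qed
    show "\<theta> \<in> cball e r \<union> cball (- e) r"
    proof (cases "0 \<le> \<theta> \<bullet> e")
      case True
      then show ?thesis using near[of e] e by (simp add: dist_commute)
    next
      case False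
      then show ?thesis using near[of "- e"] e by (simp add: dist_commute)
    qed
  qed
  then have "hausdorff_content s (path_limits \<epsilon> \<mu> u) \<le> hausdorff_content s (cball e r \<union> cball (- e) r)"
    by (rule hausdorff_content_mono)
  also have "\<dots> \<le> hausdorff_content s (cball e r) + hausdorff_content s (cball (- e) r)"
    by (rule hausdorff_content_Un_le)
  also have "\<dots> \<le> ennreal ((2 * r) powr s) + ennreal ((2 * r) powr s)"
    using s r by (intro add_mono hausdorff_content_cball_le)
  also have "\<dots> = ennreal (2 * (2 * r) powr s)"
    using ennreal_plus[of "(2 * r) powr s" "(2 * r) powr s"] by (simp del: ennreal_plus)
  also have "(2 * r) powr s = 6 powr s * ?n powr (- 2 * s)"
  proof -
    have "?n\<^sup>2 = ?n powr 2" using n by simp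
    then have "(?n\<^sup>2) powr s = ?n powr (2 * s)" by (simp only: powr_powr)
    then show ?thesis by (simp add: r_def powr_divide powr_minus_divide)
  qed
  finally show ?thesis by (simp add: mult.assoc)
qed

lemma path_limits_content_0:
  assumes \<mu>: "\<mu> \<notin> \<rat>" and s: "1/2 < s" and \<epsilon>: "0 < \<epsilon>" "\<epsilon> \<le> 1/4"
    and small: "27 * (4 * \<epsilon>) powr (2 * s) / (1 - 2 powr (1 - 2 * s))\<^sup>2 \<le> 1/2" and u: "primitive u"
  shows "hausdorff_content s (path_limits \<epsilon> \<mu> u) = 0"
proof -
  define c where "c m = 2 * 6 powr s * (1/2) ^ m" for m :: nat
  have c0: "0 \<le> c m" for m by (simp add: c_def)
  have le: "primitive v \<Longrightarrow> hausdorff_content s (path_limits \<epsilon> \<mu> v) \<le> ennreal (c m * norm (ivec v) powr (- 2 * s))" for m v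
  proof (induction m arbitrary: v)
    case 0
    then show ?case using path_limits_content_base[of s \<epsilon> v \<mu>] s \<epsilon> by (simp add: c_def)
  next
    case (Suc m)
    let ?y = "norm (ivec v) powr (- 2 * s)"
    have "hausdorff_content s (path_limits \<epsilon> \<mu> v) \<le>
      ennreal (27 * (4 * \<epsilon>) powr (2 * s) / (1 - 2 powr (1 - 2 * s))\<^sup>2 * c m * ?y)"
      by (rule path_limits_content_step[OF \<mu> s \<epsilon> c0 Suc.IH Suc.prems])
    also have "\<dots> \<le> ennreal (1/2 * c m * ?y)"
      using small c0 by (intro ennreal_leI mult_right_mono) auto
    finally show ?case by (simp add: c_def)
  qed
  have "(\<lambda>m. ennreal (c m * norm (ivec u) powr (- 2 * s))) \<longlonglongrightarrow> ennreal (2 * 6 powr s * 0 * norm (ivec u) powr (- 2 * s))"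
    unfolding c_def by (intro tendsto_ennrealI tendsto_intros LIMSEQ_power_zero) auto
  then have "hausdorff_content s (path_limits \<epsilon> \<mu> u) \<le> ennreal (2 * 6 powr s * 0 * norm (ivec u) powr (- 2 * s))"
    by (rule LIMSEQ_le_const) (use le[OF u] in blast)
  then show ?thesis by simp
qed

text \<open>A tail of every admissible sequence is a path with small sum, and there are only countably many directions
  for its first step.\<close>

theorem K_content_0:
  assumes l: "l / 2 \<notin> \<rat>" and s: "1/2 < s"
  shows "hausdorff_content s (K l) = 0"
proof -
  define x where "x = 2 powr (1 - 2 * s)"
  have x: "0 < x" "x < 1" using s by (auto simp: x_def powr_less_one)
  (* 216 = 2 * 27 * 4 makes the factor in the content step at most 1/2. *)
  define \<epsilon> where "\<epsilon> = min (1/4) ((1 - x)\<^sup>2 / 216)"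
  have \<epsilon>: "0 < \<epsilon>" "\<epsilon> \<le> 1/4" "\<epsilon> \<le> (1 - x)\<^sup>2 / 216" using x by (auto simp: \<epsilon>_def)
  have "(4 * \<epsilon>) powr (2 * s) \<le> (4 * \<epsilon>) powr 1" using \<epsilon> s by (intro powr_mono') auto
  then have "27 * (4 * \<epsilon>) powr (2 * s) \<le> 1/2 * (1 - x)\<^sup>2" using \<epsilon> by simp
  then have small: "27 * (4 * \<epsilon>) powr (2 * s) / (1 - 2 powr (1 - 2 * s))\<^sup>2 \<le> 1/2"
    using x by (simp add: x_def[symmetric] pos_divide_le_eq)
  have "K l \<subseteq> (\<Union>u\<in>{u. primitive u}. path_limits \<epsilon> (l / 2) u)"
  proof
    fix \<theta> assume "\<theta> \<in> K l"
    then have \<theta>1: "norm \<theta> = 1" and ex: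
      "\<exists>w. (\<forall>j. \<exists>m n :: int. even m \<and> even n \<and> n \<noteq> 0 \<and> w j = (l + real_of_int m, real_of_int n)) \<and>
        strict_mono (\<lambda>j. norm (w j)) \<and> summable (\<lambda>j. \<bar>cross2 (w j) (w (Suc j))\<bar>) \<and>
        (\<lambda>j. w j /\<^sub>R norm (w j)) \<longlonglongrightarrow> \<theta>"
      unfolding K_def mem_Collect_eq by simp_all
    from ex obtain w where
      w: "\<forall>j. \<exists>m n :: int. even m \<and> even n \<and> n \<noteq> 0 \<and> w j = (l + real_of_int m, real_of_int n)"
      and mono: "strict_mono (\<lambda>j. norm (w j))" and sm: "summable (\<lambda>j. \<bar>cross2 (w j) (w (Suc j))\<bar>)"
      and lim: "(\<lambda>j. w j /\<^sub>R norm (w j)) \<longlonglongrightarrow> \<theta>"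
      by blast
    define W where "W j = (1/2) *\<^sub>R w j" for j
    have slit: "W j \<in> slits (l / 2)" for j
    proof -
      obtain m n :: int where mn: "even m" "even n" "n \<noteq> 0" "w j = (l + real_of_int m, real_of_int n)" using w by blast
      then have "W j = (l / 2 + real_of_int (m div 2), real_of_int (n div 2)) \<and> n div 2 \<noteq> 0"
        by (auto simp: W_def add_divide_distrib elim!: evenE)
      then show ?thesis unfolding slits_def by blast
    qed
    have S: "summable (\<lambda>j. \<bar>cross2 (W j) (W (Suc j))\<bar>)"
      using summable_mult[OF sm, of "1/4"] by (simp add: W_def abs_mult)
    have "(\<lambda>k. \<Sum>j. \<bar>cross2 (W (j + k)) (W (Suc (j + k)))\<bar>) \<longlonglongrightarrow> 0"
      using suminf_exist_split2[OF S] by (simp add: add_ac)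
    then have "\<forall>\<^sub>F k in sequentially. (\<Sum>j. \<bar>cross2 (W (j + k)) (W (Suc (j + k)))\<bar>) < \<epsilon>"
      using \<epsilon>(1) by (rule order_tendstoD(2))
    then obtain k where k: "(\<Sum>j. \<bar>cross2 (W (j + k)) (W (Suc (j + k)))\<bar>) < \<epsilon>"
      unfolding eventually_sequentially by blast
    have WK: "strict_mono (\<lambda>j. norm (W (j + k)))" "W j /\<^sub>R norm (W j) = w j /\<^sub>R norm (w j)" for j
      using mono by (auto simp: W_def strict_mono_def inverse_eq_divide)
    have path: "slit_path \<epsilon> (l / 2) \<theta> (\<lambda>j. W (j + k))"
      unfolding slit_path_def
      using slit WK(1) summable_ignore_initial_segment[OF S, of k] k \<theta>1 LIMSEQ_ignore_initial_segment[OF lim, of k]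
      by (simp add: WK(2))
    obtain d u where u: "primitive u" "d \<noteq> 0" "W (Suc 0 + k) - W (0 + k) = real_of_int d *\<^sub>R ivec u"
      using slit_path_difference[OF path, of 0] .
    then have "\<theta> \<in> path_limits \<epsilon> (l / 2) u"
      using path unfolding path_limits_def by (auto intro!: exI[of _ "\<lambda>j. W (j + k)"])
    then show "\<theta> \<in> (\<Union>u\<in>{u. primitive u}. path_limits \<epsilon> (l / 2) u)" using u(1) by blast
  qed
  moreover have "hausdorff_content s (\<Union>u\<in>{u. primitive u}. path_limits \<epsilon> (l / 2) u) = 0"
    by (rule hausdorff_content_countable_UN_zero) (use path_limits_content_0[OF l s \<epsilon>(1,2) small] in auto)
  ultimately show ?thesis using hausdorff_content_mono by (metis le_zero_eq)
qed

section \<open>Counting lattice vectors near a slit\<close>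

abbreviation height :: "int \<times> int \<Rightarrow> real" where "height u \<equiv> real_of_int (snd u)"

definition det2 :: "int \<times> int \<Rightarrow> int \<times> int \<Rightarrow> int" where
  "det2 u v = fst u * snd v - snd u * fst v"

lemma real_det2: "real_of_int (det2 u v) = cross2 (ivec u) (ivec v)"
  by (simp add: det2_def cross2_ivec mult.commute)

lemma det2_eq_0:
  assumes "primitive u" "det2 u v = 0"
  obtains c where "v = (c * fst u, c * snd u)"
proof (rule parallel_primitive_multiple[OF assms(1)])
  show "cross2 (ivec u) (ivec v) = 0" using assms(2) by (simp add: real_det2[symmetric])
qed

text \<open>The pairs with the common divisor \<open>d\<close> number at most \<open>I * J / d\<^sup>2\<close>, and the sum of \<open>1 / d\<^sup>2\<close> over \<open>d \<ge> 2\<close> is at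
  most \<open>3/4\<close>.\<close>

lemma card_coprime_pairs:
  "real I * real J / 4 \<le> real (card {(i, j). i \<in> {1..I} \<and> j \<in> {1..J} \<and> coprime i j})"
proof -
  let ?C = "{(i, j). i \<in> {1..I} \<and> j \<in> {1..J} \<and> coprime i j}"
  let ?N = "{(i, j). i \<in> {1..I} \<and> j \<in> {1..J} \<and> \<not> coprime i j}"
  have fin: "finite ?C" "finite ?N" by (rule finite_subset[of _ "{1..I} \<times> {1..J}"]; auto)+
  have "?N \<subseteq> (\<Union>d\<in>{2..I}. (\<lambda>(i, j). (d * i, d * j)) ` ({1..I div d} \<times> {1..J div d}))"
  proof
    fix z assume "z \<in> ?N"
    then obtain i j where z: "z = (i, j)" "1 \<le> i" "i \<le> I" "1 \<le> j" "j \<le> J" "\<not> coprime i j" by auto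
    define d where "d = gcd i j"
    have d: "d dvd i" "d dvd j" "d \<noteq> 1" "d \<noteq> 0" using z by (auto simp: d_def coprime_iff_gcd_eq_1)
    have "2 \<le> d" using d(3,4) by linarith
    moreover have "d \<le> I" using dvd_imp_le[OF d(1)] z(2,3) by linarith
    moreover have eq: "i = d * (i div d)" "j = d * (j div d)" using d(1,2) by simp_all
    moreover have "i div d \<noteq> 0" "j div d \<noteq> 0" using eq z(2,4) by (metis mult_0_right not_one_le_zero)+
    then have "i div d \<in> {1..I div d}" "j div d \<in> {1..J div d}"
      using div_le_mono[OF z(3), of d] div_le_mono[OF z(5), of d] by auto
    ultimately show "z \<in> (\<Union>d\<in>{2..I}. (\<lambda>(i, j). (d * i, d * j)) ` ({1..I div d} \<times> {1..J div d}))"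
      using z(1) by (intro UN_I[of d] image_eqI[of _ _ "(i div d, j div d)"]) auto
  qed
  then have "card ?N \<le> card (\<Union>d\<in>{2..I}. (\<lambda>(i, j). (d * i, d * j)) ` ({1..I div d} \<times> {1..J div d}))"
    by (intro card_mono) auto
  also have "\<dots> \<le> (\<Sum>d\<in>{2..I}. card ((\<lambda>(i, j). (d * i, d * j)) ` ({1..I div d} \<times> {1..J div d})))"
    by (rule card_UN_le) simp
  also have "\<dots> \<le> (\<Sum>d\<in>{2..I}. (I div d) * (J div d))"
  proof (rule sum_mono)
    fix d
    have "card ((\<lambda>(i, j). (d * i, d * j)) ` ({1..I div d} \<times> {1..J div d})) \<le> card ({1..I div d} \<times> {1..J div d})"
      by (rule card_image_le) simp
    then show "card ((\<lambda>(i, j). (d * i, d * j)) ` ({1..I div d} \<times> {1..J div d})) \<le> (I div d) * (J div d)"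
      by (simp add: card_cartesian_product)
  qed
  finally have "real (card ?N) \<le> (\<Sum>d\<in>{2..I}. real (I div d) * real (J div d))"
    by (simp flip: of_nat_mult of_nat_sum)
  also have "\<dots> \<le> (\<Sum>d\<in>{2..I}. (I / d) * (J / d))"
    by (intro sum_mono mult_mono of_nat_div_le_of_nat) auto
  also have "\<dots> = I * J * (\<Sum>d\<in>{2..I}. 1 / (real d)\<^sup>2)"
    by (simp add: sum_distrib_left power2_eq_square)
  also have "\<dots> \<le> I * J * (3 / 4)"
  proof (intro mult_left_mono)
    have *: "(\<Sum>d\<in>{2..n}. 1 / (real d)\<^sup>2) \<le> 3/4 - 1 / n" if "2 \<le> n" for n :: nat
      using that
    proof (induction n rule: dec_induct)
      case (step n)
      have "1 / (real (Suc n))\<^sup>2 \<le> 1 / n - 1 / Suc n"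
      proof -
        have "1 / (real (Suc n))\<^sup>2 \<le> 1 / (real n * real (Suc n))"
          using step(1) by (intro divide_left_mono) (auto simp: power2_eq_square)
        also have "\<dots> = 1 / n - 1 / Suc n" using step(1) by (simp add: field_simps)
        finally show ?thesis .
      qed
      then show ?case using step by simp
    qed simp
    show "(\<Sum>d\<in>{2..I}. 1 / (real d)\<^sup>2) \<le> 3/4"
    proof (cases "2 \<le> I")
      case True
      have "0 \<le> 1 / real I" by simp
      with *[OF True] show ?thesis by linarith
    qed simp
  qed simp
  finally have N: "real (card ?N) \<le> I * J * (3 / 4)" .
  have "card ?C + card ?N = card (?C \<union> ?N)" by (rule card_Un_disjoint[symmetric, OF fin]) auto
  also have "?C \<union> ?N = {1..I} \<times> {1..J}" by auto
  finally have eq: "card ?C + card ?N = I * J" by (simp add: card_cartesian_product)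
  have "real (card ?C + card ?N) = real (I * J)" by (simp only: eq)
  with N show ?thesis unfolding of_nat_add of_nat_mult by linarith
qed

text \<open>A vector that is shortest in the norm given by the height in units of \<open>R\<close> and the value of the
  linear form in units of \<open>\<epsilon>\<close> extends to a basis. After reduction, one basis vector \<open>P\<close> is as long as
  its height says and the other, \<open>T\<close>, as long as its value says; the product of the two lengths is
  then at most twice the area of a fundamental cell.\<close>

lemma reduced_basis:
  fixes \<alpha> \<beta> R \<epsilon> :: real
  assumes pos: "0 < \<beta>" "0 < R" "0 < \<epsilon>"
  defines "L \<equiv> \<lambda>u. \<alpha> * height u - \<beta> * real_of_int (fst u)"
  obtains P T :: "int \<times> int" where "\<bar>det2 P T\<bar> = 1" "0 < snd P" "0 \<le> snd T"
    "\<bar>L P\<bar> * R \<le> \<epsilon> * height P" "\<epsilon> * height T \<le> R * \<bar>L T\<bar>"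
    "height P * \<bar>L T\<bar> \<le> 2 * \<beta>"
proof -
  define n where "n u = max (\<bar>height u\<bar> / R) (\<bar>L u\<bar> / \<epsilon>)" for u
  define S where "S = {u. u \<noteq> (0, 0) \<and> n u \<le> n (1, 0)}"
  define N where "N = n (1, 0)"
  have finS: "finite S"
  proof -
    define B C where "B = \<lceil>R * N\<rceil>" and "C = \<lceil>(\<bar>\<alpha>\<bar> * (R * N) + \<epsilon> * N) / \<beta>\<rceil>"
    have "S \<subseteq> {-C..C} \<times> {-B..B}"
    proof
      fix u assume u: "u \<in> S"
      have 1: "\<bar>height u\<bar> \<le> R * N" "\<bar>L u\<bar> \<le> \<epsilon> * N"
        using u pos by (auto simp: S_def n_def N_def pos_divide_le_eq mult.commute)
      have "\<beta> * \<bar>real_of_int (fst u)\<bar> = \<bar>\<alpha> * height u - L u\<bar>" using pos by (simp add: L_def abs_mult)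
      also have "\<dots> \<le> \<bar>\<alpha>\<bar> * \<bar>height u\<bar> + \<bar>L u\<bar>" by (metis abs_mult abs_triangle_ineq4)
      also have "\<dots> \<le> \<bar>\<alpha>\<bar> * (R * N) + \<epsilon> * N" using 1 by (intro add_mono mult_left_mono) auto
      finally have 2: "\<bar>real_of_int (fst u)\<bar> \<le> (\<bar>\<alpha>\<bar> * (R * N) + \<epsilon> * N) / \<beta>"
        using pos by (simp add: pos_le_divide_eq mult.commute)
      have "\<bar>snd u\<bar> \<le> B" "\<bar>fst u\<bar> \<le> C" unfolding B_def C_def using 1 2 by linarith+
      then show "u \<in> {-C..C} \<times> {-B..B}" by (cases u) auto
    qed
    then show ?thesis using finite_subset by blast
  qed
  have "(1, 0) \<in> S" by (simp add: S_def)
  then have "S \<noteq> {}" by blast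
  then obtain z where z: "z \<in> S" "\<And>u. u \<in> S \<Longrightarrow> n z \<le> n u"
    using that[of "arg_min_on n S"] finS by (simp add: arg_min_if_finite(1) arg_min_least)
  have z_min: "n z \<le> n u" if "u \<noteq> (0, 0)" for u
  proof (cases "u \<in> S")
    case True
    then show ?thesis by (rule z(2))
  next
    case False
    then have "n (1, 0) < n u" using that by (auto simp: S_def not_le)
    moreover have "n z \<le> n (1, 0)" by (rule z(2)) fact
    ultimately show ?thesis by simp
  qed
  have "z \<noteq> (0, 0)" using z(1) by (simp add: S_def)
  then obtain d u where u: "primitive u" "0 < d" "z = (d * fst u, d * snd u)"
    using eq_multiple_primitive by blast
  have "n z = d * n u"
  proof -
    have "L z = d * L u" unfolding u(3) L_def by (simp add: algebra_simps)
    then show ?thesis using u(2) by (simp add: n_def u(3) abs_mult max_mult_distrib_left)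
  qed
  moreover have n_nonneg: "0 \<le> n v" for v using pos by (auto simp: n_def le_max_iff_disj)
  then have "1 * n u \<le> d * n u" using u(2) by (intro mult_right_mono) auto
  ultimately have min: "n u \<le> n v" if "v \<noteq> (0, 0)" for v using z_min[OF that] by simp
  have "u \<noteq> (0, 0)" using u(1) by (auto simp: primitive_def)
  have n_pos: "0 < n u"
  proof (rule ccontr)
    assume "\<not> 0 < n u"
    then have *: "\<bar>height u\<bar> / R \<le> 0" "\<bar>L u\<bar> / \<epsilon> \<le> 0" by (auto simp: n_def)
    then have "snd u = 0" using pos by (simp add: divide_le_0_iff)
    moreover from this have "fst u = 0" using * pos by (simp add: divide_le_0_iff L_def)
    ultimately show False using \<open>u \<noteq> (0, 0)\<close> by (simp add: prod_eq_iff)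
  qed
  obtain v0 where v0: "det2 u v0 = 1"
  proof -
    obtain x y where "x * fst u + y * snd u = gcd (fst u) (snd u)" using bezout_int by blast
    then have "det2 u (- y, x) = 1" using u(1) by (simp add: primitive_def det2_def algebra_simps)
    then show thesis by (rule that)
  qed
  define v where "v c = (fst v0 - c * fst u, snd v0 - c * snd u)" for c :: int
  have det: "det2 u (v c) = 1" for c using v0 by (simp add: v_def det2_def algebra_simps)
  have L_v: "L (v c) = L v0 - c * L u" for c by (simp add: v_def L_def algebra_simps)
  have v_neq: "v c \<noteq> (0, 0)" for c using det[of c] by (auto simp: det2_def)
  have area: "\<bar>snd u * L (v c) - snd (v c) * L u\<bar> = \<beta>" for c
  proof -
    have "snd u * L (v c) - snd (v c) * L u = \<beta> * real_of_int (det2 u (v c)) * (-1) * (-1)"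
      unfolding L_def det2_def by (simp add: algebra_simps)
    then show ?thesis using det[of c] pos by simp
  qed
  have round_ex: "\<exists>c. \<bar>x - of_int c * y\<bar> \<le> \<bar>y\<bar> / 2" if "y \<noteq> 0" for x y :: real
  proof (intro exI[of _ "round (x / y)"])
    have "\<bar>x - of_int (round (x / y)) * y\<bar> = \<bar>of_int (round (x / y)) - x / y\<bar> * \<bar>y\<bar>"
      using that by (simp add: abs_mult[symmetric] algebra_simps abs_minus_commute)
    also have "\<dots> \<le> 1/2 * \<bar>y\<bar>" by (intro mult_right_mono of_int_round_abs_le) auto
    finally show "\<bar>x - of_int (round (x / y)) * y\<bar> \<le> \<bar>y\<bar> / 2" by simp
  qed
  have "\<exists>P T :: int \<times> int. \<bar>det2 P T\<bar> = 1 \<and> 0 < \<bar>snd P\<bar> \<and> \<bar>L P\<bar> * R \<le> \<epsilon> * \<bar>height P\<bar> \<and>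
      \<epsilon> * \<bar>height T\<bar> \<le> R * \<bar>L T\<bar> \<and> \<bar>height P\<bar> * \<bar>L T\<bar> \<le> 2 * \<beta>"
  proof (cases "\<bar>L u\<bar> / \<epsilon> \<le> \<bar>height u\<bar> / R")
    case True
    then have nu: "n u = \<bar>height u\<bar> / R" by (simp add: n_def)
    then have su: "height u \<noteq> 0" using n_pos pos by auto
    then obtain c where c: "\<bar>height v0 - of_int c * height u\<bar> \<le> \<bar>height u\<bar> / 2"
      using round_ex by blast
    then have sv: "\<bar>height (v c)\<bar> \<le> \<bar>height u\<bar> / 2" by (simp add: v_def)
    then have "\<bar>height (v c)\<bar> / R \<le> n u / 2" using divide_right_mono[OF sv, of R] pos by (simp add: nu mult.commute)
    then have lt: "\<bar>height (v c)\<bar> / R < n u" using n_pos by linarith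
    with min[OF v_neq[of c]] have ge: "n u \<le> \<bar>L (v c)\<bar> / \<epsilon>" unfolding n_def[of "v c"] by linarith
    have Lu: "\<bar>L u\<bar> \<le> \<bar>L (v c)\<bar>"
    proof -
      have "\<bar>L u\<bar> / \<epsilon> \<le> \<bar>L (v c)\<bar> / \<epsilon>" using True ge unfolding nu by linarith
      then show ?thesis using pos by (simp add: divide_le_cancel)
    qed
    have 1: "\<bar>L u\<bar> * R \<le> \<epsilon> * \<bar>height u\<bar>" using True pos by (simp add: field_simps)
    have 2: "\<epsilon> * \<bar>height (v c)\<bar> \<le> R * \<bar>L (v c)\<bar>"
      using order_trans[OF less_imp_le[OF lt] ge] pos by (simp add: field_simps)
    have "\<bar>height u\<bar> * \<bar>L (v c)\<bar> \<le> \<beta> + \<bar>height (v c)\<bar> * \<bar>L u\<bar>"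
      using area[of c] abs_triangle_ineq2[of "snd u * L (v c)" "snd (v c) * L u"] by (simp add: abs_mult)
    also have "\<bar>height (v c)\<bar> * \<bar>L u\<bar> \<le> \<bar>height u\<bar> / 2 * \<bar>L (v c)\<bar>"
      using sv Lu by (intro mult_mono) auto
    finally have "\<bar>height u\<bar> * \<bar>L (v c)\<bar> \<le> 2 * \<beta>" by simp
    then show ?thesis using det[of c] su 1 2 by (intro exI[of _ u] exI[of _ "v c"]) auto
  next
    case False
    then have nu: "n u = \<bar>L u\<bar> / \<epsilon>" by (simp add: n_def)
    then have "L u \<noteq> 0" using n_pos pos by auto
    then obtain c where c: "\<bar>L v0 - of_int c * L u\<bar> \<le> \<bar>L u\<bar> / 2" using round_ex by blast
    then have sv: "\<bar>L (v c)\<bar> \<le> \<bar>L u\<bar> / 2" by (simp add: L_v)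
    then have "\<bar>L (v c)\<bar> / \<epsilon> \<le> n u / 2" using divide_right_mono[OF sv, of \<epsilon>] pos by (simp add: nu mult.commute)
    then have lt: "\<bar>L (v c)\<bar> / \<epsilon> < n u" using n_pos by linarith
    with min[OF v_neq[of c]] have ge: "n u \<le> \<bar>height (v c)\<bar> / R" unfolding n_def[of "v c"] by linarith
    have pv: "0 < \<bar>snd (v c)\<bar>"
    proof (rule ccontr)
      assume "\<not> 0 < \<bar>snd (v c)\<bar>"
      then show False using ge n_pos by simp
    qed
    have "\<bar>height u\<bar> / R \<le> \<bar>height (v c)\<bar> / R" using False ge unfolding nu by linarith
    then have su: "\<bar>height u\<bar> \<le> \<bar>height (v c)\<bar>" using pos by (simp add: divide_le_cancel)
    have 1: "\<bar>L (v c)\<bar> * R \<le> \<epsilon> * \<bar>height (v c)\<bar>"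
      using order_trans[OF less_imp_le[OF lt] ge] pos by (simp add: field_simps)
    have 2: "\<epsilon> * \<bar>height u\<bar> \<le> R * \<bar>L u\<bar>" using False pos by (simp add: field_simps)
    have "\<bar>height (v c)\<bar> * \<bar>L u\<bar> \<le> \<beta> + \<bar>height u\<bar> * \<bar>L (v c)\<bar>"
      using area[of c] abs_triangle_ineq2[of "snd (v c) * L u" "snd u * L (v c)"]
      by (simp add: abs_mult abs_minus_commute)
    also have "\<bar>height u\<bar> * \<bar>L (v c)\<bar> \<le> \<bar>height (v c)\<bar> * (\<bar>L u\<bar> / 2)"
      using sv su by (intro mult_mono) auto
    finally have 3: "\<bar>height (v c)\<bar> * \<bar>L u\<bar> \<le> 2 * \<beta>" by simp
    have "\<bar>det2 (v c) u\<bar> = 1" using det[of c] by (simp add: det2_def algebra_simps abs_if)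
    then show ?thesis using pv 1 2 3 by (intro exI[of _ "v c"] exI[of _ u]) auto
  qed
  then obtain P T where PT: "\<bar>det2 P T\<bar> = 1" "0 < \<bar>snd P\<bar>" "\<bar>L P\<bar> * R \<le> \<epsilon> * \<bar>height P\<bar>"
      "\<epsilon> * \<bar>height T\<bar> \<le> R * \<bar>L T\<bar>" "\<bar>height P\<bar> * \<bar>L T\<bar> \<le> 2 * \<beta>" by blast
  define fl where "fl u = (if snd u < 0 then - u else u)" for u :: "int \<times> int"
  have fl: "\<bar>L (fl u)\<bar> = \<bar>L u\<bar>" "snd (fl u) = \<bar>snd u\<bar>" for u
    by (auto simp: fl_def L_def)
  have "\<bar>det2 (fl P) (fl T)\<bar> = \<bar>det2 P T\<bar>" by (auto simp: fl_def det2_def)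
  then show thesis using that[of "fl P" "fl T"] PT by (simp add: fl)
qed

text \<open>Combinations \<open>i * P + j * T\<close> of a reduced basis with coprime \<open>i\<close> and \<open>j\<close> are primitive, and they satisfy the
  upper bounds on the height and on the linear form as long as \<open>i\<close> and \<open>j\<close> are below half the inverse lengths of
  \<open>P\<close> and \<open>T\<close>. The hypothesis on short vectors makes both ranges nonempty: if one basis vector were too long,
  the other one would be too short. Restricting \<open>i\<close> to the upper part of its range bounds the height from below.\<close>

lemma many_primitive_vectors:
  fixes \<alpha> \<beta> R \<epsilon> :: real
  defines "L \<equiv> \<lambda>u. \<alpha> * height u - \<beta> * real_of_int (fst u)"
  assumes pos: "0 < \<beta>" "4 < R" "0 < \<epsilon>"
    and no_short: "\<And>u :: int \<times> int. 1 \<le> snd u \<Longrightarrow> height u \<le> 4 * \<beta> / \<epsilon> \<Longrightarrow> 4 * \<beta> / R < \<bar>L u\<bar>"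
  obtains A :: "(int \<times> int) set" where "finite A"
    "\<And>u. u \<in> A \<Longrightarrow> primitive u \<and> R / 64 \<le> height u \<and> height u \<le> R \<and> \<bar>L u\<bar> \<le> \<epsilon>"
    "R * \<epsilon> / (200 * \<beta>) \<le> card A"
proof -
  have R: "0 < R" using pos by simp
  obtain P T :: "int \<times> int" where PT: "\<bar>det2 P T\<bar> = 1" "0 < snd P" "0 \<le> snd T"
    "\<bar>L P\<bar> * R \<le> \<epsilon> * height P" "\<epsilon> * height T \<le> R * \<bar>L T\<bar>"
    "height P * \<bar>L T\<bar> \<le> 2 * \<beta>"
    unfolding L_def using reduced_basis[OF pos(1) R pos(3), of \<alpha>] by blast
  define p t where "p = height P" and "t = \<bar>L T\<bar>"
  have p: "1 \<le> p" using PT(2) by (simp add: p_def)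
  have "\<beta> \<le> 2 * (p * t)"
  proof -
    have "p * L T - height T * L P = \<beta> * real_of_int (det2 P T)"
      by (simp add: p_def L_def det2_def algebra_simps)
    then have "\<beta> * \<bar>real_of_int (det2 P T)\<bar> = \<bar>p * L T - height T * L P\<bar>"
      using pos by (simp add: abs_mult)
    moreover have "\<bar>real_of_int (det2 P T)\<bar> = 1" using PT(1) by (metis of_int_abs of_int_1)
    ultimately have "\<beta> = \<bar>p * L T - height T * L P\<bar>" by simp
    also have "\<dots> \<le> \<bar>p * L T\<bar> + \<bar>height T * L P\<bar>" by (rule abs_triangle_ineq4)
    also have "\<dots> = p * t + height T * \<bar>L P\<bar>"
      using PT(3) p by (simp add: abs_mult t_def)
    also have "height T * \<bar>L P\<bar> \<le> p * t"
    proof -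
      have "(\<bar>L P\<bar> * R) * (\<epsilon> * height T) \<le> (\<epsilon> * p) * (R * t)"
      proof (rule mult_mono)
        show "\<bar>L P\<bar> * R \<le> \<epsilon> * p" using PT(4) by (simp add: p_def)
        show "\<epsilon> * height T \<le> R * t" using PT(5) by (simp add: t_def)
      qed (use p pos PT(3) in auto)
      then have "(R * \<epsilon>) * (height T * \<bar>L P\<bar>) \<le> (R * \<epsilon>) * (p * t)" by (simp add: mult_ac)
      then show ?thesis using R pos by (simp add: mult_le_cancel_left_pos)
    qed
    finally show ?thesis by simp
  qed
  then have t: "0 < t" using pos p zero_less_mult_pos[of p t] by linarith
  have pt: "p * t \<le> 2 * \<beta>" using PT(6) by (simp add: p_def t_def)
  have p2: "2 * p \<le> R"
  proof (rule ccontr)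
    assume "\<not> 2 * p \<le> R"
    then have "R / 2 * t < p * t" using t by (intro mult_strict_right_mono) auto
    then have Rt: "R * t < 4 * \<beta>" using pt by simp
    then have t_less: "t < 4 * \<beta> / R" using R by (simp add: pos_less_divide_eq mult.commute)
    show False
    proof (cases "snd T = 0")
      case True
      then have "fst T \<noteq> 0" using PT(1) by (auto simp: det2_def)
      then have "\<beta> * 1 \<le> \<beta> * \<bar>real_of_int (fst T)\<bar>" using pos by (intro mult_left_mono) auto
      then have "\<beta> \<le> t" using True pos by (simp add: t_def L_def abs_mult)
      then have "R * \<beta> \<le> R * t" using R by (intro mult_left_mono) auto
      then have "R * \<beta> < 4 * \<beta>" using Rt by simp
      then show False using pos by simp
    next
      case False
      have "\<epsilon> * height T \<le> 4 * \<beta>" using PT(5) Rt by (simp add: t_def)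
      then have "height T \<le> 4 * \<beta> / \<epsilon>" using pos by (simp add: pos_le_divide_eq mult.commute)
      then have "4 * \<beta> / R < t" using no_short[of T] False PT(3) by (simp add: t_def)
      then show False using t_less by simp
    qed
  qed
  have t2: "2 * t \<le> \<epsilon>"
  proof (rule ccontr)
    assume "\<not> 2 * t \<le> \<epsilon>"
    then have "p * (\<epsilon> / 2) \<le> p * t" using p by (intro mult_left_mono) auto
    then have *: "\<epsilon> * p \<le> 4 * \<beta>" using pt by (simp add: mult.commute)
    then have "p \<le> 4 * \<beta> / \<epsilon>" using pos by (simp add: pos_le_divide_eq mult.commute)
    then have "4 * \<beta> / R < \<bar>L P\<bar>" using no_short[of P] PT(2) by (simp add: p_def)
    then have "4 * \<beta> < \<bar>L P\<bar> * R" using R by (simp add: pos_divide_less_eq)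
    then show False using PT(4) * by (simp add: p_def)
  qed
  define I J where "I = nat \<lfloor>R / (2 * p)\<rfloor>" and "J = nat \<lfloor>\<epsilon> / (2 * t)\<rfloor>"
  have half: "x / 2 \<le> real (nat \<lfloor>x\<rfloor>) \<and> real (nat \<lfloor>x\<rfloor>) \<le> x" if "1 \<le> x" for x :: real
  proof -
    have "1 \<le> \<lfloor>x\<rfloor>" using that by simp
    then have "real (nat \<lfloor>x\<rfloor>) = real_of_int \<lfloor>x\<rfloor>" "1 \<le> real_of_int \<lfloor>x\<rfloor>" by simp_all
    then show ?thesis using floor_correct[of x] by linarith
  qed
  have I: "R / (4 * p) \<le> I" "I \<le> R / (2 * p)"
    using half[of "R / (2 * p)"] p p2 by (auto simp: I_def)
  have J: "\<epsilon> / (4 * t) \<le> J" "J \<le> \<epsilon> / (2 * t)"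
    using half[of "\<epsilon> / (2 * t)"] t t2 by (auto simp: J_def)
  define C where "C = {(i, j). i \<in> {1..I} \<and> j \<in> {1..J} \<and> coprime i j}"
  define C' where "C' = {(i, j) \<in> C. I < 16 * i}"
  have finC: "finite C" unfolding C_def by (rule finite_subset[of _ "{1..I} \<times> {1..J}"]) auto
  have cardC': "3 * (real I * real J) / 16 \<le> real (card C')"
  proof -
    have "C - C' \<subseteq> {1..I div 16} \<times> {1..J}" by (auto simp: C_def C'_def)
    then have "card (C - C') \<le> card ({1..I div 16} \<times> {1..J})" by (rule card_mono[rotated]) auto
    then have "card (C - C') \<le> (I div 16) * J" by (simp add: card_cartesian_product)
    then have "real (card (C - C')) \<le> real (I div 16) * real J" by (simp flip: of_nat_mult)
    also have "\<dots> \<le> (real I / 16) * real J"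
      using of_nat_div_le_of_nat[of I 16, where ?'a = real] by (intro mult_right_mono) auto
    finally have 1: "real (card (C - C')) \<le> real I * real J / 16" by simp
    have "C' \<subseteq> C" by (auto simp: C'_def)
    then have "card C = card C' + card (C - C')"
      using finC by (metis card_Diff_subset card_mono finite_subset le_add_diff_inverse)
    then have "real (card C) = real (card C') + real (card (C - C'))" by simp
    moreover have "real I * real J / 4 \<le> real (card C)" unfolding C_def by (rule card_coprime_pairs)
    ultimately show ?thesis using 1 by linarith
  qed
  define f where "f = (\<lambda>(i :: nat, j :: nat). (int i * fst P + int j * fst T, int i * snd P + int j * snd T))"
  have det_f: "det2 (f (i, j)) T = int i * det2 P T" "det2 P (f (i, j)) = int j * det2 P T" for i j
    by (simp_all add: f_def det2_def algebra_simps)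
  have det_neq: "det2 P T \<noteq> 0" using PT(1) by auto
  have inj: "inj_on f C'"
  proof (rule inj_onI)
    fix x y assume "f x = f y"
    then show "x = y" using det_f[of "fst x" "snd x"] det_f[of "fst y" "snd y"] det_neq
      by (cases x; cases y) simp
  qed
  show thesis
  proof (rule that[of "f ` C'"])
    have "finite C'" using finC by (rule rev_finite_subset) (auto simp: C'_def)
    then show "finite (f ` C')" by simp
    have "R * \<epsilon> / (200 * \<beta>) \<le> 3 * (R * \<epsilon> / (32 * \<beta>)) / 16" using R pos by (simp add: field_simps)
    also have "\<dots> \<le> 3 * (real I * real J) / 16"
    proof -
      have "16 * (p * t) \<le> 32 * \<beta>" using pt by simp
      then have "R * \<epsilon> / (32 * \<beta>) \<le> R * \<epsilon> / (16 * (p * t))"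
        using R pos p t by (intro divide_left_mono mult_pos_pos) auto
      also have "\<dots> = (R / (4 * p)) * (\<epsilon> / (4 * t))" by simp
      also have "\<dots> \<le> real I * real J" using I J R pos p t by (intro mult_mono) auto
      finally show ?thesis by simp
    qed
    also have "\<dots> \<le> card (f ` C')" using cardC' card_image[OF inj] by simp
    finally show "R * \<epsilon> / (200 * \<beta>) \<le> card (f ` C')" .
  next
    fix u assume "u \<in> f ` C'"
    then obtain i j where ij: "u = f (i, j)" "1 \<le> i" "i \<le> I" "1 \<le> j" "j \<le> J" "coprime i j" "I < 16 * i"
      by (auto simp: C_def C'_def)
    have "primitive u"
      unfolding primitive_def
    proof (rule coprimeI)
      fix c assume c: "c dvd fst u" "c dvd snd u"
      then have "c dvd det2 u T" "c dvd det2 P u" by (auto simp: det2_def)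
      then have "c dvd int i * det2 P T" "c dvd int j * det2 P T" using det_f ij(1) by auto
      moreover have "is_unit (det2 P T)" using PT(1) by simp
      ultimately have "c dvd int i" "c dvd int j" by (simp_all add: dvd_mult_unit_iff)
      then show "is_unit c" using ij(6) by (meson coprime_common_divisor coprime_int_iff)
    qed
    moreover have i: "real i * p \<le> R / 2"
    proof -
      have "real i * p \<le> R / (2 * p) * p" using I(2) ij(3) p by (intro mult_right_mono) auto
      then show ?thesis using p by simp
    qed
    have j: "real j * t \<le> \<epsilon> / 2"
    proof -
      have "real j * t \<le> \<epsilon> / (2 * t) * t" using J(2) ij(5) t by (intro mult_right_mono) auto
      then show ?thesis using t by simp
    qed
    have jT: "real j * height T \<le> R / 2"
    proof -
      have "\<epsilon> * (real j * height T) = real j * (\<epsilon> * height T)" by simp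
      also have "\<dots> \<le> real j * (R * t)" using PT(5) by (intro mult_left_mono) (auto simp: t_def)
      also have "\<dots> = R * (real j * t)" by simp
      also have "\<dots> \<le> R * (\<epsilon> / 2)" using j R by (intro mult_left_mono) auto
      also have "\<dots> = \<epsilon> * (R / 2)" by simp
      finally show ?thesis using pos by (simp add: mult_le_cancel_left_pos)
    qed
    have iP: "real i * \<bar>L P\<bar> \<le> \<epsilon> / 2"
    proof -
      have "R * (real i * \<bar>L P\<bar>) = real i * (\<bar>L P\<bar> * R)" by simp
      also have "\<dots> \<le> real i * (\<epsilon> * p)" using PT(4) by (intro mult_left_mono) (auto simp: p_def)
      also have "\<dots> = \<epsilon> * (real i * p)" by simp
      also have "\<dots> \<le> \<epsilon> * (R / 2)" using i pos by (intro mult_left_mono) auto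
      also have "\<dots> = R * (\<epsilon> / 2)" by simp
      finally show ?thesis using R by (simp add: mult_le_cancel_left_pos)
    qed
    have snd_u: "height u = real i * p + real j * height T"
      by (simp add: ij(1) f_def p_def)
    have "R / 64 \<le> height u"
    proof -
      have "R / 64 = R / (4 * p) / 16 * p" using p by simp
      also have "\<dots> \<le> real I / 16 * p" using I(1) p by (intro mult_right_mono divide_right_mono) auto
      also have "\<dots> \<le> real i * p" using ij(7) p by (intro mult_right_mono) auto
      finally have "R / 64 \<le> real i * p" .
      moreover have "0 \<le> real j * height T" using PT(3) by simp
      ultimately show ?thesis unfolding snd_u by linarith
    qed
    moreover have "height u \<le> R" using snd_u i jT by simp
    moreover have "\<bar>L u\<bar> \<le> \<epsilon>"
    proof -
      have "L u = real i * L P + real j * L T" by (simp add: ij(1) f_def L_def algebra_simps)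
      then have "\<bar>L u\<bar> \<le> real i * \<bar>L P\<bar> + real j * t"
        using abs_triangle_ineq[of "real i * L P" "real j * L T"] by (simp add: abs_mult t_def)
      then show ?thesis using iP j by simp
    qed
    ultimately show "primitive u \<and> R / 64 \<le> height u \<and> height u \<le> R \<and> \<bar>L u\<bar> \<le> \<epsilon>" by simp
  qed
qed

text \<open>The cross product of the slit \<open>(\<mu> + fst w, snd w)\<close> with a lattice vector.\<close>

definition slit_cross :: "real \<Rightarrow> int \<times> int \<Rightarrow> int \<times> int \<Rightarrow> real" where
  "slit_cross \<mu> w u = (\<mu> + real_of_int (fst w)) * height u - height w * real_of_int (fst u)"

lemma slit_cross_add: "slit_cross \<mu> (w + u) v = slit_cross \<mu> w v + real_of_int (det2 u v)"
  by (simp add: slit_cross_def det2_def algebra_simps)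

lemma slit_cross_diff: "slit_cross \<mu> w (u - v) = slit_cross \<mu> w u - slit_cross \<mu> w v"
  by (simp add: slit_cross_def algebra_simps)

text \<open>The heights of two vectors in the strip differ by at least \<open>D\<close>, because the difference of the vectors is too
  nearly parallel to \<open>w\<close> to be shorter.\<close>

lemma strip_card_le:
  fixes \<mu> \<kappa> k D Y :: real and w :: "int \<times> int"
  assumes b: "1 \<le> snd w" and \<kappa>: "\<kappa> < 1/4" and D: "0 < D" and Y: "1 \<le> Y"
    and gap: "\<And>v. 1 \<le> snd v \<Longrightarrow> height v \<le> D \<Longrightarrow> 2 * \<kappa> < \<bar>slit_cross \<mu> w v\<bar>"
  defines "V \<equiv> {v :: int \<times> int. 1 \<le> snd v \<and> height v \<le> Y \<and> \<bar>slit_cross \<mu> w v - k\<bar> \<le> \<kappa>}"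
  shows "finite V" "real (card V) \<le> 1 + Y / D"
proof -
  have lt: "D \<le> real_of_int (snd v' - snd v)" if "v \<in> V" "v' \<in> V" "v \<noteq> v'" "snd v \<le> snd v'" for v v'
  proof (rule ccontr)
    assume "\<not> ?thesis"
    let ?z = "v' - v"
    have "\<bar>slit_cross \<mu> w v - k\<bar> \<le> \<kappa>" "\<bar>slit_cross \<mu> w v' - k\<bar> \<le> \<kappa>" using that by (auto simp: V_def)
    then have z: "\<bar>slit_cross \<mu> w ?z\<bar> \<le> 2 * \<kappa>" unfolding slit_cross_diff by linarith
    show False
    proof (cases "snd v = snd v'")
      case True
      then have "fst ?z \<noteq> 0" using that(3) by (auto simp: prod_eq_iff)
      then have "1 * 1 \<le> height w * \<bar>real_of_int (fst ?z)\<bar>" using b by (intro mult_mono) auto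
      moreover have "\<bar>slit_cross \<mu> w ?z\<bar> = height w * \<bar>real_of_int (fst ?z)\<bar>"
        using True b by (simp add: slit_cross_def abs_mult flip: right_diff_distrib)
      ultimately show False using z \<kappa> by linarith
    next
      case False
      then show False using gap[of ?z] z that(4) \<open>\<not> D \<le> real_of_int (snd v' - snd v)\<close> by simp
    qed
  qed
  have sep: "D \<le> \<bar>height v - height v'\<bar>" if "v \<in> V" "v' \<in> V" "v \<noteq> v'" for v v'
    using lt[of v v'] lt[of v' v] that by (cases "snd v \<le> snd v'") auto
  have range: "0 \<le> height v \<and> height v \<le> Y" if "v \<in> V" for v
    using that by (auto simp: V_def)
  show "finite V" using separated_card_le(1)[OF D _ sep range] Y by simp
  show "real (card V) \<le> 1 + Y / D" using separated_card_le(2)[OF D _ sep range] Y by simp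
qed

text \<open>If the cross product of \<open>w + u\<close> with \<open>v\<close> is tiny, then that of \<open>w\<close> with \<open>v\<close> is close to an integer \<open>k\<close>. In
  the case \<open>k = 0\<close> the vectors \<open>v\<close> and \<open>u\<close> are parallel, so \<open>u\<close> itself lies in a thin strip along \<open>w\<close>. Otherwise
  \<open>v\<close> is higher than every \<open>u\<close> in \<open>A\<close> and determines \<open>u\<close>, whose cross product with \<open>v\<close> is known. In both cases
  the vectors lie in strips of width \<open>\<kappa>\<close>, where \<open>gap\<close> makes them sparse.\<close>

lemma few_bad_children:
  fixes \<mu> \<kappa> \<epsilon> D R X :: real and w :: "int \<times> int" and A :: "(int \<times> int) set"
  assumes b: "1 \<le> snd w" and \<kappa>: "0 \<le> \<kappa>" "\<kappa> < 1/4" and \<epsilon>: "0 < \<epsilon>" "\<epsilon> < 1/128"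
    and D: "0 < D" and R: "1 \<le> R" and X: "1 \<le> X"
    and gap: "\<And>v. 1 \<le> snd v \<Longrightarrow> height v \<le> D \<Longrightarrow> 2 * \<kappa> < \<bar>slit_cross \<mu> w v\<bar>"
    and finA: "finite A"
    and A: "\<And>u. u \<in> A \<Longrightarrow> primitive u \<and> R / 64 \<le> height u \<and> height u \<le> R \<and> \<bar>slit_cross \<mu> w u\<bar> \<le> \<epsilon>"
  defines "Bad \<equiv> {u \<in> A. \<exists>v :: int \<times> int. 1 \<le> snd v \<and> height v \<le> X \<and> \<bar>slit_cross \<mu> (w + u) v\<bar> \<le> \<kappa>}"
  shows "real (card Bad) \<le> (1 + R / D) + (2 + 128 * X / R) * (1 + X / D)"
proof -
  define V where "V k = {v :: int \<times> int. 1 \<le> snd v \<and> height v \<le> X \<and> \<bar>slit_cross \<mu> w v - real_of_int k\<bar> \<le> \<kappa>}" for k :: int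
  define Bad1 where "Bad1 = {u \<in> Bad. \<bar>slit_cross \<mu> w u\<bar> \<le> \<kappa>}"
  define Ks where "Ks = {k :: int. \<bar>real_of_int k\<bar> \<le> 1/2 + 64 * X / R}"
  have A_pos: "1 \<le> snd u" if "u \<in> A" for u
  proof -
    have "0 < R / 64" using R by simp
    then have "0 < height u" using A[OF that] by linarith
    then show ?thesis by simp
  qed
  have finBad: "finite Bad" using finA by (simp add: Bad_def)
  let ?V0 = "{v :: int \<times> int. 1 \<le> snd v \<and> height v \<le> R \<and> \<bar>slit_cross \<mu> w v - 0\<bar> \<le> \<kappa>}"
  have "Bad1 \<subseteq> ?V0" using A A_pos by (auto simp: Bad1_def Bad_def)
  moreover have "finite ?V0" by (rule strip_card_le(1)[OF b \<kappa>(2) D R gap])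
  ultimately have "card Bad1 \<le> card ?V0" by (rule card_mono[rotated])
  moreover have "real (card ?V0) \<le> 1 + R / D" by (rule strip_card_le(2)[OF b \<kappa>(2) D R gap])
  ultimately have card1: "real (card Bad1) \<le> 1 + R / D" by linarith

  have "\<exists>v k. primitive v \<and> v \<in> V k \<and> k \<in> Ks \<and> det2 u v = - k \<and> R < height v" if u: "u \<in> Bad - Bad1" for u
  proof -
    have uA: "u \<in> A" and not1: "\<kappa> < \<bar>slit_cross \<mu> w u\<bar>" using u by (auto simp: Bad_def Bad1_def)
    obtain v0 :: "int \<times> int" where v0: "1 \<le> snd v0" "height v0 \<le> X" "\<bar>slit_cross \<mu> (w + u) v0\<bar> \<le> \<kappa>"
      using u by (auto simp: Bad_def)
    then have "v0 \<noteq> (0, 0)" by auto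
    then obtain d v where dv: "primitive v" "0 < d" "v0 = (d * fst v, d * snd v)" using eq_multiple_primitive by blast
    have v1: "1 \<le> snd v" using v0(1) dv by (simp add: zero_less_mult_iff int_one_le_iff_zero_less)
    have d1: "1 \<le> real_of_int d" using dv(2) by simp
    have "height v \<le> real_of_int d * height v" using d1 v1 by (simp add: mult_le_cancel_right1)
    then have vX: "height v \<le> X" using v0(2) dv(3) by simp
    have "slit_cross \<mu> (w + u) v0 = real_of_int d * slit_cross \<mu> (w + u) v"
      by (simp add: dv(3) slit_cross_def algebra_simps)
    moreover have "1 * \<bar>slit_cross \<mu> (w + u) v\<bar> \<le> real_of_int d * \<bar>slit_cross \<mu> (w + u) v\<bar>"
      using d1 by (intro mult_right_mono) auto
    ultimately have v\<kappa>: "\<bar>slit_cross \<mu> (w + u) v\<bar> \<le> \<kappa>" using v0(3) d1 by (simp add: abs_mult)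
    define k where "k = - det2 u v"
    have vk: "\<bar>slit_cross \<mu> w v - real_of_int k\<bar> \<le> \<kappa>" using v\<kappa> by (simp add: slit_cross_add k_def)
    have k0: "k \<noteq> 0"
    proof
      assume "k = 0"
      then have 0: "det2 u v = 0" by (simp add: k_def)
      have "cross2 (ivec u) (ivec v) = 0" using 0 by (simp add: real_det2[symmetric])
      then have "v = u \<or> v = - u" using parallel_primitives dv(1) A[OF uA] by blast
      moreover have "v \<noteq> - u" using v1 A_pos[OF uA] by auto
      ultimately have "v = u" by simp
      then show False using v\<kappa> not1 by (simp add: slit_cross_add det2_def)
    qed
    have b': "0 < height w + height u" using b A_pos[OF uA] by linarith
    have "(height w + height u) * slit_cross \<mu> w v =
        height w * slit_cross \<mu> (w + u) v + height v * slit_cross \<mu> w u"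
      by (simp add: slit_cross_def algebra_simps)
    then have "(height w + height u) * \<bar>slit_cross \<mu> w v\<bar> =
        \<bar>height w * slit_cross \<mu> (w + u) v + height v * slit_cross \<mu> w u\<bar>"
      using b' by (metis abs_mult abs_of_pos)
    also have "\<dots> \<le> height w * \<kappa> + height v * \<epsilon>"
    proof (rule order_trans[OF abs_triangle_ineq add_mono])
      show "\<bar>height w * slit_cross \<mu> (w + u) v\<bar> \<le> height w * \<kappa>"
        using b v\<kappa> by (simp add: abs_mult mult_left_mono)
      show "\<bar>height v * slit_cross \<mu> w u\<bar> \<le> height v * \<epsilon>"
        using v1 A[OF uA] by (simp add: abs_mult mult_left_mono)
    qed
    finally have key: "(height w + height u) * \<bar>slit_cross \<mu> w v\<bar>
        \<le> height w * \<kappa> + height v * \<epsilon>" .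
    have cross_le: "\<bar>slit_cross \<mu> w v\<bar> \<le> \<kappa> + 64 * \<epsilon> * height v / R"
    proof -
      have "\<bar>slit_cross \<mu> w v\<bar> \<le> (height w * \<kappa> + height v * \<epsilon>) / (height w + height u)"
        using key b' by (simp add: pos_le_divide_eq mult.commute)
      also have "\<dots> = height w * \<kappa> / (height w + height u)
          + height v * \<epsilon> / (height w + height u)" by (rule add_divide_distrib)
      also have "height w * \<kappa> / (height w + height u) \<le> \<kappa>"
        using b' A_pos[OF uA] \<kappa> by (simp add: pos_divide_le_eq algebra_simps)
      also have "height v * \<epsilon> / (height w + height u) \<le> height v * \<epsilon> / (R / 64)"
      proof (rule divide_left_mono)
        show "R / 64 \<le> height w + height u" using A[OF uA] b by linarith
        show "0 \<le> height v * \<epsilon>" using v1 \<epsilon> by simp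
        show "0 < (height w + height u) * (R / 64)" using b' R by (intro mult_pos_pos) auto
      qed
      finally show ?thesis by (simp add: mult_ac)
    qed
    have "1 \<le> \<bar>real_of_int k\<bar>" using k0 by linarith
    then have "1/2 \<le> 64 * \<epsilon> * height v / R" using cross_le vk \<kappa> by linarith
    then have "R \<le> 128 * \<epsilon> * height v" using R by (simp add: pos_le_divide_eq)
    also have "128 * \<epsilon> * height v < 1 * height v"
      using \<epsilon> v1 by (intro mult_strict_right_mono) auto
    finally have Rv: "R < height v" by simp
    have "64 * \<epsilon> * height v / R \<le> 64 * 1 * X / R"
      using \<epsilon> vX v1 R by (intro divide_right_mono mult_mono) auto
    then have "\<bar>real_of_int k\<bar> \<le> 1/2 + 64 * X / R" using cross_le vk \<kappa> by linarith
    then have "k \<in> Ks" by (simp add: Ks_def)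
    moreover have "v \<in> V k" using v1 vX vk by (simp add: V_def)
    moreover have "det2 u v = - k" by (simp add: k_def)
    ultimately show ?thesis using dv(1) Rv by blast
  qed
  then obtain v k where vk: "\<And>u. u \<in> Bad - Bad1 \<Longrightarrow>
      primitive (v u) \<and> v u \<in> V (k u) \<and> k u \<in> Ks \<and> det2 u (v u) = - k u \<and> R < height (v u)" by metis
  have inj: "inj_on v (Bad - Bad1)"
  proof (rule inj_onI)
    fix u u' assume u: "u \<in> Bad - Bad1" "u' \<in> Bad - Bad1" and eq: "v u = v u'"
    note a = vk[OF u(1)] and a' = vk[OF u(2)]
    have "\<bar>slit_cross \<mu> w (v u) - real_of_int (k u)\<bar> \<le> \<kappa>" "\<bar>slit_cross \<mu> w (v u) - real_of_int (k u')\<bar> \<le> \<kappa>"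
      using a a' eq by (auto simp: V_def)
    then have "\<bar>real_of_int (k u) - real_of_int (k u')\<bar> < 1" using \<kappa>(2) by linarith
    then have "k u = k u'" by linarith
    then have "det2 (v u) (u - u') = 0" using a a' eq by (simp add: det2_def algebra_simps)
    then obtain c where c: "u - u' = (c * fst (v u), c * snd (v u))" using det2_eq_0 a by blast
    have "snd u - snd u' = c * snd (v u)" using c by (metis snd_conv snd_diff)
    moreover have "\<bar>real_of_int (snd u - snd u')\<bar> < R"
      using u A[of u] A[of u'] A_pos[of u] A_pos[of u'] by (auto simp: Bad_def)
    ultimately have "\<bar>real_of_int c\<bar> * \<bar>height (v u)\<bar> < height (v u)"
      using a by (simp add: abs_mult)
    then have "\<bar>real_of_int c\<bar> < 1" using R a by (simp add: mult_less_cancel_right1 split: if_splits)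
    then have "c = 0" by linarith
    then have "u - u' = 0" using c by (simp add: zero_prod_def)
    then show "u = u'" by simp
  qed
  have Ks: "finite Ks" "real (card Ks) \<le> 2 + 128 * X / R"
  proof -
    have XR: "0 \<le> X / R" using X R by simp
    have sep: "1 \<le> \<bar>real_of_int j - real_of_int k\<bar>" if "j \<noteq> k" for j k using that by linarith
    have range: "- (1/2 + 64 * X / R) \<le> real_of_int k \<and> real_of_int k \<le> 1/2 + 64 * X / R" if "k \<in> Ks" for k
      using that by (auto simp: Ks_def abs_le_iff)
    have le: "- (1/2 + 64 * X / R) \<le> 1/2 + 64 * X / R" using XR by simp
    show "finite Ks" using separated_card_le(1)[of 1, OF _ le sep range] by simp
    show "real (card Ks) \<le> 2 + 128 * X / R" using separated_card_le(2)[of 1, OF _ le sep range] by simp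
  qed
  have finV: "finite (V k)" and cardV: "real (card (V k)) \<le> 1 + X / D" for k
    unfolding V_def by (rule strip_card_le[OF b \<kappa>(2) D X gap]; assumption)+
  have "v ` (Bad - Bad1) \<subseteq> (\<Union>k\<in>Ks. V k)" using vk by blast
  then have "card (Bad - Bad1) \<le> card (\<Union>k\<in>Ks. V k)"
    using card_image[OF inj] card_mono[of "\<Union>k\<in>Ks. V k" "v ` (Bad - Bad1)"] Ks(1) finV by simp
  also have "\<dots> \<le> (\<Sum>k\<in>Ks. card (V k))" by (rule card_UN_le[OF Ks(1)])
  finally have "real (card (Bad - Bad1)) \<le> (\<Sum>k\<in>Ks. real (card (V k)))" by (simp flip: of_nat_sum)
  also have "\<dots> \<le> real (card Ks) * (1 + X / D)" by (rule sum_bounded_above) (rule cardV)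
  also have "\<dots> \<le> (2 + 128 * X / R) * (1 + X / D)"
    using Ks(2) X D by (intro mult_right_mono) auto
  finally have card2: "real (card (Bad - Bad1)) \<le> (2 + 128 * X / R) * (1 + X / D)" .
  have "Bad1 \<subseteq> Bad" by (auto simp: Bad1_def)
  then have "card Bad = card Bad1 + card (Bad - Bad1)"
    using finBad by (metis card_Diff_subset card_mono finite_subset le_add_diff_inverse)
  then show ?thesis using card1 card2 by simp
qed

section \<open>Good slits and their children\<close>

lemma eventually_powr_less:
  fixes e f K :: real
  assumes "e < f"
  shows "\<forall>\<^sub>F H in at_top. K * H powr e < H powr f"
proof -
  have "\<forall>\<^sub>F H in at_top. (\<bar>K\<bar> + 1) powr (1 / (f - e)) \<le> H" by (rule eventually_ge_at_top)
  moreover have "\<forall>\<^sub>F H :: real in at_top. 1 \<le> H" by (rule eventually_ge_at_top)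
  ultimately show ?thesis
  proof eventually_elim
    case (elim H)
    have "((\<bar>K\<bar> + 1) powr (1 / (f - e))) powr (f - e) \<le> H powr (f - e)"
      using elim assms by (intro powr_mono2) auto
    then have "\<bar>K\<bar> + 1 \<le> H powr (f - e)" using assms by (simp add: powr_powr)
    then have "K * H powr e < H powr (f - e) * H powr e"
      using elim by (intro mult_strict_right_mono) auto
    then show ?case by (simp flip: powr_add)
  qed
qed

text \<open>The heights of the slits grow with the exponent \<open>\<tau>\<close>, and \<open>\<eta>\<close> is the exponent lost in the cross products of
  consecutive slits. The last two assumptions make a ladder of \<open>S\<close> steps reach an exponent at which the
  Diophantine condition takes over, while the tolerances on it stay small.\<close>

locale diophantine_exponents =
  fixes \<mu> c0 E \<tau> \<eta> :: real and S :: nat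
  assumes dioph: "\<And>p q :: int. 1 \<le> q \<Longrightarrow> c0 * real_of_int q powr (- E) \<le> \<bar>\<mu> * real_of_int q - real_of_int p\<bar>"
    and c0: "0 < c0" and E: "1 \<le> E" and \<tau>: "1 < \<tau>" "\<tau> < 2" and \<eta>: "0 < \<eta>"
    and level_S: "2 * E < (\<tau> - 1) / 2 * ((1 + \<tau>) / 2) ^ S"
    and \<eta>_small: "2 * \<eta> * 6 ^ S \<le> (\<tau> - 1) / (8 * E)"
begin

text \<open>At level \<open>i\<close> of the ladder \<open>t i\<close> is the exponent for the cross product and \<open>\<phi> i\<close> the one for the excess height. From
  one level to the next \<open>t\<close> grows by less than the factor \<open>\<tau>\<close> that is gained when passing to a child, and
  \<open>\<phi>\<close> by more than the factor \<open>2 * \<tau>\<close> that is lost.\<close>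

definition t :: "nat \<Rightarrow> real" where "t i = (\<tau> - 1) / 2 * ((1 + \<tau>) / 2) ^ i"

definition \<phi> :: "nat \<Rightarrow> real" where "\<phi> i = 2 * \<eta> * 6 ^ i"

text \<open>A slit is good at the scale \<open>H\<close> if no lattice vector that is not much longer than \<open>H\<close> is too close
  to being parallel to it. The levels \<open>i\<close> form a ladder: goodness of a slit at level \<open>Suc i\<close> controls how
  many of its children fail to be good at level \<open>i\<close>, and the exponent \<open>t S\<close> of the top level is so large
  that every slit is good at that level because \<open>\<mu>\<close> is Diophantine.\<close>

definition good :: "real \<Rightarrow> int \<times> int \<Rightarrow> bool" where
  "good H w \<longleftrightarrow> (\<forall>i\<le>S. \<forall>v. 1 \<le> snd v \<longrightarrow> height v \<le> H powr (1 + \<phi> i) \<longrightarrow>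
     H powr (- t i) < \<bar>slit_cross \<mu> w v\<bar>)"

lemma goodD:
  "good H w \<Longrightarrow> i \<le> S \<Longrightarrow> 1 \<le> snd v \<Longrightarrow> height v \<le> H powr (1 + \<phi> i) \<Longrightarrow>
    H powr (- t i) < \<bar>slit_cross \<mu> w v\<bar>"
  unfolding good_def by blast

lemma t_ge: "t 0 \<le> t i"
proof -
  have "1 \<le> ((1 + \<tau>) / 2) ^ i" using \<tau> by (intro one_le_power) auto
  then have "(\<tau> - 1) / 2 * 1 \<le> (\<tau> - 1) / 2 * ((1 + \<tau>) / 2) ^ i" using \<tau> by (intro mult_left_mono) auto
  then show ?thesis by (simp add: t_def)
qed

lemma t_pos: "0 < t i"
  using t_ge[of i] \<tau> by (simp add: t_def)

lemma t_Suc_less: "t (Suc i) < \<tau> * t i"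
proof -
  have "(1 + \<tau>) / 2 * t i < \<tau> * t i" using \<tau> t_pos[of i] by (intro mult_strict_right_mono) auto
  then show ?thesis by (simp add: t_def)
qed

lemma \<phi>_pos: "0 < \<phi> i"
  using \<eta> by (simp add: \<phi>_def)

lemma \<phi>_ge: "2 * \<eta> \<le> \<phi> i"
  using \<eta> by (simp add: \<phi>_def)

lemma \<phi>_Suc: "\<phi> (Suc i) = 6 * \<phi> i"
  by (simp add: \<phi>_def)

lemma \<phi>_le: "i \<le> S \<Longrightarrow> \<phi> i \<le> (\<tau> - 1) / (8 * E)"
proof -
  assume "i \<le> S"
  then have "\<phi> i \<le> 2 * \<eta> * 6 ^ S" using \<eta> by (simp add: \<phi>_def power_increasing)
  then show ?thesis using \<eta>_small by linarith
qed

lemma t_0: "2 * t 0 = \<tau> - 1"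
  by (simp add: t_def)

lemma \<phi>_E_le: "i \<le> S \<Longrightarrow> 8 * (E * \<phi> i) \<le> \<tau> - 1"
  using \<phi>_le[of i] E by (simp add: field_simps)

lemma \<phi>_le': "i \<le> S \<Longrightarrow> 8 * \<phi> i \<le> \<tau> - 1"
proof -
  assume i: "i \<le> S"
  have "1 * \<phi> i \<le> E * \<phi> i" using E \<phi>_pos[of i] by (intro mult_right_mono) auto
  then show ?thesis using \<phi>_E_le[OF i] by simp
qed

lemma \<eta>_le: "16 * \<eta> \<le> \<tau> - 1"
  using \<phi>_ge[of 0] \<phi>_le'[of 0] by simp

lemma slit_cross_ge:
  assumes "1 \<le> snd v"
  shows "c0 * height v powr (- E) \<le> \<bar>slit_cross \<mu> w v\<bar>"
  using dioph[OF assms, of "snd w * fst v - fst w * snd v"] by (simp add: slit_cross_def algebra_simps)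

lemma eventually_top_level:
  "\<forall>\<^sub>F H in at_top. \<forall>w v. 1 \<le> snd v \<longrightarrow> height v \<le> H powr (1 + \<phi> S) \<longrightarrow>
     H powr (- t S) < \<bar>slit_cross \<mu> w v\<bar>"
proof -
  have "\<phi> S \<le> 1" using \<phi>_le'[of S] \<tau> by simp
  then have "E * (1 + \<phi> S) \<le> E * 2" using E by (intro mult_left_mono) auto
  then have "- t S < - (E * (1 + \<phi> S))" using level_S by (simp add: t_def)
  then have "\<forall>\<^sub>F H in at_top. 1 / c0 * H powr (- t S) < H powr (- (E * (1 + \<phi> S)))"
    by (rule eventually_powr_less)
  moreover have "\<forall>\<^sub>F H :: real in at_top. 1 \<le> H" by (rule eventually_ge_at_top)
  ultimately show ?thesis
  proof eventually_elim
    case (elim H)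
    show ?case
    proof (intro allI impI)
      fix w v :: "int \<times> int" assume v: "1 \<le> snd v" "height v \<le> H powr (1 + \<phi> S)"
      have "H powr (- t S) < c0 * H powr (- (E * (1 + \<phi> S)))" using elim(1) c0 by (simp add: field_simps)
      also have "H powr (- (E * (1 + \<phi> S))) = (H powr (1 + \<phi> S)) powr (- E)" by (simp add: powr_powr mult.commute)
      also have "c0 * (H powr (1 + \<phi> S)) powr (- E) \<le> c0 * height v powr (- E)"
        using v c0 E by (intro mult_left_mono powr_mono2') auto
      also have "\<dots> \<le> \<bar>slit_cross \<mu> w v\<bar>" by (rule slit_cross_ge[OF v(1)])
      finally show "H powr (- t S) < \<bar>slit_cross \<mu> w v\<bar>" .
    qed
  qed
qed

text \<open>The left hand side is the bound in \<open>few_bad_children\<close> for the strips of level \<open>i\<close> at the scale \<open>H powr \<tau>\<close> and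
  the gap of level \<open>Suc i\<close> at the scale \<open>H\<close>. Its largest terms have the exponents \<open>\<tau> * \<phi> i\<close> and
  \<open>\<tau> - 1 + 2 * \<tau> * \<phi> i - \<phi> (Suc i)\<close>, and the factor 6 between \<open>\<phi> i\<close> and \<open>\<phi> (Suc i)\<close> outweighs \<open>2 * \<tau>\<close>.\<close>

lemma eventually_bad_bound:
  assumes i: "i < S"
  shows "\<forall>\<^sub>F H in at_top.
    (1 + (H powr \<tau> / 2) / H powr (1 + \<phi> (Suc i))) +
    (2 + 128 * (H powr \<tau>) powr (1 + \<phi> i) / (H powr \<tau> / 2)) * (1 + (H powr \<tau>) powr (1 + \<phi> i) / H powr (1 + \<phi> (Suc i)))
    \<le> H powr (\<tau> - 1 - 2 * \<eta>)"
proof -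
  define x y where "x = \<tau> * \<phi> i" and "y = \<tau> - 1 + \<tau> * \<phi> i - \<phi> (Suc i)"
  let ?f = "\<tau> - 1 - 2 * \<eta>"
  have "x \<le> 2 * \<phi> i" using \<tau> \<phi>_pos[of i] unfolding x_def by (intro mult_right_mono) auto
  moreover have "0 \<le> x" using \<tau> \<phi>_pos[of i] by (simp add: x_def)
  ultimately have e: "0 < ?f" "\<tau> - 1 - \<phi> (Suc i) < ?f" "x < ?f" "y < ?f" "x + y < ?f"
    using \<phi>_Suc[of i] \<phi>_ge[of i] \<phi>_le'[OF less_imp_le[OF i]] \<eta>_le \<eta> \<tau> unfolding y_def x_def[symmetric] by - linarith+
  have "\<forall>\<^sub>F H in at_top. 18 * H powr 0 < H powr ?f" by (intro eventually_powr_less e)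
  moreover have "\<forall>\<^sub>F H in at_top. 6 * H powr (\<tau> - 1 - \<phi> (Suc i)) < H powr ?f" by (intro eventually_powr_less e)
  moreover have "\<forall>\<^sub>F H in at_top. 1536 * H powr x < H powr ?f" by (intro eventually_powr_less e)
  moreover have "\<forall>\<^sub>F H in at_top. 12 * H powr y < H powr ?f" by (intro eventually_powr_less e)
  moreover have "\<forall>\<^sub>F H in at_top. 1536 * H powr (x + y) < H powr ?f" by (intro eventually_powr_less e)
  moreover have "\<forall>\<^sub>F H :: real in at_top. 1 \<le> H" by (rule eventually_ge_at_top)
  ultimately show ?thesis
  proof eventually_elim
    case (elim H)
    have 1: "(H powr \<tau> / 2) / H powr (1 + \<phi> (Suc i)) = H powr (\<tau> - 1 - \<phi> (Suc i)) / 2"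
      using elim by (simp add: powr_diff powr_add)
    have X: "(H powr \<tau>) powr (1 + \<phi> i) = H powr \<tau> * H powr x"
      by (simp add: powr_powr x_def distrib_left powr_add)
    have 2: "128 * (H powr \<tau>) powr (1 + \<phi> i) / (H powr \<tau> / 2) = 256 * H powr x"
      unfolding X using elim by simp
    have 3: "(H powr \<tau>) powr (1 + \<phi> i) / H powr (1 + \<phi> (Suc i)) = H powr y"
      unfolding X using elim by (simp add: y_def x_def powr_diff powr_add)
    have "(1 + H powr (\<tau> - 1 - \<phi> (Suc i)) / 2) + (2 + 256 * H powr x) * (1 + H powr y)
      = 3 + H powr (\<tau> - 1 - \<phi> (Suc i)) / 2 + 256 * H powr x + 2 * H powr y + 256 * H powr (x + y)"
      by (simp add: algebra_simps powr_add)
    also have "\<dots> \<le> H powr ?f" using elim by simp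
    finally show ?case unfolding 1 2 3 .
  qed
qed

definition good_child_set :: "real \<Rightarrow> int \<times> int \<Rightarrow> (int \<times> int) set \<Rightarrow> bool" where
  "good_child_set H w C \<longleftrightarrow> finite C \<and> H powr (\<tau> - 1 - 2 * \<eta>) \<le> real (card C) \<and>
     (\<forall>u\<in>C. H powr \<tau> / 128 \<le> height (w + u) \<and> height (w + u) \<le> H powr \<tau> \<and>
        good (H powr \<tau>) (w + u) \<and> \<bar>slit_cross \<mu> w u\<bar> \<le> H powr (- \<eta>)) \<and>
     (\<forall>u\<in>C. \<forall>u'\<in>C. u \<noteq> u' \<longrightarrow> 1/2 \<le> \<bar>slit_cross \<mu> (w + u) (u' - u)\<bar>)"

text \<open>Goodness of \<open>w\<close> at level 0 provides about \<open>H powr (\<tau> - 1 - \<eta>)\<close> primitive vectors. At each level below the top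
  only a smaller power of \<open>H\<close> of them leads to bad slits, and at the top level no slit is bad.\<close>

lemma good_children:
  "\<forall>\<^sub>F H in at_top. \<forall>w. H / 128 \<le> height w \<longrightarrow> height w \<le> H \<longrightarrow> good H w \<longrightarrow>
    (\<exists>C. good_child_set H w C)"
proof -
  have \<tau>0: "0 < \<tau>" using \<tau> by simp
  have "\<forall>\<^sub>F H in at_top. \<forall>i\<in>{..<S}. (1 + (H powr \<tau> / 2) / H powr (1 + \<phi> (Suc i))) +
    (2 + 128 * (H powr \<tau>) powr (1 + \<phi> i) / (H powr \<tau> / 2)) * (1 + (H powr \<tau>) powr (1 + \<phi> i) / H powr (1 + \<phi> (Suc i)))
    \<le> H powr (\<tau> - 1 - 2 * \<eta>)"
    by (intro eventually_ball_finite ballI eventually_bad_bound) auto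
  moreover have "\<forall>\<^sub>F H in at_top. 129 * H powr (- \<eta>) < H powr 0" by (intro eventually_powr_less) (use \<eta> in simp)
  moreover have "\<forall>\<^sub>F H in at_top. 9 * H powr 0 < H powr \<tau>" by (intro eventually_powr_less \<tau>0)
  moreover have "\<forall>\<^sub>F H in at_top. 4 * H powr (1 + \<eta>) < H powr (1 + 2 * \<eta>)"
    by (intro eventually_powr_less) (use \<eta> in simp)
  moreover have "\<forall>\<^sub>F H in at_top. 8 * H powr (1 - \<tau>) < H powr (- t 0)"
    by (intro eventually_powr_less) (use \<tau> t_0 in linarith)
  moreover have "\<forall>\<^sub>F H in at_top. 2 * H powr 1 < H powr \<tau>" by (intro eventually_powr_less \<tau>)
  moreover have "\<forall>\<^sub>F H in at_top. \<forall>i\<in>{..<S}. 5 * H powr (- (\<tau> * t i)) < H powr 0"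
    by (intro eventually_ball_finite ballI eventually_powr_less) (use t_pos \<tau> in auto)
  moreover have "\<forall>\<^sub>F H in at_top. \<forall>i\<in>{..<S}. 2 * H powr (- (\<tau> * t i)) < H powr (- t (Suc i))"
    by (intro eventually_ball_finite ballI eventually_powr_less) (use t_Suc_less in auto)
  moreover have "\<forall>\<^sub>F H in at_top. 400 * (real S + 1) * H powr (\<tau> - 1 - 2 * \<eta>) < H powr (\<tau> - 1 - \<eta>)"
    by (intro eventually_powr_less) (use \<eta> in simp)
  moreover have "filterlim (\<lambda>H :: real. H powr \<tau>) at_top at_top"
    unfolding filterlim_at_top_dense
  proof
    fix Z :: real
    have "\<forall>\<^sub>F H in at_top. Z * H powr 0 < H powr \<tau>" by (intro eventually_powr_less \<tau>0)
    moreover have "\<forall>\<^sub>F H :: real in at_top. 0 < H" by (rule eventually_gt_at_top)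
    ultimately show "\<forall>\<^sub>F H in at_top. Z < H powr \<tau>" by eventually_elim simp
  qed
  note eventually_compose_filterlim[OF eventually_top_level this]
  moreover have "\<forall>\<^sub>F H :: real in at_top. 1 \<le> H" by (rule eventually_ge_at_top)
  ultimately show ?thesis
  proof eventually_elim
    case (elim H)
    note bad = elim(1) and \<epsilon>small = elim(2) and Hbig = elim(3) and short1 = elim(4) and short2 = elim(5)
      and Hle = elim(6) and \<kappa>small = elim(7) and ladder = elim(8) and many = elim(9) and top = elim(10) and H1 = elim(11)
    show ?case
    proof (intro allI impI)
      fix w :: "int \<times> int" assume w: "H / 128 \<le> height w" "height w \<le> H" and good: "good H w"
      define \<epsilon> R H' where "\<epsilon> = H powr (- \<eta>)" and "R = H powr \<tau> / 2" and "H' = H powr \<tau>"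
      define b where "b = height w"
      have \<epsilon>: "0 < \<epsilon>" "\<epsilon> < 1/128" using H1 \<epsilon>small by (auto simp: \<epsilon>_def)
      have R: "4 < R" using Hbig H1 by (simp add: R_def)
      have b1: "1 \<le> snd w"
      proof -
        have "0 < height w" using w(1) H1 by linarith
        then show ?thesis by simp
      qed
      then have b: "0 < b" by (simp add: b_def)
      have no_short: "4 * b / R < \<bar>(\<mu> + real_of_int (fst w)) * height u - b * real_of_int (fst u)\<bar>"
        if u: "1 \<le> snd u" "height u \<le> 4 * b / \<epsilon>" for u :: "int \<times> int"
      proof -
        have "4 * b / \<epsilon> \<le> 4 * H / \<epsilon>" using w(2) \<epsilon> by (intro divide_right_mono) (auto simp: b_def)
        also have "4 * H / \<epsilon> = 4 * H powr (1 + \<eta>)"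
          using H1 by (simp add: \<epsilon>_def powr_add powr_minus field_simps)
        also have "\<dots> \<le> H powr (1 + \<phi> 0)" using short1 by (simp add: \<phi>_def)
        finally have "4 * b / \<epsilon> \<le> H powr (1 + \<phi> 0)" .
        then have "H powr (- t 0) < \<bar>slit_cross \<mu> w u\<bar>" using goodD[OF good, of 0 u] u by linarith
        moreover have "4 * b / R \<le> H powr (- t 0)"
        proof -
          have "4 * b / R \<le> 4 * H / R" using w(2) R by (intro divide_right_mono) (auto simp: b_def)
          also have "\<dots> = 8 * H powr (1 - \<tau>)" using H1 by (simp add: R_def powr_diff)
          also have "\<dots> \<le> H powr (- t 0)" using short2 by simp
          finally show ?thesis .
        qed
        ultimately show ?thesis by (simp add: slit_cross_def b_def)
      qed
      obtain A :: "(int \<times> int) set" where finA: "finite A" and A: "\<And>u. u \<in> A \<Longrightarrow> primitive u \<and> R / 64 \<le> height u \<and>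
          height u \<le> R \<and> \<bar>(\<mu> + real_of_int (fst w)) * height u - b * real_of_int (fst u)\<bar> \<le> \<epsilon>"
        and cardA: "R * \<epsilon> / (200 * b) \<le> real (card A)"
        using many_primitive_vectors[OF b R \<epsilon>(1) no_short] by blast
      have A': "primitive u \<and> R / 64 \<le> height u \<and> height u \<le> R \<and> \<bar>slit_cross \<mu> w u\<bar> \<le> \<epsilon>"
        if "u \<in> A" for u using A[OF that] by (simp add: slit_cross_def b_def)
      define Bad where "Bad i = {u \<in> A. \<exists>v :: int \<times> int. 1 \<le> snd v \<and> height v \<le> H' powr (1 + \<phi> i) \<and>
        \<bar>slit_cross \<mu> (w + u) v\<bar> \<le> H' powr (- t i)}" for i
      define B where "B = H powr (\<tau> - 1 - 2 * \<eta>)"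
      have card_Bad: "real (card (Bad i)) \<le> B" if i: "i < S" for i
      proof -
        have \<kappa>: "H' powr (- t i) = H powr (- (\<tau> * t i))" by (simp add: H'_def powr_powr)
        have H'1: "1 \<le> H'" using Hbig H1 by (simp add: H'_def)
        have "real (card (Bad i)) \<le> (1 + R / H powr (1 + \<phi> (Suc i))) +
            (2 + 128 * (H' powr (1 + \<phi> i)) / R) * (1 + H' powr (1 + \<phi> i) / H powr (1 + \<phi> (Suc i)))"
          unfolding Bad_def
        proof (rule few_bad_children[OF b1 _ _ \<epsilon> _ _ _ _ finA A'])
          show "H' powr (- t i) < 1/4" 
          proof -
            have "5 * H powr (- (\<tau> * t i)) < 1" using bspec[OF \<kappa>small, of i] i H1 by simp
            then show ?thesis using powr_ge_zero[of H "- (\<tau> * t i)"] unfolding \<kappa> by linarith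
          qed
          show "1 \<le> H' powr (1 + \<phi> i)" using H'1 \<phi>_pos[of i] by (intro ge_one_powr_ge_zero) auto
          show "2 * H' powr (- t i) < \<bar>slit_cross \<mu> w v\<bar>"
            if v: "1 \<le> snd v" "height v \<le> H powr (1 + \<phi> (Suc i))" for v
          proof -
            have "2 * H' powr (- t i) < H powr (- t (Suc i))" using ladder i unfolding \<kappa> by auto
            also have "\<dots> < \<bar>slit_cross \<mu> w v\<bar>" using goodD[OF good, of "Suc i" v] i v by simp
            finally show ?thesis .
          qed
        qed (use H1 R in auto)
        also have "\<dots> \<le> B" using bad i unfolding R_def H'_def B_def by auto
        finally show ?thesis .
      qed
      define C where "C = A - (\<Union>i\<in>{..<S}. Bad i)"
      have "real (card (\<Union>i\<in>{..<S}. Bad i)) \<le> real S * B"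
      proof -
        have "card (\<Union>i\<in>{..<S}. Bad i) \<le> (\<Sum>i\<in>{..<S}. card (Bad i))" by (rule card_UN_le) simp
        then have "real (card (\<Union>i\<in>{..<S}. Bad i)) \<le> (\<Sum>i\<in>{..<S}. real (card (Bad i)))" by (simp flip: of_nat_sum)
        also have "\<dots> \<le> real (card {..<S}) * B" by (rule sum_bounded_above) (use card_Bad in auto)
        finally show ?thesis by simp
      qed
      moreover have "(real S + 1) * B \<le> real (card A)"
      proof -
        have "(real S + 1) * B \<le> H powr (\<tau> - 1 - \<eta>) / 400" using many by (simp add: B_def algebra_simps)
        also have "\<dots> = R * \<epsilon> / (200 * H)" using H1 by (simp add: R_def \<epsilon>_def powr_diff powr_add powr_minus field_simps)
        also have "\<dots> \<le> R * \<epsilon> / (200 * b)"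
          using w(2) b R \<epsilon> H1 by (intro divide_left_mono mult_pos_pos) (auto simp: b_def)
        finally show ?thesis using cardA by simp
      qed
      moreover have "real (card A) - real (card (\<Union>i\<in>{..<S}. Bad i)) \<le> real (card C)"
      proof -
        have "finite (\<Union>i\<in>{..<S}. Bad i)" using finA by (auto simp: Bad_def)
        then show ?thesis using diff_card_le_card_Diff[of "\<Union>i\<in>{..<S}. Bad i" A] by (simp add: C_def)
      qed
      ultimately have cardC: "B \<le> real (card C)" by (simp add: algebra_simps)
      have "H powr \<tau> / 128 \<le> height (w + u) \<and> height (w + u) \<le> H powr \<tau> \<and>
         good (H powr \<tau>) (w + u) \<and> \<bar>slit_cross \<mu> w u\<bar> \<le> H powr (- \<eta>)" if u: "u \<in> C" for u
      proof (intro conjI)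
        have uA: "u \<in> A" using u by (simp add: C_def)
        show "H powr \<tau> / 128 \<le> height (w + u)" using A'[OF uA] b by (simp add: R_def b_def)
        show "height (w + u) \<le> H powr \<tau>" using A'[OF uA] w(2) Hle H1 by (simp add: R_def)
        show "\<bar>slit_cross \<mu> w u\<bar> \<le> H powr (- \<eta>)" using A'[OF uA] by (simp add: \<epsilon>_def)
        show "good (H powr \<tau>) (w + u)"
          unfolding good_def
        proof (intro allI impI)
          fix i and v :: "int \<times> int" assume i: "i \<le> S" and v: "1 \<le> snd v" "height v \<le> (H powr \<tau>) powr (1 + \<phi> i)"
          show "(H powr \<tau>) powr (- t i) < \<bar>slit_cross \<mu> (w + u) v\<bar>"
          proof (cases "i = S")
            case True
            then show ?thesis using top v by blast
          next
            case False
            then have "u \<notin> Bad i" using i u by (auto simp: C_def)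
            then show ?thesis using uA v unfolding Bad_def H'_def mem_Collect_eq not_le[symmetric] by blast
          qed
        qed
      qed
      moreover have "1/2 \<le> \<bar>slit_cross \<mu> (w + u) (u' - u)\<bar>" if u: "u \<in> C" "u' \<in> C" "u \<noteq> u'" for u u'
      proof -
        have uA: "u \<in> A" "u' \<in> A" using u by (auto simp: C_def)
        have "0 < height u" "0 < height u'" using A'[OF uA(1)] A'[OF uA(2)] R by linarith+
        then have "u' \<noteq> - u" by auto
        then have "cross2 (ivec u) (ivec u') \<noteq> 0" using parallel_primitives[of u u'] A' uA u(3) by blast
        then have "1 \<le> \<bar>real_of_int (det2 u u')\<bar>" unfolding real_det2 by (rule abs_cross2_ivec_ge_1)
        moreover have "real_of_int (det2 u u) = 0" by (simp add: det2_def)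
        ultimately show ?thesis using A'[OF uA(1)] A'[OF uA(2)] \<epsilon> unfolding slit_cross_add slit_cross_diff by linarith
      qed
      ultimately show "\<exists>C. good_child_set H w C"
        using cardC finA unfolding B_def good_child_set_def by (intro exI[of _ C]) (auto simp: C_def)
    qed
  qed
qed

text \<open>A vector \<open>v\<close> that spoils the slit given by \<open>(a, b)\<close> yields an integer \<open>k = b * fst v - a * snd v\<close> close to
  \<open>\<mu> * snd v\<close>. Such pairs of \<open>k\<close> and \<open>snd v\<close> are rare since \<open>\<mu>\<close> is Diophantine, and each of them determines \<open>a\<close>
  modulo the prime \<open>b\<close>, because \<open>snd v\<close> is not divisible by \<open>b\<close>.\<close>

lemma good_root:
  "\<forall>\<^sub>F H in at_top. \<forall>b :: nat. prime b \<longrightarrow> real b = H \<longrightarrow> (\<exists>a. 0 \<le> a \<and> a < int b \<and> good H (a, int b))"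
proof -
  have "\<forall>\<^sub>F H in at_top. \<forall>i\<in>{..S}. 5 * H powr (- t i) < H powr 0"
    by (intro eventually_ball_finite ballI eventually_powr_less) (use t_pos in auto)
  moreover have "\<forall>\<^sub>F H in at_top. \<forall>i\<in>{..S}. 2 / c0 * H powr (- t i) < H powr (- (t i / 2))"
    by (intro eventually_ball_finite ballI eventually_powr_less) (use t_pos in auto)
  moreover have "\<forall>\<^sub>F H in at_top. \<forall>i\<in>{..S}. 1 / c0 * H powr (- 1) < H powr (- (E * \<phi> i))"
  proof (intro eventually_ball_finite ballI eventually_powr_less)
    fix i assume "i \<in> {..S}"
    then show "- 1 < - (E * \<phi> i)" using \<phi>_E_le[of i] \<tau> by simp
  qed simp
  moreover have "\<forall>\<^sub>F H in at_top. \<forall>i\<in>{..S}. 2 * (real S + 2) * H powr (1 + \<phi> i - t i / (2 * E)) < H powr 1"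
  proof (intro eventually_ball_finite ballI eventually_powr_less)
    fix i assume "i \<in> {..S}"
    then have "E * \<phi> i < t i / 2" using \<phi>_E_le[of i] t_ge[of i] t_0 \<tau> by simp
    then show "1 + \<phi> i - t i / (2 * E) < 1" using E by (simp add: field_simps)
  qed simp
  moreover have "\<forall>\<^sub>F H in at_top. 2 * (real S + 2) * H powr 0 < H powr 1" by (rule eventually_powr_less) simp
  moreover have "\<forall>\<^sub>F H :: real in at_top. 1 \<le> H" by (rule eventually_ge_at_top)
  ultimately show ?thesis
  proof eventually_elim
    case (elim H)
    show ?case
    proof (intro allI impI)
      fix b :: nat assume b: "prime b" "real b = H"
      have H1: "1 \<le> H" by (rule elim(6))
      define Q where "Q i = {v :: int \<times> int. 1 \<le> snd v \<and> height v \<le> H powr (1 + \<phi> i) \<and>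
        \<bar>slit_cross \<mu> (0, 1) v - 0\<bar> \<le> H powr (- t i)}" for i
      define Bad where "Bad i = {a \<in> {0..<int b}. \<exists>v :: int \<times> int. 1 \<le> snd v \<and> height v \<le> H powr (1 + \<phi> i) \<and>
        \<bar>slit_cross \<mu> (a, int b) v\<bar> \<le> H powr (- t i)}" for i
      have Q: "finite (Q i)" "real (card (Q i)) \<le> 1 + H powr (1 + \<phi> i) / H powr (t i / (2 * E))" if i: "i \<le> S" for i
      proof -
        have gap: "2 * H powr (- t i) < \<bar>slit_cross \<mu> (0, 1) v\<bar>"
          if v: "1 \<le> snd v" "height v \<le> H powr (t i / (2 * E))" for v
        proof -
          have "2 * H powr (- t i) < c0 * H powr (- (t i / 2))"
            using bspec[OF elim(2), of i] i c0 by (simp add: field_simps)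
          also have "H powr (- (t i / 2)) = (H powr (t i / (2 * E))) powr (- E)" using E by (simp add: powr_powr)
          also have "c0 * (H powr (t i / (2 * E))) powr (- E) \<le> c0 * height v powr (- E)"
            using v c0 E by (intro mult_left_mono powr_mono2') auto
          also have "\<dots> \<le> \<bar>slit_cross \<mu> (0, 1) v\<bar>" by (rule slit_cross_ge[OF v(1)])
          finally show ?thesis .
        qed
        have \<kappa>: "H powr (- t i) < 1/4" using bspec[OF elim(1), of i] i H1 by simp
        have D: "0 < H powr (t i / (2 * E))" using H1 by simp
        have Y: "1 \<le> H powr (1 + \<phi> i)" using H1 \<phi>_pos[of i] by (intro ge_one_powr_ge_zero) auto
        show "finite (Q i)" unfolding Q_def by (rule strip_card_le(1)[OF _ \<kappa> D Y gap]) auto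
        show "real (card (Q i)) \<le> 1 + H powr (1 + \<phi> i) / H powr (t i / (2 * E))"
          unfolding Q_def by (rule strip_card_le(2)[OF _ \<kappa> D Y gap]) auto
      qed
      have card_Bad: "real (card (Bad i)) \<le> H / (real S + 2)" if i: "i \<le> S" for i
      proof -
        have "\<exists>v. v \<in> Q i \<and> \<not> int b dvd snd v \<and> int b dvd fst v + a * snd v" if a: "a \<in> Bad i" for a
        proof -
          obtain u :: "int \<times> int" where u: "1 \<le> snd u" "height u \<le> H powr (1 + \<phi> i)"
            "\<bar>slit_cross \<mu> (a, int b) u\<bar> \<le> H powr (- t i)" using a by (auto simp: Bad_def)
          define v where "v = (int b * fst u - a * snd u, snd u)"
          have eq: "slit_cross \<mu> (0, 1) v = slit_cross \<mu> (a, int b) u"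
            by (simp add: slit_cross_def v_def algebra_simps)
          have "\<not> int b dvd snd v"
          proof
            assume "int b dvd snd v"
            then obtain s where s: "snd u = int b * s" by (auto simp: v_def elim: dvdE)
            define s' where "s' = fst u - a * s"
            have b0: "0 < real b" using b H1 by simp
            have s1: "1 \<le> s" using s u(1) b0 by (simp add: zero_less_mult_iff int_one_le_iff_zero_less)
            have "slit_cross \<mu> (a, int b) u = real b * (\<mu> * real_of_int s - real_of_int s')"
              by (simp add: slit_cross_def s s'_def algebra_simps)
            then have "real b * \<bar>\<mu> * real_of_int s - real_of_int s'\<bar> \<le> H powr (- t i)"
              using u(3) b0 by (simp add: abs_mult)
            also have "\<dots> \<le> 1" using bspec[OF elim(1), of i] i H1 by simp
            finally have 1: "\<bar>\<mu> * real_of_int s - real_of_int s'\<bar> \<le> H powr (- 1)"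
              using b0 by (simp add: b(2)[symmetric] powr_minus_divide pos_le_divide_eq mult.commute)
            have "H * real_of_int s \<le> H * H powr (\<phi> i)" using u(2) s b(2) H1 by (simp add: powr_add)
            then have s2: "real_of_int s \<le> H powr (\<phi> i)" using H1 by simp
            have "H powr (- 1) < c0 * H powr (- (E * \<phi> i))" using mult_strict_left_mono[OF bspec[OF elim(3), of i] c0] i c0 by simp
            also have "H powr (- (E * \<phi> i)) = (H powr (\<phi> i)) powr (- E)" by (simp add: powr_powr mult.commute)
            also have "c0 * (H powr (\<phi> i)) powr (- E) \<le> c0 * real_of_int s powr (- E)"
              using s1 s2 c0 E by (intro mult_left_mono powr_mono2') auto
            also have "\<dots> \<le> \<bar>\<mu> * real_of_int s - real_of_int s'\<bar>" by (rule dioph[OF s1])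
            finally show False using 1 by simp
          qed
          moreover have "v \<in> Q i" unfolding Q_def mem_Collect_eq eq using u by (simp add: v_def)
          moreover have "int b dvd fst v + a * snd v" by (simp add: v_def)
          ultimately show ?thesis by blast
        qed
        then obtain v where v: "\<And>a. a \<in> Bad i \<Longrightarrow> v a \<in> Q i \<and> \<not> int b dvd snd (v a) \<and> int b dvd fst (v a) + a * snd (v a)"
          by metis
        have "inj_on v (Bad i)"
        proof (rule inj_onI)
          fix a a' assume a: "a \<in> Bad i" "a' \<in> Bad i" "v a = v a'"
          have "int b dvd (fst (v a) + a * snd (v a)) - (fst (v a) + a' * snd (v a))"
            using v[OF a(1)] v[OF a(2)] a(3) by (intro dvd_diff) auto
          then have "int b dvd (a - a') * snd (v a)" by (simp add: algebra_simps)
          then have "int b dvd a - a'" using v[OF a(1)] b(1) by (simp add: prime_dvd_mult_iff)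
          then show "a = a'" using a zdvd_imp_le[of "int b" "a - a'"] zdvd_imp_le[of "int b" "a' - a"]
            by (cases a a' rule: linorder_cases) (auto simp: Bad_def dvd_diff_commute)
        qed
        moreover have "v ` Bad i \<subseteq> Q i" using v by blast
        ultimately have "card (Bad i) \<le> card (Q i)" using Q(1)[OF i] card_inj_on_le by blast
        also have "real (card (Q i)) \<le> 1 + H powr (1 + \<phi> i) / H powr (t i / (2 * E))" by (rule Q(2)[OF i])
        also have "H powr (1 + \<phi> i) / H powr (t i / (2 * E)) = H powr (1 + \<phi> i - t i / (2 * E))" by (simp add: powr_diff)
        also have "1 + H powr (1 + \<phi> i - t i / (2 * E)) \<le> H / (real S + 2)"
        proof -
          have "2 * (real S + 2) * H powr (1 + \<phi> i - t i / (2 * E)) \<le> H" "2 * (real S + 2) \<le> H"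
            using bspec[OF elim(4), of i] i elim(5) H1 by auto
          then show ?thesis by (simp add: field_simps)
        qed
        finally show ?thesis by simp
      qed
      have "real (card (\<Union>i\<in>{..S}. Bad i)) < real b"
      proof -
        have "card (\<Union>i\<in>{..S}. Bad i) \<le> (\<Sum>i\<in>{..S}. card (Bad i))" by (rule card_UN_le) simp
        then have "real (card (\<Union>i\<in>{..S}. Bad i)) \<le> (\<Sum>i\<in>{..S}. real (card (Bad i)))" by (simp flip: of_nat_sum)
        also have "\<dots> \<le> real (card {..S}) * (H / (real S + 2))" by (rule sum_bounded_above) (use card_Bad in auto)
        also have "\<dots> < H" using H1 by (simp add: field_simps)
        finally show ?thesis using b by simp
      qed
      then have "card (\<Union>i\<in>{..S}. Bad i) < card {0..<int b}" by simp
      moreover have "(\<Union>i\<in>{..S}. Bad i) \<subseteq> {0..<int b}" by (auto simp: Bad_def)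
      ultimately obtain a where a: "a \<in> {0..<int b}" "a \<notin> (\<Union>i\<in>{..S}. Bad i)"
        by (metis less_irrefl subsetI subset_antisym)
      have "good H (a, int b)"
        unfolding good_def
      proof (intro allI impI, rule ccontr)
        fix i and v :: "int \<times> int" assume v: "i \<le> S" "1 \<le> snd v" "height v \<le> H powr (1 + \<phi> i)"
          "\<not> H powr (- t i) < \<bar>slit_cross \<mu> (a, int b) v\<bar>"
        then have "a \<in> Bad i" using a(1) unfolding Bad_def mem_Collect_eq not_less by blast
        then show False using a(2) v(1) by blast
      qed
      then show "\<exists>a. 0 \<le> a \<and> a < int b \<and> good H (a, int b)" using a by auto
    qed
  qed
qed

end

section \<open>The lower bound\<close>

text \<open>Directions are parametrised by the inverse slope, since the inverse slopes of two vectors differ by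
  their cross product divided by the product of their heights.\<close>

definition direction :: "real \<Rightarrow> real \<times> real" where
  "direction x = (1 / sqrt (1 + x\<^sup>2)) *\<^sub>R (x, 1)"

lemma norm_direction [simp]: "norm (direction x) = 1"
proof -
  have "0 < 1 + x\<^sup>2" by (smt (verit) zero_le_power2)
  then show ?thesis unfolding direction_def norm_scaleR by (simp add: norm_Pair add.commute)
qed

lemma direction_of_vector:
  assumes "0 < b"
  shows "(b * x, b) /\<^sub>R norm (b * x, b) = direction x"
proof -
  have "norm (b * x, b) = norm (b *\<^sub>R (x, 1 :: real))" by simp
  also have "\<dots> = b * sqrt (1 + x\<^sup>2)" using assms unfolding norm_scaleR by (simp add: norm_Pair add.commute)
  finally have n: "norm (b * x, b) = b * sqrt (1 + x\<^sup>2)" .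
  show ?thesis unfolding n direction_def using assms by (simp add: field_simps)
qed

lemma direction_expanding:
  assumes "x \<in> {-4..4}" "y \<in> {-4..4}"
  shows "dist x y \<le> 17 * dist (direction x) (direction y)"
proof -
  have pos: "0 < sqrt (1 + z\<^sup>2)" and le: "z \<in> {-4..4} \<Longrightarrow> sqrt (1 + z\<^sup>2) \<le> sqrt 17" for z :: real
  proof -
    have "0 < 1 + z\<^sup>2" by (smt (verit) zero_le_power2)
    then show "0 < sqrt (1 + z\<^sup>2)" by simp
    assume "z \<in> {-4..4}"
    then have "\<bar>z\<bar>\<^sup>2 \<le> 4\<^sup>2" by (intro power_mono) auto
    then show "sqrt (1 + z\<^sup>2) \<le> sqrt 17" by simp
  qed
  have "cross2 (direction x) (direction y) = (x - y) / (sqrt (1 + x\<^sup>2) * sqrt (1 + y\<^sup>2))"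
    by (simp add: direction_def cross2_def diff_divide_distrib)
  then have "\<bar>x - y\<bar> = sqrt (1 + x\<^sup>2) * sqrt (1 + y\<^sup>2) * \<bar>cross2 (direction x) (direction y)\<bar>"
    using pos[of x] pos[of y] by (simp add: abs_mult abs_divide)
  also have "\<dots> \<le> sqrt 17 * sqrt 17 * \<bar>cross2 (direction x) (direction y)\<bar>"
    using le[OF assms(1)] le[OF assms(2)] pos[of x] pos[of y] by (intro mult_right_mono mult_mono) auto
  also have "cross2 (direction x) (direction y) = cross2 (direction x - direction y) (direction y)"
    by (simp add: cross2_add)
  also have "\<bar>\<dots>\<bar> \<le> norm (direction x - direction y) * norm (direction y)" by (rule abs_cross2_le)
  finally show ?thesis by (simp add: dist_norm)
qed

text \<open>The nodes of level \<open>k\<close> are good slits of height between \<open>H k / 128\<close> and \<open>H k\<close>, and a cell is an interval of inverse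
  slopes around that of the slit. A child moves the inverse slope by the cross product divided by
  both heights, which is at most half the radius \<open>r k = 1 / (H k * H (Suc k))\<close>; siblings have cross product at least \<open>1/2\<close> and
  therefore inverse slopes at distance at least \<open>1 / (2 * (H (Suc k))\<^sup>2)\<close>. The numbers of children multiply up to a power of
  \<open>H k\<close>, and the hypothesis \<open>dim\<close> compares its exponent with that of the sibling distance.\<close>

lemma (in diophantine_exponents) K_content_neq_0:
  assumes \<mu>: "0 < \<mu>" "\<mu> < 1/2" and s: "0 < s" "s \<le> 1"
    and dim: "s * (\<tau> + 1 + 2 * \<eta>) \<le> 1 - 2 * \<eta> / (\<tau> - 1)"
  shows "hausdorff_content s (K (2 * \<mu>)) \<noteq> 0"
proof -
  (* 1024 leaves room for cells much smaller than their distances and for increasing lengths, and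
     32768 = 2 * 128\<^sup>2 absorbs the factor lost in the heights of a slit and its child. *)
  define large where "large H \<longleftrightarrow> 1024 * H < H powr \<tau> \<and> 32768 * H powr (- \<eta>) < 1 \<and> 1 \<le> H \<and>
    (\<forall>w. H / 128 \<le> height w \<longrightarrow> height w \<le> H \<longrightarrow> good H w \<longrightarrow> (\<exists>C. good_child_set H w C))" for H
  have "\<forall>\<^sub>F H in at_top. 1024 * H powr 1 < H powr \<tau>" by (intro eventually_powr_less \<tau>)
  moreover have "\<forall>\<^sub>F H in at_top. 32768 * H powr (- \<eta>) < H powr 0"
    by (intro eventually_powr_less) (use \<eta> in simp)
  moreover have "\<forall>\<^sub>F H :: real in at_top. 1 \<le> H" by (rule eventually_ge_at_top)
  moreover note good_children
  ultimately have "\<forall>\<^sub>F H in at_top. large H"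
    by eventually_elim (simp add: large_def)
  then obtain H0 where H0: "\<And>H. H0 \<le> H \<Longrightarrow> large H"
    unfolding eventually_at_top_linorder by blast
  obtain H1 where H1: "\<forall>H\<ge>H1. \<forall>b :: nat. prime b \<longrightarrow> real b = H \<longrightarrow> (\<exists>a. 0 \<le> a \<and> a < int b \<and> good H (a, int b))"
    using good_root unfolding eventually_at_top_linorder by (rule exE)
  obtain b :: nat where b: "prime b" "nat \<lceil>max H0 H1\<rceil> < b" using bigger_prime by blast
  define h where "h = real b"
  have h: "H0 \<le> h" "H1 \<le> h" using b(2) unfolding h_def by linarith+
  obtain a where a: "0 \<le> a" "a < int b" "good h (a, int b)" using H1 h(2) b(1) h_def by blast

  define H where "H = rec_nat h (\<lambda>_ x. x powr \<tau>)"
  have H_0: "H 0 = h" and H_Suc: "H (Suc k) = H k powr \<tau>" for k by (simp_all add: H_def)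
  have H_ge: "h \<le> H k" for k
  proof (induction k)
    case (Suc k)
    have "H0 \<le> H k" using Suc h by simp
    then have "1024 * H k < H k powr \<tau>" "1 \<le> H k" using H0 by (auto simp: large_def)
    then show ?case using Suc unfolding H_Suc by linarith
  qed (simp add: H_0)
  have HH: "H0 \<le> H k" for k using H_ge[of k] h by linarith
  have H_1: "1 \<le> H k" and H_step: "1024 * H k < H (Suc k)" and \<epsilon>_small: "32768 * H k powr (- \<eta>) < 1" for k
    using H0[OF HH[of k]] by (auto simp: H_Suc large_def)
  have H_pos: "0 < H k" for k using H_1[of k] by linarith

  define node where "node k w \<longleftrightarrow> H k / 128 \<le> height w \<and> height w \<le> H k \<and> good (H k) w" for k w
  define C where "C k w = (SOME C. good_child_set (H k) w C)" for k w
  have C: "good_child_set (H k) w (C k w)" if "node k w" for k w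
  proof -
    have "\<exists>C. good_child_set (H k) w C"
      using H0[OF HH[of k]] that unfolding node_def large_def by blast
    then show ?thesis unfolding C_def by (rule someI_ex)
  qed
  define ch where "ch k w = (\<lambda>u. w + u) ` C k w" for k w
  define \<xi> where "\<xi> w = (\<mu> + real_of_int (fst w)) / height w" for w :: "int \<times> int"
  define r where "r k = 1 / (H k * H (Suc k))" for k
  define cell where "cell k w = {\<xi> w - r k .. \<xi> w + r k}" for k w
  define N where "N k = H k powr (\<tau> - 1 - 2 * \<eta>)" for k
  define \<delta> where "\<delta> k = 1 / (4 * (H (Suc k))\<^sup>2)" for k

  have node_pos: "0 < height w" if "node k w" for k w
    using that H_pos[of k] by (auto simp: node_def)
  have node_ch: "node (Suc k) y" if "node k w" "y \<in> ch k w" for k w y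
    using C[OF that(1)] that(2) by (auto simp: node_def ch_def H_Suc good_child_set_def)
  have ch_cross: "\<bar>slit_cross \<mu> w (y - w)\<bar> \<le> H k powr (- \<eta>)" if "node k w" "y \<in> ch k w" for k w y
    using C[OF that(1)] that(2) by (auto simp: ch_def good_child_set_def)
  have ch_sep: "1/2 \<le> \<bar>slit_cross \<mu> y (y' - y)\<bar>" if y: "node k w" "y \<in> ch k w" "y' \<in> ch k w" "y \<noteq> y'" for k w y y'
  proof -
    obtain u u' where u: "u \<in> C k w" "y = w + u" "u' \<in> C k w" "y' = w + u'" using y(2,3) unfolding ch_def by blast
    then have "u \<noteq> u'" using y(4) by blast
    then have "1/2 \<le> \<bar>slit_cross \<mu> (w + u) (u' - u)\<bar>"
      using C[OF y(1)] u(1,3) unfolding good_child_set_def by blast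
    moreover have "y' - y = u' - u" using u(2,4) by simp
    ultimately show ?thesis by (metis u(2))
  qed
  have \<xi>_diff: "\<bar>\<xi> w - \<xi> w'\<bar> = \<bar>slit_cross \<mu> w (w' - w)\<bar> / (height w * height w')"
    if "0 < height w" "0 < height w'" for w w'
  proof -
    have "\<xi> w - \<xi> w' = slit_cross \<mu> w (w' - w) / (height w * height w')"
      using that by (simp add: \<xi>_def slit_cross_def field_simps)
    then show ?thesis using that by (simp add: abs_mult abs_divide)
  qed
  have r_pos: "0 < r k" for k using H_pos by (simp add: r_def)
  have r_Suc: "r (Suc k) \<le> r k / 2" for k
  proof -
    have "H k * 2 \<le> H (Suc (Suc k))" using H_step[of k] H_step[of "Suc k"] H_pos[of k] H_pos[of "Suc k"] by linarith
    then have "H (Suc k) * (H k * 2) \<le> H (Suc k) * H (Suc (Suc k))" using H_pos by (intro mult_left_mono) (auto intro: less_imp_le)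
    then have "1 / (H (Suc k) * H (Suc (Suc k))) \<le> 1 / (H (Suc k) * (H k * 2))"
      using H_pos by (intro divide_left_mono mult_pos_pos) auto
    then show ?thesis by (simp add: r_def mult_ac)
  qed
  have \<xi>_child: "\<bar>\<xi> w - \<xi> y\<bar> \<le> r k / 2" if w: "node k w" "y \<in> ch k w" for k w y
  proof -
    have y: "node (Suc k) y" using node_ch[OF w] .
    have "\<bar>\<xi> w - \<xi> y\<bar> = \<bar>slit_cross \<mu> w (y - w)\<bar> / (height w * height y)"
      using node_pos[OF w(1)] node_pos[OF y] by (rule \<xi>_diff)
    also have "\<dots> \<le> (1 / 32768) / ((H k / 128) * (H (Suc k) / 128))"
    proof (rule frac_le)
      show "\<bar>slit_cross \<mu> w (y - w)\<bar> \<le> 1 / 32768" using ch_cross[OF w] \<epsilon>_small[of k] by linarith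
      show "(H k / 128) * (H (Suc k) / 128) \<le> height w * height y"
        using w(1) y H_pos[of k] H_pos[of "Suc k"] by (intro mult_mono) (auto simp: node_def)
    qed (use H_pos[of k] H_pos[of "Suc k"] in auto)
    also have "\<dots> = r k / 2" by (simp add: r_def)
    finally show ?thesis .
  qed
  have nested: "cell (Suc k) y \<subseteq> cell k w" if "node k w" "y \<in> ch k w" for k w y
  proof -
    have "\<xi> w - r k \<le> \<xi> y - r (Suc k)" "\<xi> y + r (Suc k) \<le> \<xi> w + r k"
      using \<xi>_child[OF that] r_Suc[of k] by linarith+
    then show ?thesis by (auto simp: cell_def)
  qed

  have scheme: "cantor_scheme node ch cell N \<delta>"
  proof
    fix k x assume x: "node k x"
    show "finite (ch k x)" using C[OF x] by (simp add: ch_def good_child_set_def)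
    have "inj_on (\<lambda>u. x + u) (C k x)" by (auto intro: inj_onI)
    then show "N k \<le> real (card (ch k x))" using C[OF x] by (simp add: ch_def N_def card_image good_child_set_def)
  next
    fix k
    show "0 < N k" using H_pos[of k] by (simp add: N_def)
    show "0 < \<delta> k" using H_pos[of "Suc k"] by (simp add: \<delta>_def)
  next
    fix k x y assume y: "node k x" "y \<in> ch k x"
    show "node (Suc k) y" using y by (rule node_ch)
    show "cell (Suc k) y \<subseteq> cell k x" using y by (rule nested)
  next
    fix k x y y' p p'
    assume x: "node k x" and y: "y \<in> ch k x" "y' \<in> ch k x" "y \<noteq> y'" and p: "p \<in> cell (Suc k) y" "p' \<in> cell (Suc k) y'"
    let ?H = "H (Suc k)"
    have n: "node (Suc k) y" "node (Suc k) y'" using node_ch x y by auto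
    have "(1/2) / (?H * ?H) \<le> \<bar>slit_cross \<mu> y (y' - y)\<bar> / (height y * height y')"
    proof (rule frac_le)
      show "1/2 \<le> \<bar>slit_cross \<mu> y (y' - y)\<bar>" by (rule ch_sep[OF x y])
      show "height y * height y' \<le> ?H * ?H"
        using n node_pos[OF n(2)] H_pos[of "Suc k"] by (intro mult_mono) (auto simp: node_def)
    qed (use node_pos[OF n(1)] node_pos[OF n(2)] in auto)
    also have "\<dots> = \<bar>\<xi> y - \<xi> y'\<bar>" by (rule \<xi>_diff[symmetric, OF node_pos[OF n(1)] node_pos[OF n(2)]])
    finally have 1: "(1/2) / (?H * ?H) \<le> \<bar>\<xi> y - \<xi> y'\<bar>" .
    have 2: "r (Suc k) \<le> (1/8) / (?H * ?H)"
    proof -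
      have "?H * (8 * ?H) \<le> ?H * H (Suc (Suc k))" using H_step[of "Suc k"] H_pos[of "Suc k"] by (intro mult_left_mono) auto
      then have "1 / (?H * H (Suc (Suc k))) \<le> 1 / (?H * (8 * ?H))"
        using H_pos by (intro divide_left_mono mult_pos_pos) auto
      then show ?thesis by (simp add: r_def)
    qed
    have "\<bar>p - \<xi> y\<bar> \<le> r (Suc k)" "\<bar>p' - \<xi> y'\<bar> \<le> r (Suc k)" using p by (auto simp: cell_def abs_le_iff)
    moreover have "\<delta> k = (1/4) / (?H * ?H)" by (simp add: \<delta>_def power2_eq_square)
    moreover have "(1/2) / (?H * ?H) = 2 * ((1/4) / (?H * ?H))" "(1/8) / (?H * ?H) = ((1/4) / (?H * ?H)) / 2" by simp_all
    ultimately show "\<delta> k \<le> \<bar>p - p'\<bar>" using 1 2 by linarith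
  next
    have H_pow: "2 ^ k \<le> H k" for k
    proof (induction k)
      case 0 then show ?case using H_1[of 0] by simp
    next
      case (Suc k) then show ?case using H_step[of k] H_pos[of k] by simp
    qed
    show "\<delta> \<longlonglongrightarrow> 0"
    proof (rule tendsto_sandwich[of "\<lambda>_. 0" _ _ "\<lambda>k. (1/2) ^ k"])
      show "\<forall>\<^sub>F k in sequentially. \<delta> k \<le> (1/2) ^ k"
      proof (rule always_eventually, rule allI)
        fix k
        have "H k \<le> H (Suc k)" using H_step[of k] H_pos[of k] by linarith
        then have "(2::real) ^ k \<le> H (Suc k)" using H_pow[of k] by linarith
        also have "H (Suc k) \<le> 4 * (H (Suc k))\<^sup>2" using H_1[of "Suc k"] by (simp add: power2_eq_square mult_le_cancel_left1)
        finally have "1 / (4 * (H (Suc k))\<^sup>2) \<le> 1 / 2 ^ k" using H_pos[of "Suc k"] by (intro divide_left_mono) auto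
        then show "\<delta> k \<le> (1/2) ^ k" by (simp add: \<delta>_def power_one_over)
      qed
    qed (auto simp: \<delta>_def LIMSEQ_power_zero)
  qed
  interpret cantor_scheme node ch cell N \<delta> by (rule scheme)

  define E' where "E' = {x \<in> {-4..4}. direction x \<in> K (2 * \<mu>)}"
  define w0 where "w0 = (a, int b)"
  have node0: "node 0 w0" using a H_pos[of 0] by (simp add: node_def H_0 w0_def h_def)
  have \<xi>0: "0 \<le> \<xi> w0" "\<xi> w0 \<le> 2"
  proof -
    have "0 < real b" using H_pos[of 0] by (simp add: H_0 h_def)
    moreover have "\<mu> + real_of_int a \<le> 2 * real b" using \<mu> a(2) by linarith
    ultimately show "0 \<le> \<xi> w0" "\<xi> w0 \<le> 2" using \<mu> a(1) by (auto simp: \<xi>_def w0_def pos_divide_le_eq)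
  qed
  have r0: "r 0 \<le> 1"
  proof -
    have "1 * 1 \<le> H 0 * H (Suc 0)" using H_1[of 0] H_1[of "Suc 0"] by (intro mult_mono) auto
    then show ?thesis by (simp add: r_def)
  qed

  have lim: "\<exists>\<theta>\<in>E'. \<forall>k. \<theta> \<in> cell k (X k)" if X: "X 0 = w0" "\<And>k. X (Suc k) \<in> ch k (X k)" for X
  proof -
    have nX: "node k (X k)" for k
      by (induction k) (use node0 X node_ch in auto)
    have sub: "cell (Suc k) (X (Suc k)) \<subseteq> cell k (X k)" for k by (rule nested[OF nX X(2)])
    then have dec: "cell n (X n) \<subseteq> cell m (X m)" if "m \<le> n" for m n
      using lift_Suc_antimono_le[of "\<lambda>k. cell k (X k)" m n] sub that by blast
    have "\<Inter> (range (\<lambda>k. cell k (X k))) \<noteq> {}"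
      by (rule compact_nest) (use dec r_pos in \<open>auto simp: cell_def less_imp_le\<close>)
    then obtain \<theta> where \<theta>: "\<And>k. \<theta> \<in> cell k (X k)" by blast
    define w where "w k = (2 * \<mu> + real_of_int (2 * fst (X k)), real_of_int (2 * snd (X k)))" for k
    have Xpos: "0 < height (X k)" for k by (rule node_pos[OF nX])
    have w_eq: "w k = (2 * height (X k) * \<xi> (X k), 2 * height (X k))" for k
      using Xpos[of k] by (simp add: w_def \<xi>_def)
    have \<xi>_lim: "(\<lambda>k. \<xi> (X k)) \<longlonglongrightarrow> \<theta>"
    proof (rule LIMSEQ_I)
      fix e :: real assume e: "0 < e"
      have r_le: "r k \<le> (1/2) ^ k" for k
      proof (induction k)
        case (Suc k) then show ?case using r_Suc[of k] by simp
      qed (use r0 in simp)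
      obtain n where n: "(1/2 :: real) ^ n < e" using real_arch_pow_inv[OF e, of "1/2"] by auto
      show "\<exists>n. \<forall>k\<ge>n. norm (\<xi> (X k) - \<theta>) < e"
      proof (intro exI[of _ n] allI impI)
        fix k assume "n \<le> k"
        then have "(1/2 :: real) ^ k \<le> (1/2) ^ n" by (intro power_decreasing) auto
        moreover have "\<bar>\<xi> (X k) - \<theta>\<bar> \<le> r k" using \<theta>[of k] by (auto simp: cell_def abs_le_iff)
        ultimately show "norm (\<xi> (X k) - \<theta>) < e" using r_le[of k] n unfolding real_norm_def by linarith
      qed
    qed
    have \<xi>_bound: "\<bar>\<xi> (X k)\<bar> \<le> 3" for k
    proof -
      have "\<xi> (X k) \<in> cell k (X k)" using r_pos[of k] by (simp add: cell_def less_imp_le)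
      then have "\<xi> (X k) \<in> cell 0 w0" using dec[of 0 k] X(1) by auto
      then have "\<xi> w0 - r 0 \<le> \<xi> (X k)" "\<xi> (X k) \<le> \<xi> w0 + r 0" by (simp_all add: cell_def)
      then show ?thesis using \<xi>0 r0 by linarith
    qed
    have "direction \<theta> \<in> K (2 * \<mu>)"
      unfolding K_def mem_Collect_eq
    proof (intro conjI exI[of _ w] allI)
      show "direction \<theta> \<in> sphere 0 1" by simp
      show "\<exists>m n :: int. even m \<and> even n \<and> n \<noteq> 0 \<and> w j = (2 * \<mu> + real_of_int m, real_of_int n)" for j
        using Xpos[of j] by (intro exI[of _ "2 * fst (X j)"] exI[of _ "2 * snd (X j)"]) (auto simp: w_def)
      show "strict_mono (\<lambda>j. norm (w j))"
        unfolding strict_mono_Suc_iff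
      proof
        fix k
        have "norm (w k) \<le> \<bar>fst (w k)\<bar> + \<bar>snd (w k)\<bar>" by (cases "w k") (simp add: norm_Pair sqrt_sum_squares_le_sum_abs)
        also have "\<dots> = 2 * height (X k) * (\<bar>\<xi> (X k)\<bar> + 1)"
          using Xpos[of k] by (simp add: w_eq abs_mult algebra_simps)
        also have "\<dots> \<le> 2 * H k * 4"
          using \<xi>_bound[of k] nX[of k] Xpos[of k] by (intro mult_mono) (auto simp: node_def)
        also have "\<dots> < 2 * (H (Suc k) / 128)" using H_step[of k] H_pos[of k] by simp
        also have "\<dots> \<le> 2 * real_of_int (snd (X (Suc k)))" using nX[of "Suc k"] by (simp add: node_def)
        also have "\<dots> \<le> \<bar>snd (w (Suc k))\<bar>" by (simp add: w_eq)
        also have "\<dots> \<le> norm (w (Suc k))" by (cases "w (Suc k)") (simp add: norm_Pair real_sqrt_sum_squares_ge2)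
        finally show "norm (w k) < norm (w (Suc k))" .
      qed
      show "summable (\<lambda>j. \<bar>cross2 (w j) (w (Suc j))\<bar>)"
      proof (rule summable_comparison_test')
        have z: "0 < (2::real) powr (- \<eta>)" "(2::real) powr (- \<eta>) < 1" using \<eta> by (auto simp: powr_less_one)
        then show "summable (\<lambda>k. 4 * ((2::real) powr (- \<eta>)) ^ k)" by (intro summable_mult summable_geometric) simp
        fix k :: nat
        have "cross2 (w k) (w (Suc k)) = 4 * slit_cross \<mu> (X k) (X (Suc k) - X k)"
          by (simp add: w_def cross2_def slit_cross_def algebra_simps)
        then have "\<bar>cross2 (w k) (w (Suc k))\<bar> \<le> 4 * H k powr (- \<eta>)"
          using ch_cross[OF nX X(2), of k] by (simp add: abs_mult)
        also have "H k powr (- \<eta>) \<le> (2 ^ k) powr (- \<eta>)"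
        proof (rule powr_mono2')
          show "2 ^ k \<le> H k"
          proof (induction k)
            case 0 then show ?case using H_1[of 0] by simp
          next
            case (Suc k) then show ?case using H_step[of k] H_pos[of k] by simp
          qed
        qed (use \<eta> in auto)
        also have "((2::real) ^ k) powr (- \<eta>) = (2 powr (- \<eta>)) ^ k"
          by (simp add: powr_powr mult.commute flip: powr_realpow)
        finally show "norm \<bar>cross2 (w k) (w (Suc k))\<bar> \<le> 4 * (2 powr (- \<eta>)) ^ k" by simp
      qed
      have "(\<lambda>j. direction (\<xi> (X j))) \<longlonglongrightarrow> direction \<theta>"
        unfolding direction_def by (intro tendsto_intros \<xi>_lim) (smt (verit) real_sqrt_gt_zero zero_le_power2)
      moreover have "w j /\<^sub>R norm (w j) = direction (\<xi> (X j))" for j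
        unfolding w_eq using Xpos[of j] by (intro direction_of_vector) simp
      ultimately show "(\<lambda>j. w j /\<^sub>R norm (w j)) \<longlonglongrightarrow> direction \<theta>" by simp
    qed
    moreover have "\<theta> \<in> {-4..4}" using \<theta>[of 0] X(1) \<xi>0 r0 by (auto simp: cell_def)
    ultimately show ?thesis using \<theta> by (auto simp: E'_def)
  qed

  define \<nu> \<kappa> where "\<nu> = \<tau> - 1 - 2 * \<eta>" and "\<kappa> = 1 - 2 * \<eta> / (\<tau> - 1)"
  have \<kappa>: "\<tau> * \<kappa> = \<kappa> + \<nu>" using \<tau> by (simp add: \<kappa>_def \<nu>_def field_simps)
  have prod: "(\<Prod>j<k. N j) = H k powr \<kappa> * h powr (- \<kappa>)" for k
  proof (induction k)
    case 0
    then show ?case using H_pos[of 0] by (simp add: H_0 flip: powr_add)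
  next
    case (Suc k)
    have "H (Suc k) powr \<kappa> = H k powr (\<kappa> + \<nu>)" by (simp add: H_Suc powr_powr \<kappa>)
    then show ?case using Suc by (simp add: N_def \<nu>_def powr_add)
  qed
  define c where "c = h powr (- \<kappa>) * 4 powr (- s)"
  have "0 < c" using H_pos[of 0] by (simp add: c_def H_0)
  moreover have "c \<le> (\<Prod>j<k. N j) * (N k * \<delta> k) powr s" for k
  proof -
    have "(H (Suc k))\<^sup>2 = H k powr (2 * \<tau>)" by (simp only: H_Suc power2_eq_square mult_2 powr_add)
    then have "N k * \<delta> k = H k powr (\<nu> - 2 * \<tau>) * (1/4)"
      by (simp add: N_def \<delta>_def \<nu>_def[symmetric] powr_diff[of _ \<nu> "2 * \<tau>"])
    moreover have "(1/4 :: real) powr s = 4 powr (- s)" by (simp add: powr_divide powr_minus_divide)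
    ultimately have "(N k * \<delta> k) powr s = H k powr (s * (\<nu> - 2 * \<tau>)) * 4 powr (- s)"
      by (simp only: powr_mult powr_powr mult.commute[of s])
    then have "(\<Prod>j<k. N j) * (N k * \<delta> k) powr s = c * H k powr (\<kappa> + s * (\<nu> - 2 * \<tau>))"
      unfolding prod c_def by (simp add: powr_add mult_ac)
    moreover have "0 \<le> \<kappa> + s * (\<nu> - 2 * \<tau>)" using dim by (simp add: \<kappa>_def \<nu>_def algebra_simps)
    then have "1 \<le> H k powr (\<kappa> + s * (\<nu> - 2 * \<tau>))" using H_1[of k] by (intro ge_one_powr_ge_zero) auto
    ultimately show ?thesis using \<open>0 < c\<close> by simp
  qed
  ultimately have E': "hausdorff_content s E' \<noteq> 0"
    using hausdorff_content_neq_0[OF s node0, of E' c] lim by blast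
  have "hausdorff_content s E' \<le> ennreal (17 powr s) * hausdorff_content s (direction ` E')"
    using direction_expanding s by (intro hausdorff_content_expanding_le) (auto simp: E'_def)
  also have "\<dots> \<le> ennreal (17 powr s) * hausdorff_content s (K (2 * \<mu>))"
    by (intro mult_left_mono hausdorff_content_mono) (auto simp: E'_def)
  finally show ?thesis using E' by auto
qed

section \<open>Diophantine numbers and the dimension\<close>

text \<open>A rational number \<open>p / q\<close> agrees with all the fractions \<open>(k * p) / (k * q)\<close>, which count as different solutions.\<close>

lemma diophantine_irrational:
  assumes "diophantine l"
  shows "l \<notin> \<rat>"
proof
  assume "l \<in> \<rat>"
  then obtain p q :: int where pq: "0 < q" "l = real_of_int p / real_of_int q" by (rule Rats_cases') blast
  obtain e where fin: "finite {(p::int, q::int). q \<noteq> 0 \<and>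
      \<bar>l - real_of_int p / real_of_int q\<bar> \<le> 1 / \<bar>real_of_int q\<bar> powr e}" (is "finite ?F")
    using assms by (auto simp: diophantine_def)
  define f where "f k = (int (Suc k) * p, int (Suc k) * q)" for k
  have "f k \<in> ?F" for k
  proof -
    have "real_of_int (int (Suc k) * p) / real_of_int (int (Suc k) * q) = l"
      unfolding of_int_mult pq(2) by (rule mult_divide_mult_cancel_left) simp
    then show ?thesis using pq(1) by (simp add: f_def)
  qed
  then have "finite (range f)" using fin by (meson finite_subset image_subsetI)
  moreover have "inj f" using pq(1) by (auto simp: f_def inj_def)
  ultimately show False using finite_imageD infinite_UNIV_nat by blast
qed

text \<open>The finitely many exceptional fractions are absorbed into the constant: none of them equals \<open>l\<close>, which is
  irrational.\<close>

lemma diophantine_exponent: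
  assumes "diophantine l"
  obtains c E where "0 < c" "1 \<le> E"
    "\<And>p q :: int. 1 \<le> q \<Longrightarrow> c * real_of_int q powr (- E) \<le> \<bar>l / 2 * real_of_int q - real_of_int p\<bar>"
proof -
  obtain e where fin: "finite {(p::int, q::int). q \<noteq> 0 \<and>
      \<bar>l - real_of_int p / real_of_int q\<bar> \<le> 1 / \<bar>real_of_int q\<bar> powr e}" (is "finite ?F")
    using assms by (auto simp: diophantine_def)
  define D where "D = insert (1/2) ((\<lambda>(p, q). \<bar>l / 2 * real_of_int q - real_of_int p / 2\<bar>) ` ?F)"
  have D: "finite D" "D \<noteq> {}" using fin by (auto simp: D_def)
  define c where "c = Min D"
  have c_pos: "0 < c"
  proof -
    have "0 < x" if "x \<in> D" for x
    proof (rule ccontr)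
      assume "\<not> 0 < x"
      then obtain p q :: int where pq: "q \<noteq> 0" "x = \<bar>l / 2 * real_of_int q - real_of_int p / 2\<bar>"
        using \<open>x \<in> D\<close> by (auto simp: D_def)
      then have "l / 2 * real_of_int q = real_of_int p / 2" using \<open>\<not> 0 < x\<close> by simp
      then have "l = real_of_int p / real_of_int q" using pq(1) by (simp add: field_simps)
      then show False using diophantine_irrational[OF assms] by simp
    qed
    then show ?thesis unfolding c_def using D by simp
  qed
  have c_le: "c \<le> x" if "x \<in> D" for x unfolding c_def using D(1) that by (rule Min_le)
  have "c * real_of_int q powr (- max 1 e) \<le> \<bar>l / 2 * real_of_int q - real_of_int p\<bar>" if q: "1 \<le> q" for p q :: int
  proof -
    have q1: "1 \<le> real_of_int q" using q by simp
    have pw: "real_of_int q powr (- max 1 e) \<le> 1" using powr_mono[of "- max 1 e" 0 "real_of_int q"] q1 by simp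
    show ?thesis
    proof (cases "(2 * p, q) \<in> ?F")
      case True
      then have "\<bar>l / 2 * real_of_int q - real_of_int (2 * p) / 2\<bar> \<in> D" unfolding D_def by (intro insertI2) (rule image_eqI[of _ _ "(2 * p, q)"], auto)
      then have "c \<le> \<bar>l / 2 * real_of_int q - real_of_int p\<bar>" using c_le by fastforce
      moreover have "c * real_of_int q powr (- max 1 e) \<le> c * 1" using pw c_pos by (intro mult_left_mono) auto
      ultimately show ?thesis by simp
    next
      case False
      then have "1 / real_of_int q powr e < \<bar>l - real_of_int (2 * p) / real_of_int q\<bar>" using q by simp
      then have "real_of_int q powr (- e) * (real_of_int q / 2) \<le> \<bar>l - real_of_int (2 * p) / real_of_int q\<bar> * (real_of_int q / 2)"
        using q1 by (intro mult_right_mono) (auto simp: powr_minus_divide)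
      also have "\<dots> = \<bar>(l - real_of_int (2 * p) / real_of_int q) * (real_of_int q / 2)\<bar>" using q1 by (simp add: abs_mult)
      also have "(l - real_of_int (2 * p) / real_of_int q) * (real_of_int q / 2) = l / 2 * real_of_int q - real_of_int p"
        using q1 by (simp add: field_simps)
      finally have 1: "real_of_int q powr (- e) * (real_of_int q / 2) \<le> \<bar>l / 2 * real_of_int q - real_of_int p\<bar>" .
      have "c \<le> 1/2" by (rule c_le) (simp add: D_def)
      then have "c * real_of_int q powr (- max 1 e) \<le> (real_of_int q / 2) * real_of_int q powr (- e)"
        using q1 c_pos by (intro mult_mono powr_mono) auto
      then show ?thesis using 1 by (simp add: mult.commute)
    qed
  qed
  then show thesis using that[of c "max 1 e"] c_pos by simp
qed

text \<open>With \<open>\<rho> = 1 - 2 * s\<close> and \<open>\<tau> = 1 + \<rho>\<close> the product \<open>s * (\<tau> + 1)\<close> is less than one by more than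
  \<open>\<rho> / 2\<close>, which leaves room for the terms with \<open>\<eta>\<close>.\<close>

lemma K_content_pos:
  assumes l: "0 < l" "l < 1" "diophantine l" and s: "0 < s" "s < 1/2"
  shows "hausdorff_content s (K l) \<noteq> 0"
proof -
  obtain c E where cE: "0 < c" "1 \<le> E"
    "\<And>p q :: int. 1 \<le> q \<Longrightarrow> c * real_of_int q powr (- E) \<le> \<bar>l / 2 * real_of_int q - real_of_int p\<bar>"
    using diophantine_exponent[OF l(3)] by blast
  define \<rho> where "\<rho> = 1 - 2 * s"
  have \<rho>: "0 < \<rho>" "\<rho> < 1" using s by (auto simp: \<rho>_def)
  define \<tau> where "\<tau> = 1 + \<rho>"
  have "1 < (1 + \<tau>) / 2" using \<rho> by (simp add: \<tau>_def)
  then obtain S where S: "2 * E / (\<rho> / 2) < ((1 + \<tau>) / 2) ^ S" using real_arch_pow by blast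
  define \<eta> where "\<eta> = min (\<rho>\<^sup>2 / 8) (\<rho> / (16 * E * 6 ^ S))"
  have \<eta>_bounds: "0 < \<eta>" "\<eta> \<le> \<rho>\<^sup>2 / 8" "\<eta> \<le> \<rho> / (16 * E * 6 ^ S)" using \<rho> cE(2) by (auto simp: \<eta>_def)
  interpret diophantine_exponents "l / 2" c E \<tau> \<eta> S
  proof
    show "2 * E < (\<tau> - 1) / 2 * ((1 + \<tau>) / 2) ^ S" using S \<rho> by (simp add: \<tau>_def pos_divide_less_eq mult.commute)
    show "2 * \<eta> * 6 ^ S \<le> (\<tau> - 1) / (8 * E)" using \<eta>_bounds(3) cE(2) by (simp add: \<tau>_def field_simps)
  qed (use cE \<rho> \<eta>_bounds in \<open>auto simp: \<tau>_def\<close>)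
  have "s * (\<tau> + 1 + 2 * \<eta>) \<le> 1 - 2 * \<eta> / (\<tau> - 1)"
  proof -
    have sq: "\<rho>\<^sup>2 \<le> \<rho>" using \<rho> by (simp add: power2_eq_square mult_le_cancel_left1)
    have "2 * \<eta> / \<rho> \<le> 2 * (\<rho>\<^sup>2 / 8) / \<rho>" using \<eta>_bounds(2) \<rho> by (intro divide_right_mono) auto
    also have "\<dots> = \<rho> / 4" using \<rho> by (simp add: power2_eq_square)
    finally have 1: "2 * \<eta> / \<rho> \<le> \<rho> / 4" .
    have "s * (2 * \<eta>) \<le> (1/2) * (2 * \<eta>)" using s \<eta>_bounds by (intro mult_right_mono) auto
    moreover have "s * \<rho> \<le> (1/2) * \<rho>" using s \<rho> by (intro mult_right_mono) auto
    moreover have "s * (\<tau> + 1 + 2 * \<eta>) = s * 2 + s * \<rho> + s * (2 * \<eta>)" by (simp add: \<tau>_def algebra_simps)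
    moreover have "s * 2 = 1 - \<rho>" by (simp add: \<rho>_def)
    ultimately have "s * (\<tau> + 1 + 2 * \<eta>) \<le> 1 - \<rho> / 4" using \<eta>_bounds(2) sq \<rho> by linarith
    then show ?thesis using 1 by (simp add: \<tau>_def)
  qed
  then have "hausdorff_content s (K (2 * (l / 2))) \<noteq> 0" using l s by (intro K_content_neq_0) auto
  then show ?thesis by simp
qed

theorem theorem2:
  fixes l :: real
  assumes "0 < l" and "l < 1"
    and "diophantine l"
  shows "hausdorff_dim (K l) = ereal (1 / 2)"
proof (rule hausdorff_dim_eqI)
  have "l / 2 \<notin> \<rat>"
  proof
    assume "l / 2 \<in> \<rat>"
    then have "2 * (l / 2) \<in> \<rat>" by (intro Rats_mult) auto
    then show False using diophantine_irrational[OF assms(3)] by simp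
  qed
  then show "hausdorff_content s (K l) = 0" if "1 / 2 < s" for s using that by (rule K_content_0)
  show "hausdorff_content s (K l) \<noteq> 0" if "0 < s" "s < 1 / 2" for s using assms that by (rule K_content_pos)
qed simp

end
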